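(* Fix $d\ge2$. For all sufficiently large $N$, the number of combinatorially distinct simplicial LC $d$-spheres with $N$ facets is not larger than $$\Big(d\cdot\big(\tfrac{d}{d-1}\big)^{d-1}\cdot 2^{\frac{2d^2-d}{3}}\Big)^N .$$ The same upper bound holds, for all sufficiently large $N$, for the number of combinatorially distinct simplicial LC $d$-balls with $N$ facets.
   Context: All complexes are finite. A simplicial $d$-sphere (resp. $d$-ball) is a simplicial complex whose underlying space is homeomorphic to the $d$-sphere (resp. $d$-ball); facets are its $d$-dimensional faces. Combinatorially distinct means non-isomorphic as simplicial complexes. LC (locally constructible): A regular CW complex is simplicial if every lower interval $[0,F]$ in its face poset is boolean. A $d$-pseudomanifold is a finite, pure $d$-dimensional, simplicial regular CW complex in which each $(d-1)$-cell belongs to at most two $d$-cells; its boundary is the smallest subcomplex containing all $(d-1)$-cells that lie in exactly one $d$-cell. For $d\ge2$, a local construction for a pure $d$-dimensional simplicial complex $C$ with $N$ facets is a sequence $T_1,\dots,T_N,\dots,T_k$ ($k\ge N$) of $d$-pseudomanifolds such that: (1) $T_1$ is a $d$-simplex; (2) for $i\le N-1$, $T_{i+1}$ is obtained from $T_i$ by gluing a new $d$-simplex to $T_i$ along one of the $(d-1)$-cells of $\partial T_i$; (3) for $i\ge N$, $T_{i+1}$ is obtained from $T_i$ by identifying a pair of $(d-1)$-cells $\sigma,\tau$ in $\partial T_i$ whose intersection contains a $(d-2)$-cell $F$ (the identification being the simplicial one that fixes $F$ pointwise); (4) $T_k=C$. $C$ is LC if a local construction for $C$ exists. *)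

theory Defs
  imports
    "HOL-Analysis.Analysis"
    "HOL-Analysis.Abstract_Euclidean_Space"
    "HOL-Analysis.Sum_Topology"
begin

section \<open>Balls and finite simplicial complexes\<close>

definition closed_unit_ball :: "nat \<Rightarrow> (nat \<Rightarrow> real) topology" where
  "closed_unit_ball n = subtopology (Euclidean_space n) {x. (\<Sum>i<n. (x i)\<^sup>2) \<le> 1}"

definition open_unit_ball_set :: "nat \<Rightarrow> (nat \<Rightarrow> real) set" where
  "open_unit_ball_set n = {x \<in> topspace (Euclidean_space n). (\<Sum>i<n. (x i)\<^sup>2) < 1}"

definition unit_sphere_set :: "nat \<Rightarrow> (nat \<Rightarrow> real) set" where
  "unit_sphere_set n = {x \<in> topspace (Euclidean_space n). (\<Sum>i<n. (x i)\<^sup>2) = 1}"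

text \<open>Only nonempty faces are recorded; a face with \<open>n + 1\<close> vertices has dimension \<open>n\<close>.\<close>

definition abstract_complex :: "'v set set \<Rightarrow> bool" where
  "abstract_complex C \<longleftrightarrow>
     finite C \<and> (\<forall>s\<in>C. finite s \<and> s \<noteq> {}) \<and> (\<forall>s\<in>C. \<forall>t. t \<subseteq> s \<and> t \<noteq> {} \<longrightarrow> t \<in> C)"

definition facets :: "nat \<Rightarrow> 'v set set \<Rightarrow> 'v set set" where
  "facets d C = {s \<in> C. card s = d + 1}"

definition pure_complex :: "nat \<Rightarrow> 'v set set \<Rightarrow> bool" where
  "pure_complex d C \<longleftrightarrow>
     abstract_complex C \<and> C \<noteq> {} \<and> (\<forall>s\<in>C. \<exists>t\<in>facets d C. s \<subseteq> t)"

definition simplicially_isomorphic :: "'v set set \<Rightarrow> 'w set set \<Rightarrow> bool" where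
  "simplicially_isomorphic C D \<longleftrightarrow> (\<exists>f. inj_on f (\<Union>C) \<and> D = (image f) ` C)"

text \<open>Points of the underlying space are given by their barycentric coordinates.\<close>

definition realization :: "'v set set \<Rightarrow> ('v \<Rightarrow> real) set" where
  "realization C =
     {x. (\<forall>v. 0 \<le> x v) \<and> {v. x v \<noteq> 0} \<in> C \<and> (\<Sum>v | x v \<noteq> 0. x v) = 1}"

definition simplicial_sphere :: "nat \<Rightarrow> 'v set set \<Rightarrow> bool" where
  "simplicial_sphere d C \<longleftrightarrow>
     abstract_complex C \<and> top_of_set (realization C) homeomorphic_space nsphere d"

definition simplicial_ball :: "nat \<Rightarrow> 'v set set \<Rightarrow> bool" where
  "simplicial_ball d C \<longleftrightarrow>
     abstract_complex C \<and> top_of_set (realization C) homeomorphic_space closed_unit_ball d"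


section \<open>Regular CW complexes\<close>

text \<open>\<open>cw_cells K n\<close> is the set of the closed \<open>n\<close>-cells, as subsets of the space.\<close>

record 'a cw_complex =
  cw_space :: "'a topology"
  cw_cells :: "nat \<Rightarrow> 'a set set"

text \<open>
  \<open>\<Phi> n e\<close> is a characteristic map of the \<open>n\<close>-cell \<open>e\<close>. Regularity means that it
  is a homeomorphism on the whole closed ball.
\<close>

definition finite_regular_cw :: "'a cw_complex \<Rightarrow> bool" where
  "finite_regular_cw K \<longleftrightarrow>
     Hausdorff_space (cw_space K) \<and>
     finite (SIGMA n:UNIV. cw_cells K n) \<and>
     (\<exists>\<Phi>.
        (\<forall>n. \<forall>e\<in>cw_cells K n.
           e \<subseteq> topspace (cw_space K) \<and>
           homeomorphic_map (closed_unit_ball n) (subtopology (cw_space K) e) (\<Phi> n e) \<and>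
           (\<exists>L \<subseteq> (\<Union>m<n. cw_cells K m). \<Phi> n e ` unit_sphere_set n = \<Union>L)) \<and>
        (\<forall>x\<in>topspace (cw_space K).
           \<exists>!p. p \<in> (SIGMA n:UNIV. cw_cells K n) \<and>
                x \<in> \<Phi> (fst p) (snd p) ` open_unit_ball_set (fst p)))"

text \<open>
  Faces are ordered by inclusion of closed cells; the empty set plays the role of the least
  element \<open>0\<close> of the face poset, so that this is the interval \<open>[0, e]\<close>.
\<close>

definition lower_interval :: "'a cw_complex \<Rightarrow> 'a set \<Rightarrow> 'a set set" where
  "lower_interval K e = insert {} {f. (\<exists>m. f \<in> cw_cells K m) \<and> f \<subseteq> e}"

definition boolean_interval :: "'a set set \<Rightarrow> bool" where
  "boolean_interval P \<longleftrightarrow>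
     (\<exists>(A::nat set) \<phi>. finite A \<and> bij_betw \<phi> (Pow A) P \<and>
        (\<forall>a\<in>Pow A. \<forall>b\<in>Pow A. \<phi> a \<subseteq> \<phi> b \<longleftrightarrow> a \<subseteq> b))"

definition simplicial_cw :: "'a cw_complex \<Rightarrow> bool" where
  "simplicial_cw K \<longleftrightarrow>
     finite_regular_cw K \<and> (\<forall>n. \<forall>e\<in>cw_cells K n. boolean_interval (lower_interval K e))"

definition pure_cw :: "nat \<Rightarrow> 'a cw_complex \<Rightarrow> bool" where
  "pure_cw d K \<longleftrightarrow>
     cw_cells K d \<noteq> {} \<and> (\<forall>n. \<forall>e\<in>cw_cells K n. \<exists>f\<in>cw_cells K d. e \<subseteq> f)"

definition pseudomanifold :: "nat \<Rightarrow> 'a cw_complex \<Rightarrow> bool" where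
  "pseudomanifold d K \<longleftrightarrow>
     simplicial_cw K \<and> pure_cw d K \<and>
     (\<forall>e\<in>cw_cells K (d - 1). card {f \<in> cw_cells K d. e \<subseteq> f} \<le> 2)"

text \<open>The \<open>n\<close>-cells of the boundary complex.\<close>

definition boundary_cells :: "nat \<Rightarrow> 'a cw_complex \<Rightarrow> nat \<Rightarrow> 'a set set" where
  "boundary_cells d K n =
     {e \<in> cw_cells K n.
        \<exists>r\<in>cw_cells K (d - 1). card {f \<in> cw_cells K d. r \<subseteq> f} = 1 \<and> e \<subseteq> r}"

definition cw_isomorphic :: "'a cw_complex \<Rightarrow> 'b cw_complex \<Rightarrow> bool" where
  "cw_isomorphic K L \<longleftrightarrow>
     (\<exists>f. homeomorphic_map (cw_space K) (cw_space L) f \<and>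
          (\<forall>n. cw_cells L n = (image f) ` cw_cells K n))"

definition cw_of_complex :: "'v set set \<Rightarrow> ('v \<Rightarrow> real) cw_complex" where
  "cw_of_complex C =
     \<lparr> cw_space = top_of_set (realization C),
       cw_cells = (\<lambda>n. (\<lambda>s. {x \<in> realization C. {v. x v \<noteq> 0} \<subseteq> s}) ` {s \<in> C. card s = n + 1}) \<rparr>"

definition simplex_cw :: "nat \<Rightarrow> (nat \<Rightarrow> real) cw_complex" where
  "simplex_cw d = cw_of_complex {s. s \<subseteq> {..d} \<and> s \<noteq> {}}"

definition cw_disjoint_union :: "'a cw_complex \<Rightarrow> 'a cw_complex \<Rightarrow> (bool \<times> 'a) cw_complex" where
  "cw_disjoint_union K L =
     \<lparr> cw_space = sum_topology (\<lambda>b. if b then cw_space L else cw_space K) UNIV,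
       cw_cells = (\<lambda>n. (\<lambda>e. {False} \<times> e) ` cw_cells K n \<union> (\<lambda>e. {True} \<times> e) ` cw_cells L n) \<rparr>"


section \<open>Local constructions\<close>

text \<open>
  \<open>K'\<close> is (up to isomorphism) the quotient of \<open>K\<close> under \<open>x \<sim> h x\<close>, where \<open>h\<close> is a
  homeomorphism of the closed cell \<open>\<sigma>\<close> onto the closed cell \<open>\<tau>\<close> that takes faces to faces
  and fixes \<open>\<sigma> \<inter> \<tau>\<close> pointwise.

  Regular CW complexes carry no affine structure, hence ``simplicial'' is expressed by the
  action on faces. If \<open>\<sigma>\<close> and \<open>\<tau>\<close> are \<open>(d - 1)\<close>-cells with boolean lower intervals and
  \<open>F \<subseteq> \<sigma> \<inter> \<tau>\<close> is a \<open>(d - 2)\<close>-cell, then the simplicial identification that fixes \<open>F\<close>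
  fixes all of \<open>\<sigma> \<inter> \<tau>\<close>: a vertex of \<open>\<sigma> \<inter> \<tau>\<close> outside \<open>F\<close> is the vertex opposite \<open>F\<close>
  both in \<open>\<sigma>\<close> and in \<open>\<tau>\<close>, so every vertex of a common face is fixed. Demanding this of \<open>h\<close>
  excludes maps that move points inside a common face. It also makes \<open>x \<sim> h x\<close>
  already transitive, so that no equivalence closure is needed.
\<close>

definition cell_identification ::
    "'a cw_complex \<Rightarrow> 'a set \<Rightarrow> 'a set \<Rightarrow> 'b cw_complex \<Rightarrow> bool" where
  "cell_identification K \<sigma> \<tau> K' \<longleftrightarrow>
     (\<exists>h q.
        homeomorphic_map (subtopology (cw_space K) \<sigma>) (subtopology (cw_space K) \<tau>) h \<and>
        (\<forall>n. (image h) ` {e \<in> cw_cells K n. e \<subseteq> \<sigma>} = {e \<in> cw_cells K n. e \<subseteq> \<tau>}) \<and>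
        (\<forall>x\<in>\<sigma> \<inter> \<tau>. h x = x) \<and>
        quotient_map (cw_space K) (cw_space K') q \<and>
        (\<forall>x\<in>topspace (cw_space K). \<forall>y\<in>topspace (cw_space K).
           q x = q y \<longleftrightarrow> x = y \<or> (x \<in> \<sigma> \<and> y = h x) \<or> (y \<in> \<sigma> \<and> x = h y)) \<and>
        (\<forall>n. cw_cells K' n = (image q) ` cw_cells K n))"

definition glue_simplex_step ::
    "nat \<Rightarrow> (nat \<Rightarrow> real) cw_complex \<Rightarrow> (nat \<Rightarrow> real) cw_complex \<Rightarrow> bool" where
  "glue_simplex_step d K K' \<longleftrightarrow>
     (\<exists>\<sigma>\<in>boundary_cells d K (d - 1). \<exists>\<rho>\<in>cw_cells (simplex_cw d) (d - 1).
        cell_identification (cw_disjoint_union K (simplex_cw d))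
          ({False} \<times> \<sigma>) ({True} \<times> \<rho>) K')"

definition identify_step ::
    "nat \<Rightarrow> (nat \<Rightarrow> real) cw_complex \<Rightarrow> (nat \<Rightarrow> real) cw_complex \<Rightarrow> bool" where
  "identify_step d K K' \<longleftrightarrow>
     (\<exists>\<sigma>\<in>boundary_cells d K (d - 1). \<exists>\<tau>\<in>boundary_cells d K (d - 1).
        \<sigma> \<noteq> \<tau> \<and> (\<exists>F\<in>cw_cells K (d - 2). F \<subseteq> \<sigma> \<inter> \<tau>) \<and> cell_identification K \<sigma> \<tau> K')"

text \<open>
  The intermediate complexes live on topologies over \<open>nat \<Rightarrow> real\<close>. This is no restriction,
  because a finite CW complex has at most continuum many points and the topology on them is
  arbitrary.
\<close>

definition local_construction ::
    "nat \<Rightarrow> nat set set \<Rightarrow> nat \<Rightarrow> nat \<Rightarrow> (nat \<Rightarrow> (nat \<Rightarrow> real) cw_complex) \<Rightarrow> bool" where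
  "local_construction d C N k T \<longleftrightarrow>
     1 \<le> N \<and> N \<le> k \<and>
     (\<forall>i\<in>{1..k}. pseudomanifold d (T i)) \<and>
     cw_isomorphic (T 1) (simplex_cw d) \<and>
     (\<forall>i\<in>{1..<N}. glue_simplex_step d (T i) (T (i + 1))) \<and>
     (\<forall>i\<in>{N..<k}. identify_step d (T i) (T (i + 1))) \<and>
     cw_isomorphic (T k) (cw_of_complex C)"

definition locally_constructible :: "nat \<Rightarrow> nat set set \<Rightarrow> bool" where
  "locally_constructible d C \<longleftrightarrow>
     pure_complex d C \<and> (\<exists>k T. local_construction d C (card (facets d C)) k T)"


section \<open>Counting up to isomorphism\<close>

text \<open>Every finite simplicial complex is isomorphic to one whose vertices are natural numbers.\<close>

definition LC_spheres :: "nat \<Rightarrow> nat \<Rightarrow> nat set set set" where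
  "LC_spheres d N =
     {C. simplicial_sphere d C \<and> locally_constructible d C \<and> card (facets d C) = N}"

definition LC_balls :: "nat \<Rightarrow> nat \<Rightarrow> nat set set set" where
  "LC_balls d N =
     {C. simplicial_ball d C \<and> locally_constructible d C \<and> card (facets d C) = N}"

definition isomorphism_types :: "'v set set set \<Rightarrow> 'v set set set set" where
  "isomorphism_types S = S // {(C, D). C \<in> S \<and> D \<in> S \<and> simplicially_isomorphic C D}"

lemma equiv_simplicially_isomorphic:
  "equiv S {(C, D). C \<in> S \<and> D \<in> S \<and> simplicially_isomorphic C D}"
proof (rule equivI)
  show "{(C, D). C \<in> S \<and> D \<in> S \<and> simplicially_isomorphic C D} \<subseteq> S \<times> S" by auto
  show "refl_on S {(C, D). C \<in> S \<and> D \<in> S \<and> simplicially_isomorphic C D}"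
    unfolding refl_on_def simplicially_isomorphic_def by (auto intro!: exI[of _ id])
  show "sym {(C, D). C \<in> S \<and> D \<in> S \<and> simplicially_isomorphic C D}"
  proof (rule symI, clarsimp)
    fix C D :: "'a set set"
    assume "simplicially_isomorphic C D"
    then obtain f where f: "inj_on f (\<Union>C)" "D = (image f) ` C"
      unfolding simplicially_isomorphic_def by blast
    let ?g = "inv_into (\<Union>C) f"
    have "\<Union>D = f ` \<Union>C" using f(2) by blast
    then have "inj_on ?g (\<Union>D)" by (simp add: inj_on_inv_into)
    moreover have "?g ` f ` s = s" if "s \<in> C" for s
      using that f(1) by (intro inv_into_image_cancel) auto
    then have "C = (image ?g) ` D" unfolding f(2) image_image by simp
    ultimately show "simplicially_isomorphic D C"
      unfolding simplicially_isomorphic_def by blast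
  qed
  show "trans {(C, D). C \<in> S \<and> D \<in> S \<and> simplicially_isomorphic C D}"
  proof (rule transI, clarsimp)
    fix C D E :: "'a set set"
    assume "simplicially_isomorphic C D" "simplicially_isomorphic D E"
    then obtain f g where f: "inj_on f (\<Union>C)" "D = (image f) ` C"
      and g: "inj_on g (\<Union>D)" "E = (image g) ` D"
      unfolding simplicially_isomorphic_def by blast
    have "\<Union>D = f ` \<Union>C" using f(2) by blast
    then have "inj_on (g \<circ> f) (\<Union>C)" using f(1) g(1) by (simp add: comp_inj_on)
    moreover have "E = (image (g \<circ> f)) ` C" by (simp add: f(2) g(2) image_image image_comp)
    ultimately show "simplicially_isomorphic C E"
      unfolding simplicially_isomorphic_def by blast
  qed
qed

end

(*
  Only the face posets of the complexes T_i matter. After T_N they are obtained from N labelled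
  d-simplices by a set of gluings of facets, and the face poset of C is determined by that set.

  The tree T_N: simplices are labelled by words in the colours 0..d (the path from the first simplex),
  and the simplex a # w is attached to w along the facet opposite the vertex a, by the identity on
  vertices. So T_N is a suffix-closed set of N words without repeated neighbouring letters.
  Deciding one boundary facet after the other whether it carries a further simplex shows that there are
  at most a constant times (d * (d/(d-1))^(d-1))^N such sets.

  The identifications: a facet of the boundary and a ridge in it have exactly one partner facet, found by
  walking around the ridge until an unglued facet is reached. Hence an identification is the choice of a
  pair of partners. Gluing it creates at most d - 1 new pairs of partners, and no pair disappears unless
  one of its facets is glued. So the final set of gluings is independent of the order, and it can be read
  off by deciding one pair after the other, new pairs included, whether it is glued in C. There are about
  d (d-1) N / 2 initial pairs and at most about (d-1) N / 2 positive decisions, so that the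
  branching bound gives at most ((3/2)^(2d-1) * 2)^((d-1)N/2) outcomes up to a constant. Since
  3/2 < 2^(3/5), this is exponentially smaller than 2^((2d^2-d)N/3), which absorbs the constants.
*)
theory Submission
  imports Defs
begin

text \<open>Two obstacles shape the development. The definition is topological, but the argument
  must know which cells coincide in a quotient. Every closed cell has a generic point, contained
  only in cells that contain the whole cell; an inclusion of images under the quotient map is tested
  at that point and lifted back. This lifting cannot prevent two faces of one simplex from merging.
  The boolean intervals required of every intermediate complex do, by a count of the cells below a
  d-cell. The second obstacle is that positive decisions create new open ones, so the number of
  decisions is not fixed in advance. A state with m open decisions and at most k positive ones left
  is charged y^m / x^k; the best x for a given y is (y - 1) / y^b. If the tree has n free facets,
  there are about dn/2 open pairs, n/2 positive decisions, and b = d - 1, so the charge is (y^(2d-1)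
  / (y - 1))^(n/2). Its minimum is at y = (2d-1) / (2d-2), which is 3/2 for d = 2; the constant 3/2
  is good enough for every d.\<close>

section \<open>Counting by binary branching\<close>

text \<open>Each decision replaces the state by one of smaller size, or uses up one unit of \<open>k\<close> and creates
  at most \<open>b\<close> new open decisions; \<open>1 + x * y ^ b \<le> y\<close> makes \<open>y ^ sz s / x ^ k\<close> superadditive under this
  recursion.\<close>

lemma branching_count:
  fixes T :: "'s \<Rightarrow> nat \<Rightarrow> 'm set" and sz :: "'s \<Rightarrow> nat" and x y :: real
  assumes x: "x > 0" and x1: "x \<le> 1" and y: "y \<ge> 1" and xy: "1 + x * y ^ b \<le> y"
    and leaf: "\<And>s k. I s \<Longrightarrow> sz s = 0 \<Longrightarrow> finite (T s k) \<and> card (T s k) \<le> 1"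
    and branch: "\<And>s k. I s \<Longrightarrow> sz s > 0 \<Longrightarrow> \<exists>s1 s2. I s1 \<and> sz s1 < sz s \<and>
        (k > 0 \<longrightarrow> I s2 \<and> sz s2 + 1 \<le> sz s + b) \<and>
        T s k \<subseteq> T s1 k \<union> (if k = 0 then {} else T s2 (k - 1))"
    and "I s"
  shows "finite (T s k) \<and> real (card (T s k)) \<le> y ^ sz s / x ^ k"
  using \<open>I s\<close>
\<comment> \<open>A positive decision may enlarge the state, so the induction is lexicographic:
  first on the budget \<open>k\<close>, then on \<open>sz s\<close>.\<close>
proof (induction k arbitrary: s)
  case outer: 0
  then show ?case
  proof (induction "sz s" arbitrary: s rule: less_induct)
    case less
    show ?case
    proof (cases "sz s = 0")
      case True
      then show ?thesis using leaf[OF less(2), of 0] by auto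
    next
      case False
      then obtain s1 where s1: "I s1" "sz s1 < sz s" "T s 0 \<subseteq> T s1 0"
        using branch[OF less(2), of 0] by auto
      have IH: "finite (T s1 0) \<and> real (card (T s1 0)) \<le> y ^ sz s1 / x ^ 0"
        using less(1) s1 by blast
      have "real (card (T s 0)) \<le> card (T s1 0)" using IH s1 by (simp add: card_mono)
      also have "\<dots> \<le> y ^ sz s1" using IH by simp
      also have "\<dots> \<le> y ^ sz s" using s1 y by (intro power_increasing) auto
      finally show ?thesis using IH s1 finite_subset by fastforce
    qed
  qed
next
  case outer: (Suc k)
  from \<open>I s\<close> show ?case
  proof (induction "sz s" arbitrary: s rule: less_induct)
    case less
    show ?case
    proof (cases "sz s = 0")
      case True
      then have *: "finite (T s (Suc k)) \<and> card (T s (Suc k)) \<le> 1" using leaf[OF less(2)] by blast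
      have "x ^ Suc k \<le> 1"
        using x x1 by (intro power_le_one) auto
      then have "1 \<le> 1 / x ^ Suc k" using x by simp
      then show ?thesis using * True by (metis of_nat_1 of_nat_le_iff order_trans power_0)
    next
      case False
      then obtain s1 s2 where s1: "I s1" "sz s1 < sz s" and s2: "I s2" "sz s2 + 1 \<le> sz s + b"
        and T: "T s (Suc k) \<subseteq> T s1 (Suc k) \<union> T s2 k"
        using branch[OF less(2), of "Suc k"] by auto
      have IH1: "finite (T s1 (Suc k)) \<and> real (card (T s1 (Suc k))) \<le> y ^ sz s1 / x ^ Suc k"
        using less(1) s1 by blast
      have IH2: "finite (T s2 k) \<and> real (card (T s2 k)) \<le> y ^ sz s2 / x ^ k"
        using outer.IH s2 by blast
      have fin: "finite (T s (Suc k))" using T IH1 IH2 finite_subset by blast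
      have "card (T s (Suc k)) \<le> card (T s1 (Suc k)) + card (T s2 k)"
        using card_mono[OF _ T] IH1 IH2 card_Un_le[of "T s1 (Suc k)" "T s2 k"] by fastforce
      then have "real (card (T s (Suc k))) \<le> y ^ sz s1 / x ^ Suc k + y ^ sz s2 / x ^ k"
        using IH1 IH2 by linarith
      also have "\<dots> \<le> y ^ (sz s - 1) / x ^ Suc k + y ^ (sz s - 1 + b) / x ^ k"
        using s1 s2 x y by (intro add_mono divide_right_mono power_increasing) auto
      also have "\<dots> = y ^ (sz s - 1) * (1 + x * y ^ b) / x ^ Suc k"
        using x by (simp add: field_simps power_add)
      also have "\<dots> \<le> y ^ (sz s - 1) * y / x ^ Suc k"
        using x y xy by (intro divide_right_mono mult_left_mono) auto
      also have "\<dots> = y ^ sz s / x ^ Suc k" using False by (metis power_minus_mult neq0_conv mult.commute)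
      finally show ?thesis using fin by blast
    qed
  qed
qed

section \<open>The trees of simplices and their number\<close>

text \<open>The head of a word is the facet crossed last, so tails are ancestors. The facet
  \<open>hd w\<close> of \<open>w\<close> already carries the parent, which is why a child must
  differ in colour from \<open>hd w\<close>.\<close>

definition simplex_tree :: "nat \<Rightarrow> nat list set \<Rightarrow> bool" where
  "simplex_tree d W \<longleftrightarrow>
     finite W \<and> [] \<in> W \<and> (\<forall>a w. a # w \<in> W \<longrightarrow> w \<in> W \<and> a \<le> d \<and> (w \<noteq> [] \<longrightarrow> a \<noteq> hd w))"

lemma simplex_tree_insert:
  assumes "simplex_tree d W" "w \<in> W" "a \<le> d" "w \<noteq> [] \<longrightarrow> a \<noteq> hd w"
  shows "simplex_tree d (insert (a # w) W)"
  using assms unfolding simplex_tree_def by auto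

lemma simplex_tree_Un:
  "simplex_tree d V \<Longrightarrow> simplex_tree d W \<Longrightarrow> simplex_tree d (V \<union> W)"
  unfolding simplex_tree_def by blast

text \<open>A state \<open>(W, U)\<close> has accepted the words in \<open>W\<close>, leaves those
  in \<open>U\<close> open and has rejected every other child of a word in \<open>W\<close>.
  Accepting a word closes it and opens its children in the d colours other than its head, hence
  \<open>b = d\<close>.\<close>

lemma simplex_trees_count_aux:
  fixes x y :: real
  assumes x: "x > 0" "x \<le> 1" "y \<ge> 1" "1 + x * y ^ d \<le> y"
    and sW: "simplex_tree d W" and U: "finite U" "\<forall>u\<in>U. u \<notin> W \<and> simplex_tree d (insert u W)"
  defines "T \<equiv> (\<lambda>(W, U) k. {V. simplex_tree d V \<and> W \<subseteq> V \<and> card (V - W) \<le> k \<and>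
      (\<forall>w\<in>W. \<forall>a. a # w \<in> V \<longrightarrow> a # w \<in> W \<union> U)})"
  shows "finite (T (W, U) k) \<and> real (card (T (W, U) k)) \<le> y ^ card U / x ^ k"
proof -
  let ?I = "\<lambda>(W, U). simplex_tree d W \<and> finite U \<and> (\<forall>u\<in>U. u \<notin> W \<and> simplex_tree d (insert u W))"
  let ?sz = "\<lambda>(W, U). card U"
  have "finite (T (W, U) k) \<and> real (card (T (W, U) k)) \<le> y ^ ?sz (W, U) / x ^ k"
  proof (rule branching_count[where I = ?I and T = T and b = d])
    show "?I (W, U)" using sW U by auto
  next
    fix s k assume I: "?I s" and z: "?sz s = 0"
    obtain W U where s: "s = (W, U)" by force
    have U: "U = {}" using I z s by auto
    have "T s k \<subseteq> {W}"
    proof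
      fix V assume V: "V \<in> T s k"
      have sV: "simplex_tree d V" using V s unfolding T_def by simp
      \<comment> \<open>With nothing open, a child in \<open>V\<close> of a word of \<open>W\<close>
        is again in \<open>W\<close>, so \<open>V\<close> cannot leave \<open>W\<close> on any path
        from the root.\<close>
      have "v \<in> V \<Longrightarrow> v \<in> W" for v
      proof (induction v)
        case Nil
        then show ?case using I s by (auto simp: simplex_tree_def)
      next
        case (Cons a w)
        then have "w \<in> V" using sV unfolding simplex_tree_def by blast
        then have "w \<in> W" using Cons by simp
        then show ?case using V s U Cons unfolding T_def by auto
      qed
      moreover have "W \<subseteq> V" using V s unfolding T_def by auto
      ultimately show "V \<in> {W}" by auto
    qed
    then show "finite (T s k) \<and> card (T s k) \<le> 1"
      using card_mono[of "{W}" "T s k"] finite_subset[of "T s k" "{W}"] by auto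
  next
    fix s k assume I: "?I s" and z: "0 < ?sz s"
    obtain W U where s: "s = (W, U)" by force
    then have "U \<noteq> {}" using z by auto
    then obtain u where u: "u \<in> U" by blast
    have fU: "finite U" and uW: "u \<notin> W" and st: "simplex_tree d (insert u W)"
      and sW: "simplex_tree d W" using I s u by auto
    obtain a w where aw: "u = a # w" using uW sW by (cases u) (auto simp: simplex_tree_def)
    then have ad: "a \<le> d" using st unfolding simplex_tree_def by blast
    let ?ch = "(\<lambda>c. c # u) ` ({..d} - {a})"
    let ?s1 = "(W, U - {u})" and ?s2 = "(insert u W, (U - {u}) \<union> ?ch)"
    have cch: "card ?ch \<le> d" using card_image_le[of "{..d} - {a}" "\<lambda>c. c # u"] ad by simp
    have cU: "card (U - {u}) + 1 = card U" using fU u by (metis Suc_eq_plus1 card_Suc_Diff1)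
    have cU2: "card (U - {u} \<union> ?ch) + 1 \<le> card U + d"
      using card_Un_le[of "U - {u}" ?ch] cch cU by linarith
    have chW: "c # u \<notin> insert u W" for c
      using uW sW unfolding simplex_tree_def by auto
    have I2: "?I ?s2"
    proof -
      have "simplex_tree d (insert v (insert u W))" if "v \<in> U" for v
        using simplex_tree_Un[of d "insert v W" "insert u W"] that I s st by (auto simp: insert_commute)
      moreover have "simplex_tree d (insert (c # u) (insert u W))" if "c \<le> d" "c \<noteq> a" for c
        using simplex_tree_insert[OF st, of u c] that aw by auto
      ultimately show ?thesis using st chW I s by auto
    qed
    have TT: "V \<in> T ?s1 k \<union> (if k = 0 then {} else T ?s2 (k - 1))" if V: "V \<in> T s k" for V
    proof (cases "u \<in> V")
      case False
      then show ?thesis using V unfolding T_def s by auto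
    next
      case True
      have V1: "simplex_tree d V" "W \<subseteq> V" "card (V - W) \<le> k"
        and V2: "\<And>w a. w \<in> W \<Longrightarrow> a # w \<in> V \<Longrightarrow> a # w \<in> W \<union> U"
        using V s unfolding T_def by auto
      have fV: "finite V" using V1 unfolding simplex_tree_def by auto
      have c: "card (V - W) = Suc (card (V - insert u W))"
        using True fV uW by (metis Diff_iff Diff_insert card_Suc_Diff1 finite_Diff)
      have "c \<le> d \<and> c \<noteq> a" if "c # u \<in> V" for c
        using V1(1) that aw unfolding simplex_tree_def by fastforce
      then have "V \<in> T ?s2 (k - 1)" using V1 V2 True c unfolding T_def by auto
      then show ?thesis using c V1 by auto
    qed
    show "\<exists>s1 s2. ?I s1 \<and> ?sz s1 < ?sz s \<and> (0 < k \<longrightarrow> ?I s2 \<and> ?sz s2 + 1 \<le> ?sz s + d) \<and>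
       T s k \<subseteq> T s1 k \<union> (if k = 0 then {} else T s2 (k - 1))"
    proof (intro exI conjI)
      show "?I ?s1" using I s by auto
      show "?sz ?s1 < ?sz s" using cU s by auto
      show "0 < k \<longrightarrow> ?I ?s2 \<and> ?sz ?s2 + 1 \<le> ?sz s + d" using I2 cU2 s by auto
      show "T s k \<subseteq> T ?s1 k \<union> (if k = 0 then {} else T ?s2 (k - 1))" using TT by blast
    qed
  qed (use x in auto)
  then show ?thesis by simp
qed

text \<open>The root is accepted at the start and, having no parent, has d + 1 open children; they
  contribute the factor \<open>y ^ (d + 1)\<close>, which does not depend on
  \<open>N\<close>.\<close>

lemma simplex_trees_count:
  fixes x y :: real
  assumes x: "x > 0" "x \<le> 1" "y \<ge> 1" "1 + x * y ^ d \<le> y"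
  shows "finite {W. simplex_tree d W \<and> card W = N} \<and>
    real (card {W. simplex_tree d W \<and> card W = N}) \<le> y ^ (d + 1) / x ^ N"
proof -
  let ?U = "(\<lambda>c. [c]) ` {..d}"
  have "simplex_tree d {[]}" unfolding simplex_tree_def by auto
  moreover have "\<forall>u\<in>?U. u \<notin> {[]} \<and> simplex_tree d (insert u {[]})"
    unfolding simplex_tree_def by auto
  moreover define T where "T = {V. simplex_tree d V \<and> {[]} \<subseteq> V \<and> card (V - {[]}) \<le> N \<and>
      (\<forall>w\<in>{[]}. \<forall>a. a # w \<in> V \<longrightarrow> a # w \<in> {[]} \<union> ?U)}"
  ultimately have T: "finite T \<and> real (card T) \<le> y ^ card ?U / x ^ N"
    using simplex_trees_count_aux[OF x, of "{[]}" ?U N] by auto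
  have "{W. simplex_tree d W \<and> card W = N} \<subseteq> T"
    unfolding T_def simplex_tree_def by (auto intro: order_trans[OF card_Diff1_le])
  moreover have "card ?U = d + 1" by (subst card_image) (auto simp: inj_on_def)
  ultimately show ?thesis using T
    by (metis (lifting) card_mono finite_subset of_nat_le_iff order_trans)
qed

section \<open>Gluings and their partner ridges\<close>

text \<open>\<open>(w, a)\<close> is the facet opposite the vertex \<open>a\<close> of the simplex \<open>w\<close>. A gluing \<open>((w, a), (v, b), \<pi>)\<close>
  identifies the vertex \<open>i \<noteq> a\<close> of \<open>w\<close> with the vertex \<open>\<pi> i\<close> of \<open>v\<close>; by convention \<open>\<pi> a = b\<close>.\<close>

type_synonym facet = "nat list \<times> nat"
type_synonym gluing = "facet \<times> facet \<times> (nat \<Rightarrow> nat)"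

definition glued :: "gluing set \<Rightarrow> facet set" where
  "glued M = fst ` M"

definition rev_gluing :: "gluing \<Rightarrow> gluing" where
  "rev_gluing m = (case m of (\<sigma>, \<tau>, \<pi>) \<Rightarrow> (\<tau>, \<sigma>, inv \<pi>))"

text \<open>Both orientations of a gluing are stored, so \<open>M\<close> is a symmetric partial map
  on facets. Extending the bijection of two facets to a permutation of \<open>{..d}\<close>, with
  the identity elsewhere, gives each gluing a unique representing function; only then do equality of
  gluings and \<open>single_valued\<close> mean what they should.\<close>

definition gluing_set :: "nat \<Rightarrow> nat list set \<Rightarrow> gluing set \<Rightarrow> bool" where
  "gluing_set d W M \<longleftrightarrow> finite M \<and>
     (\<forall>\<sigma> \<tau> \<pi>. (\<sigma>, \<tau>, \<pi>) \<in> M \<longrightarrow> (\<tau>, \<sigma>, inv \<pi>) \<in> M \<and> \<sigma> \<noteq> \<tau> \<and> fst \<sigma> \<in> W \<and> snd \<sigma> \<le> d \<and>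
        \<pi> permutes {..d} \<and> \<pi> (snd \<sigma>) = snd \<tau>) \<and>
     single_valued M"

text \<open>A walk around the ridge of \<open>w\<close> opposite \<open>{a, c}\<close> enters \<open>w\<close> through the facet \<open>(w, a)\<close>. In a state
  \<open>(\<mu>, \<rho>)\<close> it is about to leave a simplex through the facet \<open>\<mu>\<close>; the permutation \<open>\<rho>\<close> transports the vertices
  of the ridge, takes \<open>a\<close> to the vertex opposite \<open>\<mu>\<close>, and takes \<open>c\<close> to the vertex opposite the facet of entry.\<close>

definition walk_step :: "gluing set \<Rightarrow> nat \<Rightarrow> ((facet \<times> (nat \<Rightarrow> nat)) \<times> (facet \<times> (nat \<Rightarrow> nat))) set" where
  "walk_step M c = {((\<mu>, \<rho>), ((v, \<pi> (\<rho> c)), Transposition.transpose b (\<pi> (\<rho> c)) \<circ> \<pi> \<circ> \<rho>)) |\<mu> \<rho> v b \<pi>. (\<mu>, (v, b), \<pi>) \<in> M}"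

definition walk :: "gluing set \<Rightarrow> facet \<Rightarrow> nat \<Rightarrow> (facet \<times> (nat \<Rightarrow> nat)) set" where
  "walk M \<sigma> c = {s. (((fst \<sigma>, c), Transposition.transpose (snd \<sigma>) c), s) \<in> (walk_step M c)\<^sup>*}"

lemma walk_base: "((w, c), Transposition.transpose a c) \<in> walk M (w, a) c"
  by (simp add: walk_def)

lemma walk_extend:
  "(\<mu>, \<rho>) \<in> walk M \<sigma> c \<Longrightarrow> (\<mu>, (v, b), \<pi>) \<in> M \<Longrightarrow>
   ((v, \<pi> (\<rho> c)), Transposition.transpose b (\<pi> (\<rho> c)) \<circ> \<pi> \<circ> \<rho>) \<in> walk M \<sigma> c"
proof -
  assume a: "(\<mu>, \<rho>) \<in> walk M \<sigma> c" "(\<mu>, (v, b), \<pi>) \<in> M"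
  have "((\<mu>, \<rho>), ((v, \<pi> (\<rho> c)), Transposition.transpose b (\<pi> (\<rho> c)) \<circ> \<pi> \<circ> \<rho>)) \<in> walk_step M c"
    unfolding walk_step_def mem_Collect_eq using a(2) by (intro exI conjI) (rule refl)
  with a(1)[unfolded walk_def mem_Collect_eq] show ?thesis
    unfolding walk_def mem_Collect_eq by (rule rtrancl_into_rtrancl)
qed

lemma walk_induct [consumes 1, case_names base extend]:
  assumes "(\<mu>, \<rho>) \<in> walk M (w, a) c"
    and "P (w, c) (Transposition.transpose a c)"
    and "\<And>\<mu> \<rho> v b \<pi>. (\<mu>, \<rho>) \<in> walk M (w, a) c \<Longrightarrow> P \<mu> \<rho> \<Longrightarrow> (\<mu>, (v, b), \<pi>) \<in> M \<Longrightarrow>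
      P (v, \<pi> (\<rho> c)) (Transposition.transpose b (\<pi> (\<rho> c)) \<circ> \<pi> \<circ> \<rho>)"
  shows "P \<mu> \<rho>"
proof -
  have "(((w, c), Transposition.transpose a c), (\<mu>, \<rho>)) \<in> (walk_step M c)\<^sup>*" using assms(1) by (simp add: walk_def)
  then have "P (fst (\<mu>, \<rho>)) (snd (\<mu>, \<rho>)) \<and> (\<mu>, \<rho>) \<in> walk M (w, a) c"
  proof (induction rule: rtrancl_induct)
    case base
    then show ?case using assms(2) walk_base by auto
  next
    case (step s t)
    then obtain \<mu> \<rho> v b \<pi> where "s = (\<mu>, \<rho>)" "t = ((v, \<pi> (\<rho> c)), Transposition.transpose b (\<pi> (\<rho> c)) \<circ> \<pi> \<circ> \<rho>)"
      "(\<mu>, (v, b), \<pi>) \<in> M" unfolding walk_step_def by blast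
    with step show ?case using assms(3)[of \<mu> \<rho> v b \<pi>] walk_extend[of \<mu> \<rho> M "(w, a)" c v b \<pi>]
      by (simp only: fst_conv snd_conv simp_thms)
  qed
  then show ?thesis by simp
qed

lemma walk_mono: "M \<subseteq> M' \<Longrightarrow> walk M \<sigma> c \<subseteq> walk M' \<sigma> c"
proof -
  assume "M \<subseteq> M'"
  then have "walk_step M c \<subseteq> walk_step M' c" unfolding walk_step_def by blast
  then show ?thesis unfolding walk_def using rtrancl_mono by blast
qed

context
  fixes d W M
  assumes gs: "gluing_set d W M"
begin

lemma gluing_setD:
  assumes "(\<sigma>, \<tau>, \<pi>) \<in> M"
  shows "(\<tau>, \<sigma>, inv \<pi>) \<in> M" "\<sigma> \<noteq> \<tau>" "fst \<sigma> \<in> W" "snd \<sigma> \<le> d" "fst \<tau> \<in> W" "snd \<tau> \<le> d"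
    "\<pi> permutes {..d}" "\<pi> (snd \<sigma>) = snd \<tau>" "\<sigma> \<in> glued M" "\<tau> \<in> glued M"
proof -
  have "\<forall>\<sigma> \<tau> \<pi>. (\<sigma>, \<tau>, \<pi>) \<in> M \<longrightarrow> (\<tau>, \<sigma>, inv \<pi>) \<in> M \<and> \<sigma> \<noteq> \<tau> \<and> fst \<sigma> \<in> W \<and> snd \<sigma> \<le> d \<and>
        \<pi> permutes {..d} \<and> \<pi> (snd \<sigma>) = snd \<tau>"
    using gs unfolding gluing_set_def by (elim conjE)
  note * = this[rule_format]
  note 1 = *[OF assms]
  note 2 = *[OF 1[THEN conjunct1]]
  show "(\<tau>, \<sigma>, inv \<pi>) \<in> M" "\<sigma> \<noteq> \<tau>" "fst \<sigma> \<in> W" "snd \<sigma> \<le> d" "fst \<tau> \<in> W" "snd \<tau> \<le> d"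
    "\<pi> permutes {..d}" "\<pi> (snd \<sigma>) = snd \<tau>" using 1 2 by simp_all
  show "\<sigma> \<in> glued M" "\<tau> \<in> glued M"
    unfolding glued_def using assms 1 by (metis fst_conv image_eqI)+
qed

lemma glued_unique:
  "(\<sigma>, \<tau>, \<pi>) \<in> M \<Longrightarrow> (\<sigma>, \<tau>', \<pi>') \<in> M \<Longrightarrow> \<tau> = \<tau>' \<and> \<pi> = \<pi>'"
  using gs unfolding gluing_set_def single_valued_def by blast

lemma walk_invariant:
  assumes "(\<mu>, \<rho>) \<in> walk M (w, a) c" "a \<le> d" "c \<le> d" "w \<in> W"
  shows "\<rho> permutes {..d} \<and> \<rho> a = snd \<mu> \<and> fst \<mu> \<in> W \<and> snd \<mu> \<le> d"
  using assms(1)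
proof (induction rule: walk_induct)
  case base
  then show ?case using assms permutes_swap_id[of a "{..d}" c] by auto
next
  case (extend \<mu> \<rho> v b \<pi>)
  have \<pi>: "\<pi> permutes {..d}" "b \<le> d" "v \<in> W" "\<pi> (snd \<mu>) = b"
    using gluing_setD[OF extend.hyps(2)] by auto
  have "\<rho> c \<le> d" using extend.IH assms(3) permutes_in_image by fastforce
  then have "\<pi> (\<rho> c) \<le> d" using \<pi>(1) permutes_in_image by fastforce
  moreover have "(Transposition.transpose b (\<pi> (\<rho> c)) \<circ> \<pi> \<circ> \<rho>) permutes {..d}"
    using calculation \<pi> extend.IH by (intro permutes_compose permutes_swap_id) auto
  moreover have "(Transposition.transpose b (\<pi> (\<rho> c)) \<circ> \<pi> \<circ> \<rho>) a = \<pi> (\<rho> c)" using \<pi> extend.IH by simp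
  ultimately show ?case using \<pi> by (simp add: comp_def)
qed

text \<open>Just after crossing \<open>\<mu>\<close> the walk is in the position of a fresh walk
  that entered through \<open>(v, b)\<close>, up to the transport accumulated so far. This allows
  walks to be built from the front, as their reversal requires.\<close>

lemma walk_prepend:
  assumes "(\<kappa>, \<theta>) \<in> walk M (v, b) (\<pi> (\<rho> c))" and "(\<mu>, \<rho>) \<in> walk M \<sigma> c" "(\<mu>, (v, b), \<pi>) \<in> M"
  shows "(\<kappa>, \<theta> \<circ> \<pi> \<circ> \<rho>) \<in> walk M \<sigma> c"
  using assms(1)
proof (induction rule: walk_induct)
  case base
  then show ?case using walk_extend assms by blast
next
  case (extend \<mu>' \<rho>' v' b' \<pi>')
  then show ?case using walk_extend[OF extend.IH extend.hyps(2)] by (simp add: comp_def)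
qed

text \<open>Turning around exchanges entry and exit: the walk that enters through
  \<open>\<mu>\<close> and omits \<open>\<rho> c\<close> first leaves through the facet by which the
  original walk came in. The reverse of an extended walk is one step back followed by the reverse of
  the shorter walk.\<close>

lemma walk_reverse:
  assumes "(\<mu>, \<rho>) \<in> walk M (w, a) c" "a \<le> d" "c \<le> d" "w \<in> W"
  shows "((w, a), inv \<rho>) \<in> walk M \<mu> (\<rho> c)"
  using assms(1)
proof (induction rule: walk_induct)
  case base
  show ?case using walk_base[of w a c M] by (simp add: transpose_commute)
next
  case (extend \<mu> \<rho> v b \<pi>)
  define e where "e = \<pi> (\<rho> c)"
  have \<rho>: "\<rho> permutes {..d}" using walk_invariant[OF extend.hyps(1) assms(2-)] by auto
  have \<pi>: "\<pi> permutes {..d}" "b \<le> d" and M: "((v, b), \<mu>, inv \<pi>) \<in> M"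
    using gluing_setD[OF extend.hyps(2)] by auto
  have ie: "inv \<pi> e = \<rho> c" using \<pi> e_def by (simp add: permutes_inverses)
  \<comment> \<open>The walk from \<open>(v, e)\<close> omitting \<open>b\<close> has
    \<open>(v, b)\<close> as its first exit, and the reversed gluing leads from there to
    \<open>\<mu>\<close>.\<close>
  have "((w, a), inv \<rho> \<circ> inv \<pi> \<circ> Transposition.transpose e b) \<in> walk M (v, e) b"
    by (rule walk_prepend[OF _ walk_base, where v = "fst \<mu>" and b = "snd \<mu>"])
      (use extend.IH M ie in auto)
  moreover have "inv (Transposition.transpose b e \<circ> \<pi> \<circ> \<rho>) = inv \<rho> \<circ> inv \<pi> \<circ> Transposition.transpose e b"
    using \<rho> \<pi> by (simp add: o_inv_distrib permutes_bij bij_comp transpose_commute comp_assoc)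
  moreover have "(Transposition.transpose b e \<circ> \<pi> \<circ> \<rho>) c = b" by (simp add: e_def)
  ultimately show ?case by (simp add: e_def comp_def)
qed

text \<open>Steps are functional because \<open>M\<close> is single valued, so of two runs one
  continues the other; an unglued facet is a dead end.\<close>

lemma walk_unique:
  assumes "(\<mu>, \<rho>) \<in> walk M \<sigma> c" "(\<mu>', \<rho>') \<in> walk M \<sigma> c" "\<mu> \<notin> glued M" "\<mu>' \<notin> glued M"
  shows "\<mu> = \<mu>' \<and> \<rho> = \<rho>'"
proof -
  have "single_valued (walk_step M c)"
    unfolding single_valued_def walk_step_def using glued_unique by blast
  from single_valued_confluent[OF this, of _ "(\<mu>, \<rho>)" "(\<mu>', \<rho>')"]
  have "((\<mu>, \<rho>), (\<mu>', \<rho>')) \<in> (walk_step M c)\<^sup>* \<or> ((\<mu>', \<rho>'), (\<mu>, \<rho>)) \<in> (walk_step M c)\<^sup>*"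
    using assms unfolding walk_def by blast
  moreover have "(s, t) \<in> (walk_step M c)\<^sup>* \<Longrightarrow> fst s \<notin> glued M \<Longrightarrow> s = t" for s t
    by (erule converse_rtranclE) (auto simp: walk_step_def glued_def image_iff)
  ultimately show ?thesis using assms by fastforce
qed

end

text \<open>Items are the ordered pairs of partners: unglued facets \<open>\<sigma>\<close>, \<open>\<tau>\<close> that share the ridge of \<open>\<sigma>\<close>
  omitting \<open>c\<close>, with the only simplicial identification of \<open>\<sigma>\<close> with \<open>\<tau>\<close> fixing that ridge.\<close>

definition items :: "nat \<Rightarrow> nat list set \<Rightarrow> gluing set \<Rightarrow> (facet \<times> nat \<times> facet \<times> (nat \<Rightarrow> nat)) set" where
  "items d W M = {(\<sigma>, c, \<tau>, \<pi>). fst \<sigma> \<in> W \<and> snd \<sigma> \<le> d \<and> c \<le> d \<and> c \<noteq> snd \<sigma> \<and>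
     (\<tau>, \<pi>) \<in> walk M \<sigma> c \<and> \<sigma> \<notin> glued M \<and> \<tau> \<notin> glued M \<and> \<sigma> \<noteq> \<tau>}"

definition rev_item :: "facet \<times> nat \<times> facet \<times> (nat \<Rightarrow> nat) \<Rightarrow> facet \<times> nat \<times> facet \<times> (nat \<Rightarrow> nat)" where
  "rev_item u = (case u of (\<sigma>, c, \<tau>, \<pi>) \<Rightarrow> (\<tau>, \<pi> c, \<sigma>, inv \<pi>))"

definition item_gluing :: "facet \<times> nat \<times> facet \<times> (nat \<Rightarrow> nat) \<Rightarrow> gluing" where
  "item_gluing u = (case u of (\<sigma>, c, \<tau>, \<pi>) \<Rightarrow> (\<sigma>, \<tau>, \<pi>))"

definition add_gluing :: "gluing \<Rightarrow> gluing set \<Rightarrow> gluing set" where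
  "add_gluing m M = insert m (insert (rev_gluing m) M)"

lemma rev_item_neq: "u \<in> items d W M \<Longrightarrow> rev_item u \<noteq> u"
  by (auto simp: items_def rev_item_def)

context
  fixes d W M
  assumes gs: "gluing_set d W M"
begin

lemma itemD:
  assumes "(\<sigma>, c, \<tau>, \<pi>) \<in> items d W M"
  shows "\<pi> permutes {..d}" "\<pi> (snd \<sigma>) = snd \<tau>" "fst \<tau> \<in> W" "snd \<tau> \<le> d" "\<pi> c \<le> d" "\<pi> c \<noteq> snd \<tau>"
proof -
  have *: "(\<tau>, \<pi>) \<in> walk M (fst \<sigma>, snd \<sigma>) c" "snd \<sigma> \<le> d" "c \<le> d" "fst \<sigma> \<in> W" "c \<noteq> snd \<sigma>"
    using assms unfolding items_def by auto
  show 1: "\<pi> permutes {..d}" "\<pi> (snd \<sigma>) = snd \<tau>" "fst \<tau> \<in> W" "snd \<tau> \<le> d"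
    using walk_invariant[OF gs *(1-4)] by auto
  show "\<pi> c \<le> d" using 1(1) *(3) permutes_in_image by fastforce
  show "\<pi> c \<noteq> snd \<tau>" using 1 *(5) by (metis permutes_inj injD)
qed

lemma rev_item_in: "u \<in> items d W M \<Longrightarrow> rev_item u \<in> items d W M"
proof -
  assume u: "u \<in> items d W M"
  obtain \<sigma> c \<tau> \<pi> where u': "u = (\<sigma>, c, \<tau>, \<pi>)" by (cases u) auto
  note D = itemD[OF u[unfolded u']]
  have "(\<sigma>, inv \<pi>) \<in> walk M \<tau> (\<pi> c)"
    using walk_reverse[OF gs, of \<tau> \<pi> "fst \<sigma>" "snd \<sigma>" c] u unfolding u' items_def by auto
  then show ?thesis using u D unfolding u' items_def rev_item_def by auto
qed

lemma rev_item_rev: "u \<in> items d W M \<Longrightarrow> rev_item (rev_item u) = u"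
proof -
  assume u: "u \<in> items d W M"
  obtain \<sigma> c \<tau> \<pi> where u': "u = (\<sigma>, c, \<tau>, \<pi>)" by (cases u) auto
  have "\<pi> permutes {..d}" using itemD[OF u[unfolded u']] by auto
  then show ?thesis by (simp add: u' rev_item_def permutes_inverses permutes_inv_inv)
qed

lemma items_determined:
  assumes "(\<sigma>, c, \<tau>, \<pi>) \<in> items d W M" "(\<sigma>, c, \<tau>', \<pi>') \<in> items d W M"
  shows "\<tau> = \<tau>' \<and> \<pi> = \<pi>'"
  using walk_unique[OF gs] assms unfolding items_def by blast

text \<open>A free facet has d ridges, and around each of them the walk has at most one dead
  end.\<close>

lemma finite_items: "finite W \<Longrightarrow> finite (items d W M)"
  and card_items: "finite W \<Longrightarrow> card (items d W M) \<le> d * card (W \<times> {..d} - glued M)"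
proof -
  assume W: "finite W"
  let ?S = "SIGMA \<sigma>:W \<times> {..d} - glued M. {..d} - {snd \<sigma>}"
  let ?f = "\<lambda>(\<sigma>::facet, c::nat, \<tau>::facet, \<pi>::nat\<Rightarrow>nat). (\<sigma>, c)"
  have inj: "inj_on ?f (items d W M)"
    by (rule inj_onI) (use items_determined in auto)
  have sub: "?f ` items d W M \<subseteq> ?S" by (auto simp: items_def)
  have fin: "finite ?S" using W by auto
  show "finite (items d W M)" using inj sub fin finite_subset by (blast dest: finite_imageD)
  have "card (items d W M) \<le> card ?S" using card_inj_on_le[OF inj sub fin] .
  also have "\<dots> = (\<Sum>\<sigma>\<in>W \<times> {..d} - glued M. card ({..d} - {snd \<sigma>}))"
    using W by (intro card_SigmaI) auto
  also have "\<dots> = (\<Sum>\<sigma>\<in>W \<times> {..d} - glued M. d)"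
    by (rule sum.cong) auto
  finally show "card (items d W M) \<le> d * card (W \<times> {..d} - glued M)" by (simp add: mult.commute)
qed

lemma gluing_set_add:
  assumes "u \<in> items d W M"
  shows "gluing_set d W (add_gluing (item_gluing u) M)"
proof -
  obtain \<sigma> c \<tau> \<pi> where u': "u = (\<sigma>, c, \<tau>, \<pi>)" by (cases u) auto
  note D = itemD[OF assms[unfolded u']]
  have inv: "inv \<pi> permutes {..d}" "inv \<pi> (snd \<tau>) = snd \<sigma>" "inv (inv \<pi>) = \<pi>"
    using D by (auto simp: permutes_inv permutes_inv_inv permutes_inv_eq)
  have n: "\<sigma> \<notin> glued M" "\<tau> \<notin> glued M" "\<sigma> \<noteq> \<tau>" "fst \<sigma> \<in> W" "snd \<sigma> \<le> d"
    using assms unfolding u' items_def by auto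
  have s: "single_valued M" "finite M" using gs unfolding gluing_set_def by auto
  have "single_valued (add_gluing (item_gluing u) M)"
    using s(1) n unfolding single_valued_def add_gluing_def u' item_gluing_def rev_gluing_def glued_def
    by (auto simp: image_iff)
  moreover have "(\<tau>', \<sigma>', inv \<pi>') \<in> add_gluing (item_gluing u) M \<and> \<sigma>' \<noteq> \<tau>' \<and> fst \<sigma>' \<in> W \<and>
      snd \<sigma>' \<le> d \<and> \<pi>' permutes {..d} \<and> \<pi>' (snd \<sigma>') = snd \<tau>'"
    if "(\<sigma>', \<tau>', \<pi>') \<in> add_gluing (item_gluing u) M" for \<sigma>' \<tau>' \<pi>'
  proof (cases "(\<sigma>', \<tau>', \<pi>') \<in> M")
    case True
    then show ?thesis using gluing_setD[OF gs True] by (simp add: add_gluing_def)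
  next
    case False
    then show ?thesis using that D inv n
      by (auto simp: add_gluing_def u' item_gluing_def rev_gluing_def)
  qed
  ultimately show ?thesis
    using s(2) unfolding gluing_set_def by (simp add: add_gluing_def)
qed

lemma glued_add:
  assumes "u \<in> items d W M"
  shows "glued (add_gluing (item_gluing u) M) = {fst u, fst (snd (snd u))} \<union> glued M"
  by (auto simp: glued_def add_gluing_def item_gluing_def rev_gluing_def split: prod.splits)

end


section \<open>The identification phase as a growing set of gluings\<close>

text \<open>A relaxation of the identification phase: any available pair of partners may be glued,
  whatever the resulting quotient looks like. Counting these sets therefore gives an upper
  bound.\<close>

inductive lc_gluing :: "nat \<Rightarrow> nat list set \<Rightarrow> gluing set \<Rightarrow> gluing set \<Rightarrow> bool" for d W G where
  base: "lc_gluing d W G G"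
| add: "lc_gluing d W G M \<Longrightarrow> u \<in> items d W M \<Longrightarrow> lc_gluing d W G (add_gluing (item_gluing u) M)"

lemma lc_gluing_gluing_set: "lc_gluing d W G M \<Longrightarrow> gluing_set d W G \<Longrightarrow> gluing_set d W M"
  by (induction rule: lc_gluing.induct) (auto intro: gluing_set_add)

lemma lc_gluing_mono: "lc_gluing d W G M \<Longrightarrow> G \<subseteq> M"
  by (induction rule: lc_gluing.induct) (auto simp: add_gluing_def)

text \<open>Walks only get longer when gluings are added, so an item persists until one of its two facets is
  glued; this is what makes the order of the gluings irrelevant.\<close>

lemma lc_gluing_complete:
  assumes "lc_gluing d W G M" "gluing_set d W G"
    and L: "gluing_set d W L" "M \<subseteq> L" and S: "gluing_set d W S" "G \<subseteq> S" "S \<subseteq> L"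
    and none: "\<forall>u\<in>items d W S. item_gluing u \<notin> L"
  shows "M \<subseteq> S"
  using assms(1) L(2)
proof (induction rule: lc_gluing.induct)
  case base
  then show ?case using S by simp
next
  case (add M u)
  obtain \<sigma> c \<tau> \<pi> where u: "u = (\<sigma>, c, \<tau>, \<pi>)" by (cases u) auto
  have MS: "M \<subseteq> S" using add by (auto simp: add_gluing_def)
  have L1: "(\<sigma>, \<tau>, \<pi>) \<in> L" using add.prems by (auto simp: add_gluing_def u item_gluing_def)
  \<comment> \<open>If this gluing were missing from \<open>S\<close>, both of its facets would be
    free in \<open>S\<close>, because \<open>L\<close> contains \<open>S\<close> and gives each
    facet only one gluing. The walk of \<open>M\<close> is also a walk of \<open>S\<close>, so
    \<open>u\<close> would be an item of \<open>S\<close> whose gluing lies in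
    \<open>L\<close>.\<close>
  have "(\<sigma>, \<tau>, \<pi>) \<in> S"
  proof (rule ccontr)
    assume n: "(\<sigma>, \<tau>, \<pi>) \<notin> S"
    have L2: "(\<tau>, \<sigma>, inv \<pi>) \<in> L" using gluing_setD[OF L(1) L1] by simp
    have "\<sigma> \<notin> glued S"
    proof
      assume "\<sigma> \<in> glued S"
      then obtain \<tau>' \<pi>' where "(\<sigma>, \<tau>', \<pi>') \<in> S" unfolding glued_def by force
      then show False using glued_unique[OF L(1) L1, of \<tau>' \<pi>'] S n by auto
    qed
    moreover have "\<tau> \<notin> glued S"
    proof
      assume "\<tau> \<in> glued S"
      then obtain \<tau>' \<pi>' where *: "(\<tau>, \<tau>', \<pi>') \<in> S" unfolding glued_def by force
      then have "\<tau>' = \<sigma>" using glued_unique[OF L(1) L2, of \<tau>' \<pi>'] S by auto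
      then have "\<sigma> \<in> glued S" using gluing_setD[OF S(1) *] by simp
      then show False using \<open>\<sigma> \<notin> glued S\<close> by simp
    qed
    ultimately have "u \<in> items d W S"
      using add.hyps(2) walk_mono[OF MS, of \<sigma> c] unfolding u items_def by auto
    then show False using none L1 by (auto simp: u item_gluing_def)
  qed
  moreover have "rev_gluing (\<sigma>, \<tau>, \<pi>) \<in> S"
    using gluing_setD[OF S(1) calculation] by (simp add: rev_gluing_def)
  ultimately show ?case using MS by (simp add: add_gluing_def u item_gluing_def)
qed

context
  fixes d W M u M'
  assumes gs: "gluing_set d W M" and u: "u \<in> items d W M" and W: "finite W"
  defines "M' \<equiv> add_gluing (item_gluing u) M"
begin

lemma gluing_set_M': "gluing_set d W M'"
  unfolding M'_def by (rule gluing_set_add[OF gs u])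

text \<open>Up to its first crossing of a gluing outside \<open>M\<close>, a walk of
  \<open>M'\<close> is a walk of \<open>M\<close>, and that crossing starts at one of the two facets
  of \<open>u\<close>.\<close>

lemma walk_first_new:
  assumes "(\<beta>, \<theta>) \<in> walk M' (w, a) e"
  shows "(\<beta>, \<theta>) \<in> walk M (w, a) e \<or>
    (\<exists>\<kappa>\<in>{fst u, fst (snd (snd u))}. \<exists>\<rho>. (\<kappa>, \<rho>) \<in> walk M (w, a) e)"
  using assms
proof (induction rule: walk_induct)
  case base
  then show ?case using walk_base by blast
next
  case (extend \<mu> \<rho> v b \<pi>)
  show ?case
  proof (cases "(\<mu>, (v, b), \<pi>) \<in> M")
    case True
    then show ?thesis using walk_extend[of \<mu> \<rho> M "(w, a)" e v b \<pi>] extend.IH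
      by (auto simp: comp_def)
  next
    case False
    then have "\<mu> \<in> {fst u, fst (snd (snd u))}"
      using extend.hyps(2) unfolding M'_def add_gluing_def item_gluing_def rev_gluing_def
      by (auto split: prod.splits)
    then show ?thesis using extend.IH by blast
  qed
qed

text \<open>A new item runs through one of the two newly glued facets. Followed backwards from the first one it
  meets, it is determined by that facet and the ridge in it, and the ridge along which the item \<open>u\<close>
  itself runs is excluded.\<close>

lemma card_new_items: "card (items d W M' - items d W M) \<le> 2 * (d - 1)"
proof -
  obtain \<sigma> c \<tau> \<pi> where u': "u = (\<sigma>, c, \<tau>, \<pi>)" by (cases u) auto
  note D = itemD[OF gs u[unfolded u']]
  have cd: "c \<le> d" "c \<noteq> snd \<sigma>" "snd \<sigma> \<le> d" and st: "\<sigma> \<noteq> \<tau>" and un: "\<sigma> \<notin> glued M" "\<tau> \<notin> glued M"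
    using u unfolding u' items_def by auto
  have gl: "glued M' = {\<sigma>, \<tau>} \<union> glued M" using glued_add[OF gs u] by (simp add: M'_def u')
  \<comment> \<open>Each of the two new glued facets has d ridges, one of which belongs to
    \<open>u\<close>. This leaves 2(d - 1) keys for ordered items, that is, d - 1 new pairs.\<close>
  let ?K = "{\<sigma>} \<times> ({..d} - {snd \<sigma>, c}) \<union> {\<tau>} \<times> ({..d} - {snd \<tau>, \<pi> c})"
  let ?N = "items d W M' - items d W M"
  have ex: "\<exists>k\<in>?K. \<exists>\<rho>. k = (fst k, \<rho> (fst (snd v))) \<and> (fst k, \<rho>) \<in> walk M (fst v) (fst (snd v))"
    if v: "v \<in> ?N" for v
  proof -
    obtain \<alpha> e \<beta> \<theta> where v': "v = (\<alpha>, e, \<beta>, \<theta>)" by (cases v) auto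
    have V: "\<alpha> \<notin> glued M'" "\<beta> \<notin> glued M'" "(\<beta>, \<theta>) \<in> walk M' \<alpha> e" "\<alpha> \<noteq> \<beta>" "fst \<alpha> \<in> W" "snd \<alpha> \<le> d"
      "e \<le> d" "e \<noteq> snd \<alpha>" using v unfolding v' items_def by auto
    then have "(\<beta>, \<theta>) \<notin> walk M \<alpha> e" using v gl unfolding v' items_def by auto
    then have "\<exists>\<kappa>\<in>{\<sigma>, \<tau>}. \<exists>\<rho>. (\<kappa>, \<rho>) \<in> walk M \<alpha> e"
      using walk_first_new[of \<beta> \<theta> "fst \<alpha>" "snd \<alpha>" e] V by (simp add: u')
    then obtain \<kappa> \<rho> where \<kappa>: "\<kappa> \<in> {\<sigma>, \<tau>}" "(\<kappa>, \<rho>) \<in> walk M \<alpha> e" by blast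
    note I = walk_invariant[OF gs, of \<kappa> \<rho> "fst \<alpha>" "snd \<alpha>" e]
    have \<rho>: "\<rho> permutes {..d}" "\<rho> (snd \<alpha>) = snd \<kappa>" using I \<kappa> V by auto
    have "\<rho> e \<le> d" using \<rho>(1) V(7) permutes_in_image by fastforce
    moreover have "\<rho> e \<noteq> snd \<kappa>" using \<rho> V(8) by (metis permutes_inj injD)
    moreover have rv: "(\<alpha>, inv \<rho>) \<in> walk M \<kappa> (\<rho> e)"
      using walk_reverse[OF gs, of \<kappa> \<rho> "fst \<alpha>" "snd \<alpha>" e] \<kappa> V by simp
    \<comment> \<open>Otherwise the walk of \<open>M\<close> from \<open>\<sigma>\<close> around the
      ridge of \<open>u\<close> would have both \<open>\<alpha>\<close> and \<open>\<tau>\<close> as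
      its dead end, although \<open>\<alpha>\<close> is still free in \<open>M'\<close>.\<close>
    moreover have "(\<kappa>, \<rho> e) \<noteq> (\<sigma>, c)"
    proof
      assume "(\<kappa>, \<rho> e) = (\<sigma>, c)"
      then have "(\<alpha>, inv \<rho>) \<in> walk M \<sigma> c" "(\<tau>, \<pi>) \<in> walk M \<sigma> c" using rv u unfolding u' items_def by auto
      then show False using walk_unique[OF gs, of \<alpha> _ \<sigma> c \<tau>] V gl un by auto
    qed
    moreover have "(\<kappa>, \<rho> e) \<noteq> (\<tau>, \<pi> c)"
    proof
      assume "(\<kappa>, \<rho> e) = (\<tau>, \<pi> c)"
      then have "(\<alpha>, inv \<rho>) \<in> walk M \<tau> (\<pi> c)" "(\<sigma>, inv \<pi>) \<in> walk M \<tau> (\<pi> c)"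
        using rv rev_item_in[OF gs u] unfolding u' items_def rev_item_def by auto
      then show False using walk_unique[OF gs, of \<alpha> _ \<tau> "\<pi> c" \<sigma>] V gl un by auto
    qed
    ultimately have "(\<kappa>, \<rho> e) \<in> ?K" using \<kappa>(1) by auto
    then show ?thesis
    proof (rule bexI[rotated])
      show "\<exists>\<rho>'. (\<kappa>, \<rho> e) = (fst (\<kappa>, \<rho> e), \<rho>' (fst (snd v))) \<and> (fst (\<kappa>, \<rho> e), \<rho>') \<in> walk M (fst v) (fst (snd v))"
        using \<kappa>(2) by (intro exI[of _ \<rho>]) (simp add: v')
    qed
  qed
  \<comment> \<open>An item may have several keys; any choice will do. The reverse walk of
    \<open>M\<close> from the facet in the key ends at \<open>\<alpha>\<close> with transport
    \<open>inv \<rho>\<close>, and \<open>inv \<rho>\<close> applied to the second component is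
    \<open>e\<close>.\<close>
  define key where "key v = (SOME k. k \<in> ?K \<and> (\<exists>\<rho>. k = (fst k, \<rho> (fst (snd v))) \<and>
      (fst k, \<rho>) \<in> walk M (fst v) (fst (snd v))))" for v :: "facet \<times> nat \<times> facet \<times> (nat \<Rightarrow> nat)"
  have key: "key v \<in> ?K \<and> (\<exists>\<rho>. key v = (fst (key v), \<rho> (fst (snd v))) \<and>
      (fst (key v), \<rho>) \<in> walk M (fst v) (fst (snd v)))" if "v \<in> ?N" for v
    unfolding key_def by (rule someI_ex) (use ex[OF that] in blast)
  have "inj_on key ?N"
  proof (rule inj_onI)
    fix v1 v2 assume v: "v1 \<in> ?N" "v2 \<in> ?N" and k: "key v1 = key v2"
    obtain \<alpha>1 e1 \<beta>1 \<theta>1 where v1: "v1 = (\<alpha>1, e1, \<beta>1, \<theta>1)" by (cases v1) auto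
    obtain \<alpha>2 e2 \<beta>2 \<theta>2 where v2: "v2 = (\<alpha>2, e2, \<beta>2, \<theta>2)" by (cases v2) auto
    obtain \<kappa> f where kf: "key v1 = (\<kappa>, f)" by (cases "key v1")
    obtain \<rho>1 \<rho>2 where r: "f = \<rho>1 e1" "(\<kappa>, \<rho>1) \<in> walk M \<alpha>1 e1" "f = \<rho>2 e2" "(\<kappa>, \<rho>2) \<in> walk M \<alpha>2 e2"
      using key[OF v(1)] key[OF v(2)] k kf v1 v2 by auto
    have V1: "\<alpha>1 \<notin> glued M" "fst \<alpha>1 \<in> W" "snd \<alpha>1 \<le> d" "e1 \<le> d" using v(1) gl unfolding v1 items_def by auto
    have V2: "\<alpha>2 \<notin> glued M" "fst \<alpha>2 \<in> W" "snd \<alpha>2 \<le> d" "e2 \<le> d" using v(2) gl unfolding v2 items_def by auto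
    have p: "\<rho>1 permutes {..d}" "\<rho>2 permutes {..d}"
      using walk_invariant[OF gs, of \<kappa> \<rho>1 "fst \<alpha>1" "snd \<alpha>1" e1]
        walk_invariant[OF gs, of \<kappa> \<rho>2 "fst \<alpha>2" "snd \<alpha>2" e2] r V1 V2 by auto
    have "(\<alpha>1, inv \<rho>1) \<in> walk M \<kappa> f" "(\<alpha>2, inv \<rho>2) \<in> walk M \<kappa> f"
      using walk_reverse[OF gs, of \<kappa> \<rho>1 "fst \<alpha>1" "snd \<alpha>1" e1]
        walk_reverse[OF gs, of \<kappa> \<rho>2 "fst \<alpha>2" "snd \<alpha>2" e2] r V1 V2 by auto
    then have eq: "\<alpha>1 = \<alpha>2" "inv \<rho>1 = inv \<rho>2" using walk_unique[OF gs] V1 V2 by blast+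
    have "e1 = inv \<rho>1 f" unfolding r(1) using p by (simp add: permutes_inverses)
    moreover have "e2 = inv \<rho>2 f" unfolding r(3) using p by (simp add: permutes_inverses)
    ultimately have "e1 = e2" using eq by simp
    then show "v1 = v2" using items_determined[OF gluing_set_M', of \<alpha>1 e1 \<beta>1 \<theta>1 \<beta>2 \<theta>2] eq v v1 v2 by auto
  qed
  moreover have "key ` ?N \<subseteq> ?K" using key by blast
  ultimately have "card ?N \<le> card ?K" by (rule card_inj_on_le) auto
  also have "\<dots> = card ({..d} - {snd \<sigma>, c}) + card ({..d} - {snd \<tau>, \<pi> c})"
    using st by (subst card_Un_disjoint) (auto simp: card_cartesian_product)
  also have "\<dots> = 2 * (d - 1)" using cd D by (simp add: card_Diff_subset)
  finally show ?thesis .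
qed

lemma items_lost: "v \<in> items d W M' \<Longrightarrow> v \<noteq> u \<and> v \<noteq> rev_item u"
proof -
  assume "v \<in> items d W M'"
  then have "fst v \<notin> glued M'" by (auto simp: items_def)
  moreover have "glued M' = {fst u, fst (snd (snd u))} \<union> glued M"
    using glued_add[OF gs u] by (simp add: M'_def)
  moreover have "fst (rev_item u) = fst (snd (snd u))" by (cases u) (simp add: rev_item_def)
  ultimately show ?thesis by auto
qed

end


section \<open>The number of sets of gluings over a given tree\<close>

text \<open>In a state \<open>(S, U)\<close> the gluings in \<open>S\<close> are accepted, the items
  in \<open>U\<close> are open, and all other items of \<open>S\<close> are rejected. Since
  \<open>U\<close> is closed under reversal, \<open>card U div 2\<close> counts pairs; accepting a
  pair adds both orientations, hence \<open>2 * k\<close>. Once nothing is open,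
  \<open>lc_gluing_complete\<close> leaves only \<open>L = S\<close>.\<close>

lemma lc_gluings_count_aux:
  fixes x y :: real
  assumes x: "x > 0" "x \<le> 1" "y \<ge> 1" "1 + x * y ^ (d - 1) \<le> y"
    and G: "gluing_set d W G" and W: "finite W"
  defines "T \<equiv> (\<lambda>(S, U) k. {L. lc_gluing d W G L \<and> S \<subseteq> L \<and> card (L - S) \<le> 2 * k \<and>
      (\<forall>v\<in>items d W S - U. item_gluing v \<notin> L)})"
  shows "finite (T (G, items d W G) k) \<and>
    real (card (T (G, items d W G) k)) \<le> y ^ (card (items d W G) div 2) / x ^ k"
proof -
  let ?I = "\<lambda>(S, U). gluing_set d W S \<and> G \<subseteq> S \<and> U \<subseteq> items d W S \<and> rev_item ` U \<subseteq> U"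
  let ?sz = "\<lambda>(S :: gluing set, U :: (facet \<times> nat \<times> facet \<times> (nat \<Rightarrow> nat)) set). card U div 2"
  have two: "finite U \<and> card {u, rev_item u} = 2 \<and> card (U - {u, rev_item u}) + 2 = card U"
    if "?I (S, U)" "u \<in> U" for S U u
  proof -
    have f: "finite U" using that finite_items[OF _ W] finite_subset by auto
    have "u \<noteq> rev_item u" "rev_item u \<in> U" using rev_item_neq[of u d W S] that by auto
    moreover have "card {u, rev_item u} \<le> card U" using f calculation that by (intro card_mono) auto
    ultimately show ?thesis using f that by (simp add: card_Diff_subset)
  qed
  have "finite (T (G, items d W G) k) \<and> real (card (T (G, items d W G) k)) \<le> y ^ ?sz (G, items d W G) / x ^ k"
  proof (rule branching_count[where I = ?I and T = T and b = "d - 1"])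
    show "?I (G, items d W G)" using rev_item_in[OF G] G by auto
  next
    fix s k assume I: "?I s" and z: "?sz s = 0"
    obtain S U where s: "s = (S, U)" by force
    have "card U < 2" using z s by auto
    then have U: "U = {}" using two[OF I[unfolded s]] by force
    have "T s k \<subseteq> {S}"
    proof
      fix L assume "L \<in> T s k"
      then have L: "lc_gluing d W G L" "S \<subseteq> L" "\<forall>v\<in>items d W S. item_gluing v \<notin> L"
        unfolding T_def s U by auto
      have "L \<subseteq> S"
        using lc_gluing_complete[OF L(1) G lc_gluing_gluing_set[OF L(1) G] order_refl] L I s by auto
      then show "L \<in> {S}" using L by auto
    qed
    then show "finite (T s k) \<and> card (T s k) \<le> 1"
      using card_mono[of "{S}" "T s k"] finite_subset[of "T s k" "{S}"] by auto
  next
    fix s k assume I: "?I s" and z: "0 < ?sz s"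
    obtain S U where s: "s = (S, U)" by force
    have S: "gluing_set d W S" "G \<subseteq> S" "U \<subseteq> items d W S" "\<And>u. u \<in> U \<Longrightarrow> rev_item u \<in> U"
      using I s by auto
    have "U \<noteq> {}" using z s by auto
    then obtain u where u: "u \<in> U" by blast
    have ui: "u \<in> items d W S" using u S by auto
    obtain \<sigma> c \<tau> \<pi> where u': "u = (\<sigma>, c, \<tau>, \<pi>)" by (cases u) auto
    have st: "\<sigma> \<noteq> \<tau>" "\<sigma> \<notin> glued S" "\<tau> \<notin> glued S" using ui unfolding u' items_def by auto
    have pinv: "inv (inv \<pi>) = \<pi>" using itemD(1)[OF S(1) ui[unfolded u']] by (rule permutes_inv_inv)
    define S' where "S' = add_gluing (item_gluing u) S"
    define N where "N = items d W S' - items d W S"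
    \<comment> \<open>After acceptance, open items that lost a facet disappear and every new item is
      open. The items of \<open>S'\<close> outside \<open>?U2\<close> are thus items of
      \<open>S\<close> that were rejected earlier.\<close>
    let ?U1 = "U - {u, rev_item u}" and ?U2 = "(U \<inter> items d W S') \<union> N"
    have S'eq: "S' = insert (\<sigma>, \<tau>, \<pi>) (insert (\<tau>, \<sigma>, inv \<pi>) S)"
      by (simp add: S'_def add_gluing_def u' item_gluing_def rev_gluing_def)
    have gS': "gluing_set d W S'" using gluing_set_add[OF S(1) ui] by (simp add: S'_def)
    have fU: "finite U" and cU: "card ?U1 + 2 = card U" using two[OF I[unfolded s] u] by auto
    have cN: "card N \<le> 2 * (d - 1)" using card_new_items[OF S(1) ui W] by (simp add: N_def S'_def)
    have fN: "finite N" using finite_items[OF gS' W] by (simp add: N_def)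
    have "U \<inter> items d W S' \<subseteq> ?U1" using items_lost[OF S(1) ui W] unfolding S'_def by blast
    then have "card (U \<inter> items d W S') \<le> card ?U1" using fU by (intro card_mono) auto
    then have cU2: "card ?U2 + 2 \<le> card U + 2 * (d - 1)"
      using card_Un_le[of "U \<inter> items d W S'" N] cN cU by linarith
    have sz2: "card ?U2 div 2 + 1 \<le> card U div 2 + (d - 1)"
      using div_le_mono[OF cU2, of 2] by simp
    have I2: "?I (S', ?U2)"
    proof -
      have "rev_item v \<in> ?U2" if v: "v \<in> ?U2" for v
      proof -
        have "v \<in> items d W S'" using v by (auto simp: N_def)
        then have r: "rev_item v \<in> items d W S'" and rr: "rev_item (rev_item v) = v"
          using rev_item_in[OF gS'] rev_item_rev[OF gS'] by auto
        show ?thesis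
        proof (cases "v \<in> U")
          case True
          then show ?thesis using r S(4) by auto
        next
          case False
          then have "v \<in> N" using v by auto
          then have "rev_item v \<notin> items d W S" using rev_item_in[OF S(1), of "rev_item v"] rr
            by (auto simp: N_def)
          then show ?thesis using r by (auto simp: N_def)
        qed
      qed
      then have "rev_item ` ?U2 \<subseteq> ?U2" by blast
      moreover have "G \<subseteq> S'" using S(2) by (auto simp: S'eq)
      moreover have "?U2 \<subseteq> items d W S'" unfolding N_def by blast
      ultimately show ?thesis using gS' by simp
    qed
    have "rev_item v \<in> ?U1" if v: "v \<in> ?U1" for v
    proof -
      have "rev_item (rev_item v) = v" "rev_item (rev_item u) = u"
        using v S(3) ui rev_item_rev[OF S(1)] by blast+
      moreover have "v \<in> U" "v \<noteq> u" "v \<noteq> rev_item u" using v by blast+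
      moreover have "rev_item v \<noteq> u" "rev_item v \<noteq> rev_item u" using calculation by metis+
      ultimately show ?thesis using S(4)[of v] by blast
    qed
    then have "rev_item ` ?U1 \<subseteq> ?U1" by (rule image_subsetI)
    moreover have "?U1 \<subseteq> items d W S" using S(3) by blast
    ultimately have I1: "?I (S, ?U1)" using S(1,2) by simp
    have TT: "L \<in> T (S, ?U1) k \<union> (if k = 0 then {} else T (S', ?U2) (k - 1))" if L: "L \<in> T s k" for L
    proof -
      have L1: "lc_gluing d W G L" "S \<subseteq> L" "card (L - S) \<le> 2 * k" "\<forall>v\<in>items d W S - U. item_gluing v \<notin> L"
        using L unfolding T_def s by auto
      have gL: "gluing_set d W L" by (rule lc_gluing_gluing_set[OF L1(1) G])
      show ?thesis
      proof (cases "(\<sigma>, \<tau>, \<pi>) \<in> L")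
        case True
        then have r: "(\<tau>, \<sigma>, inv \<pi>) \<in> L" by (rule gluing_setD(1)[OF gL])
        have fL: "finite L" using gL unfolding gluing_set_def by simp
        have nS: "(\<sigma>, \<tau>, \<pi>) \<notin> S" "(\<tau>, \<sigma>, inv \<pi>) \<notin> S"
          using st gluing_setD(9)[OF S(1)] by blast+
        have "L - S = insert (\<sigma>, \<tau>, \<pi>) (insert (\<tau>, \<sigma>, inv \<pi>) (L - S'))"
          using True r nS by (auto simp: S'eq)
        moreover have "card (insert (\<sigma>, \<tau>, \<pi>) (insert (\<tau>, \<sigma>, inv \<pi>) A)) = card A + 2"
          if "finite A" "(\<sigma>, \<tau>, \<pi>) \<notin> A" "(\<tau>, \<sigma>, inv \<pi>) \<notin> A" for A
          using that st by simp
        from this[of "L - S'"] have "card (insert (\<sigma>, \<tau>, \<pi>) (insert (\<tau>, \<sigma>, inv \<pi>) (L - S'))) = card (L - S') + 2"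
          using fL unfolding S'eq by blast
        ultimately have cL: "card (L - S) = card (L - S') + 2" by metis
        have "\<forall>v\<in>items d W S' - ?U2. item_gluing v \<notin> L"
          using L1(4) unfolding N_def by blast
        moreover have "S' \<subseteq> L" using True r L1(2) by (simp add: S'eq)
        moreover have "card (L - S') \<le> 2 * (k - 1)" "k \<noteq> 0" using cL L1(3) by linarith+
        ultimately have "L \<in> T (S', ?U2) (k - 1)" "k \<noteq> 0" using L1(1) unfolding T_def by simp_all
        then show ?thesis by auto
      next
        case False
        then have "(\<tau>, \<sigma>, inv \<pi>) \<notin> L" using gluing_setD(1)[OF gL, of \<tau> \<sigma> "inv \<pi>"] pinv by auto
        then have "item_gluing v \<notin> L" if "v \<in> items d W S - ?U1" for v
          using that L1(4) False by (auto simp: u' item_gluing_def rev_item_def)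
        then show ?thesis using L1 unfolding T_def by auto
      qed
    qed
    show "\<exists>s1 s2. ?I s1 \<and> ?sz s1 < ?sz s \<and> (0 < k \<longrightarrow> ?I s2 \<and> ?sz s2 + 1 \<le> ?sz s + (d - 1)) \<and>
       T s k \<subseteq> T s1 k \<union> (if k = 0 then {} else T s2 (k - 1))"
    proof (intro exI conjI)
      show "?I (S, ?U1)" by (rule I1)
      show "?sz (S, ?U1) < ?sz s" using cU by (simp add: s)
      show "0 < k \<longrightarrow> ?I (S', ?U2) \<and> ?sz (S', ?U2) + 1 \<le> ?sz s + (d - 1)"
        using I2 sz2 by (simp add: s)
      show "T s k \<subseteq> T (S, ?U1) k \<union> (if k = 0 then {} else T (S', ?U2) (k - 1))" using TT by blast
    qed
  qed (use x in auto)
  then show ?thesis by simp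
qed

text \<open>A final set adds at most one oriented gluing per free facet, \<open>n\<close> in all,
  and the budget is counted in pairs, rounded up. The open pairs at the start number at most half of
  the d ridges of each free facet.\<close>

lemma lc_gluings_count:
  fixes x y :: real
  assumes x: "x > 0" "x \<le> 1" "y \<ge> 1" "1 + x * y ^ (d - 1) \<le> y"
    and G: "gluing_set d W G" and W: "finite W" and n: "n = card (W \<times> {..d} - glued G)"
  shows "finite {L. lc_gluing d W G L} \<and>
    real (card {L. lc_gluing d W G L}) \<le> y ^ (d * n div 2) / x ^ ((n + 1) div 2)"
proof -
  define T where "T = {L. lc_gluing d W G L \<and> G \<subseteq> L \<and> card (L - G) \<le> 2 * ((n + 1) div 2) \<and>
      (\<forall>v\<in>items d W G - items d W G. item_gluing v \<notin> L)}"
  have T: "finite T \<and> real (card T) \<le> y ^ (card (items d W G) div 2) / x ^ ((n + 1) div 2)"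
    using lc_gluings_count_aux[OF x G W, of "(n + 1) div 2"] unfolding T_def by simp
  have "{L. lc_gluing d W G L} \<subseteq> T"
  proof (rule subsetI, unfold mem_Collect_eq)
    fix L assume L: "lc_gluing d W G L"
    have gL: "gluing_set d W L" by (rule lc_gluing_gluing_set[OF L G])
    have sub: "G \<subseteq> L" by (rule lc_gluing_mono[OF L])
    have "inj_on fst (L - G)"
      by (rule inj_onI) (use glued_unique[OF gL] in \<open>auto simp: prod_eq_iff\<close>)
    moreover have "fst ` (L - G) \<subseteq> W \<times> {..d} - glued G"
    proof
      fix \<sigma> assume "\<sigma> \<in> fst ` (L - G)"
      then obtain \<tau> \<pi> where m: "(\<sigma>, \<tau>, \<pi>) \<in> L" "(\<sigma>, \<tau>, \<pi>) \<notin> G" by force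
      have "\<sigma> \<notin> glued G"
      proof
        assume "\<sigma> \<in> glued G"
        then obtain \<tau>' \<pi>' where *: "(\<sigma>, \<tau>', \<pi>') \<in> G" unfolding glued_def by force
        then show False using glued_unique[OF gL m(1), of \<tau>' \<pi>'] sub m by auto
      qed
      then show "\<sigma> \<in> W \<times> {..d} - glued G" using gluing_setD[OF gL m(1)] by (cases \<sigma>) auto
    qed
    ultimately have "card (L - G) \<le> n" unfolding n using W by (intro card_inj_on_le) auto
    then show "L \<in> T" using L sub unfolding T_def by simp
  qed
  moreover have "y ^ (card (items d W G) div 2) \<le> y ^ (d * n div 2)"
    using card_items[OF G W] x n by (intro power_increasing div_le_mono) auto
  then have "y ^ (card (items d W G) div 2) / x ^ ((n + 1) div 2) \<le> y ^ (d * n div 2) / x ^ ((n + 1) div 2)"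
    using x by (intro divide_right_mono) auto
  ultimately show ?thesis using T
    by (meson card_mono finite_subset of_nat_le_iff order_trans)
qed

section \<open>The gluings of a tree of simplices\<close>

definition tree_gluing :: "nat list set \<Rightarrow> gluing set" where
  "tree_gluing W = {((w, a), (a # w, a), id) |a w. a # w \<in> W} \<union> {((a # w, a), (w, a), id) |a w. a # w \<in> W}"

lemma gluing_set_tree_gluing:
  assumes "simplex_tree d W"
  shows "gluing_set d W (tree_gluing W)"
proof -
  have W: "finite W" "\<And>a w. a # w \<in> W \<Longrightarrow> w \<in> W \<and> a \<le> d \<and> (w \<noteq> [] \<longrightarrow> a \<noteq> hd w)"
    using assms unfolding simplex_tree_def by auto
  have "tree_gluing W \<subseteq> (\<lambda>v. ((tl v, hd v), (v, hd v), id)) ` W \<union> (\<lambda>v. ((v, hd v), (tl v, hd v), id)) ` W"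
    unfolding tree_gluing_def by (force simp: image_iff)
  then have "finite (tree_gluing W)" using W finite_subset by fast
  moreover have "single_valued (tree_gluing W)"
    unfolding single_valued_def tree_gluing_def using W(2) by fastforce
  ultimately show ?thesis
    unfolding gluing_set_def tree_gluing_def using W(2) by (auto simp: permutes_id)
qed

text \<open>Every nonempty word \<open>v\<close> uses up the two facets \<open>(tl v, hd v)\<close>
  and \<open>(v, hd v)\<close>. All of these are distinct: a coincidence between the two kinds would
  give \<open>v\<close> two equal letters at its front.\<close>

lemma card_glued_tree_gluing:
  assumes "simplex_tree d W"
  shows "card (W \<times> {..d} - glued (tree_gluing W)) + 2 * (card W - 1) \<le> card W * (d + 1)"
proof -
  have W: "finite W" "\<And>a w. a # w \<in> W \<Longrightarrow> w \<in> W \<and> a \<le> d \<and> (w \<noteq> [] \<longrightarrow> a \<noteq> hd w)" "[] \<in> W"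
    using assms unfolding simplex_tree_def by auto
  let ?A = "(\<lambda>v. (tl v, hd v)) ` (W - {[]})" and ?B = "(\<lambda>v. (v, hd v)) ` (W - {[]})"
  have tl: "v \<in> W - {[]} \<Longrightarrow> tl v \<in> W \<and> hd v \<le> d \<and> (tl v \<noteq> [] \<longrightarrow> hd v \<noteq> hd (tl v))" for v
    using W(2)[of "hd v" "tl v"] by auto
  have "card ?A = card W - 1" "card ?B = card W - 1"
    using W by (subst card_image; auto simp: inj_on_def list.expand)+
  moreover have "?A \<inter> ?B = {}" using tl by fastforce
  ultimately have c: "card (?A \<union> ?B) = 2 * (card W - 1)" using W by (subst card_Un_disjoint) auto
  have "?A \<union> ?B \<subseteq> glued (tree_gluing W)"
  proof -
    have "v \<in> W - {[]} \<Longrightarrow> ((tl v, hd v), (v, hd v), id) \<in> tree_gluing W \<and>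
        ((v, hd v), (tl v, hd v), id) \<in> tree_gluing W" for v
      unfolding tree_gluing_def by (cases v) auto
    then show ?thesis unfolding glued_def by force
  qed
  then have "card (W \<times> {..d} - glued (tree_gluing W)) \<le> card (W \<times> {..d} - (?A \<union> ?B))"
    using W by (intro card_mono) auto
  also have "\<dots> = card W * (d + 1) - 2 * (card W - 1)"
    using tl W by (subst card_Diff_subset) (auto simp: c card_cartesian_product)
  finally have *: "card (W \<times> {..d} - glued (tree_gluing W)) \<le> card W * (d + 1) - 2 * (card W - 1)" .
  have "card (?A \<union> ?B) \<le> card (W \<times> {..d})" using tl W by (intro card_mono) auto
  then have "2 * (card W - 1) \<le> card W * (d + 1)" by (simp add: c card_cartesian_product)
  then show ?thesis using * by linarith
qed

section \<open>Labelled cell complexes\<close>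

definition cells :: "'a cw_complex \<Rightarrow> 'a set set" where
  "cells K = (\<Union>n. cw_cells K n)"

text \<open>The set-theoretic residue of a regular CW structure: every point has a smallest closed cell, every
  closed cell is the smallest one of some point, and dimensions are well defined.\<close>

definition cell_structure :: "'a cw_complex \<Rightarrow> bool" where
  "cell_structure K \<longleftrightarrow>
     (\<forall>e\<in>cells K. e \<subseteq> topspace (cw_space K)) \<and>
     (\<forall>x\<in>topspace (cw_space K). \<exists>e\<in>cells K. x \<in> e \<and> (\<forall>f\<in>cells K. x \<in> f \<longrightarrow> e \<subseteq> f)) \<and>
     (\<forall>e\<in>cells K. \<exists>x\<in>e. \<forall>f\<in>cells K. x \<in> f \<longrightarrow> e \<subseteq> f) \<and>
     (\<forall>m n. cw_cells K m \<inter> cw_cells K n \<noteq> {} \<longrightarrow> m = n)"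

lemma cells_I: "e \<in> cw_cells K n \<Longrightarrow> e \<in> cells K"
  unfolding cells_def by blast

lemma
  assumes "cell_structure K"
  shows cell_subset_topspace: "e \<in> cells K \<Longrightarrow> e \<subseteq> topspace (cw_space K)"
    and carrier_cell: "x \<in> topspace (cw_space K) \<Longrightarrow> \<exists>e\<in>cells K. x \<in> e \<and> (\<forall>f\<in>cells K. x \<in> f \<longrightarrow> e \<subseteq> f)"
    and generic_point: "e \<in> cells K \<Longrightarrow> \<exists>x\<in>e. \<forall>f\<in>cells K. x \<in> f \<longrightarrow> e \<subseteq> f"
    and cell_dim_unique: "e \<in> cw_cells K m \<Longrightarrow> e \<in> cw_cells K n \<Longrightarrow> m = n"
proof -
  note cs = assms[unfolded cell_structure_def]
  show "e \<in> cells K \<Longrightarrow> e \<subseteq> topspace (cw_space K)" using cs by simp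
  show "x \<in> topspace (cw_space K) \<Longrightarrow> \<exists>e\<in>cells K. x \<in> e \<and> (\<forall>f\<in>cells K. x \<in> f \<longrightarrow> e \<subseteq> f)"
    using cs by simp
  show "e \<in> cells K \<Longrightarrow> \<exists>x\<in>e. \<forall>f\<in>cells K. x \<in> f \<longrightarrow> e \<subseteq> f" using cs by simp
  have "cw_cells K m \<inter> cw_cells K n \<noteq> {} \<longrightarrow> m = n" using cs by simp
  then show "e \<in> cw_cells K m \<Longrightarrow> e \<in> cw_cells K n \<Longrightarrow> m = n" by blast
qed

text \<open>The open cells partition the space, and by induction on the dimension each point of a
  closed cell lies in an open cell whose closure is contained in that closed cell. So the closure of
  the open cell around a point is the smallest closed cell containing it, and the image of the
  centre of the ball is a generic point.\<close>

lemma finite_regular_cw_cell_structure: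
  assumes "finite_regular_cw K"
  shows "cell_structure K"
proof -
  obtain \<Phi> where
    \<Phi>: "\<And>n e. e \<in> cw_cells K n \<Longrightarrow> e \<subseteq> topspace (cw_space K) \<and>
           homeomorphic_map (closed_unit_ball n) (subtopology (cw_space K) e) (\<Phi> n e) \<and>
           (\<exists>L \<subseteq> (\<Union>m<n. cw_cells K m). \<Phi> n e ` unit_sphere_set n = \<Union>L)"
    and un: "\<And>x. x \<in> topspace (cw_space K) \<Longrightarrow>
           \<exists>!p. p \<in> (SIGMA n:UNIV. cw_cells K n) \<and> x \<in> \<Phi> (fst p) (snd p) ` open_unit_ball_set (fst p)"
    using assms unfolding finite_regular_cw_def by metis
  define opn where "opn n e = \<Phi> n e ` open_unit_ball_set n" for n e
  have un2: "n = n' \<and> e = e'" if "e \<in> cw_cells K n" "e' \<in> cw_cells K n'" "x \<in> opn n e" "x \<in> opn n' e'"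
    "x \<in> topspace (cw_space K)" for n n' e e' x
    using un[OF that(5)] that(1-4) unfolding opn_def by (metis (mono_tags) SigmaI UNIV_I fst_conv snd_conv)
  have ball: "topspace (closed_unit_ball n) = open_unit_ball_set n \<union> unit_sphere_set n" for n
    unfolding closed_unit_ball_def open_unit_ball_set_def unit_sphere_set_def
    by (auto simp: order_le_less)
  have split: "e = opn n e \<union> \<Phi> n e ` unit_sphere_set n" if e: "e \<in> cw_cells K n" for n e
  proof -
    have "\<Phi> n e ` topspace (closed_unit_ball n) = topspace (subtopology (cw_space K) e)"
      by (rule homeomorphic_imp_surjective_map[OF \<Phi>[OF e, THEN conjunct2, THEN conjunct1]])
    also have "\<dots> = e" using \<Phi>[OF e] by (simp add: Int_absorb1)
    finally show ?thesis unfolding ball opn_def by blast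
  qed
  have opn_subset: "opn n e \<subseteq> e" if e: "e \<in> cw_cells K n" for n e
    by (rule ord_le_eq_trans[OF Un_upper1 split[OF e, symmetric]])
  have below: "\<exists>m\<le>n. \<exists>e'\<in>cw_cells K m. x \<in> opn m e' \<and> e' \<subseteq> e" if "e \<in> cw_cells K n" "x \<in> e" for n e x
    using that
  proof (induction n arbitrary: e rule: less_induct)
    case (less n)
    show ?case
    proof (cases "x \<in> opn n e")
      case True
      then show ?thesis using less.prems by blast
    next
      case False
      from \<Phi>[OF less.prems(1), THEN conjunct2, THEN conjunct2]
      obtain L where L: "L \<subseteq> (\<Union>m<n. cw_cells K m)" "\<Phi> n e ` unit_sphere_set n = \<Union>L"
        by (elim exE conjE) (rule that)
      have eq: "e = opn n e \<union> \<Union>L" using split[OF less.prems(1)] unfolding L(2) .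
      from eq less.prems(2) have "x \<in> opn n e \<union> \<Union>L" by (rule eqset_imp_iff[THEN iffD1])
      then have xL: "x \<in> \<Union>L" using False by blast
      have Le: "\<Union>L \<subseteq> e" by (rule ord_le_eq_trans[OF Un_upper2 eq[symmetric]])
      then obtain l where l1: "l \<in> L" "x \<in> l" using xL by blast
      then obtain m where "m < n" "l \<in> cw_cells K m" using L(1) by blast
      moreover have "l \<subseteq> e" using l1 Le by blast
      ultimately have l: "l \<in> L" "x \<in> l" "m < n" "l \<in> cw_cells K m" "l \<subseteq> e" using l1 by simp_all
      then obtain m' e' where "m' \<le> m" "e' \<in> cw_cells K m'" "x \<in> opn m' e'" "e' \<subseteq> l"
        using less.IH[of m l] by blast
      then show ?thesis using l by (intro exI[of _ m']) auto
    qed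
  qed
  have top: "e \<subseteq> topspace (cw_space K)" if "e \<in> cells K" for e
    using that \<Phi>[THEN conjunct1] unfolding cells_def by blast
  have carrier: "e \<subseteq> f" if e: "e \<in> cw_cells K n" "x \<in> opn n e" "f \<in> cells K" "x \<in> f" for e n x f
  proof -
    obtain m where f: "f \<in> cw_cells K m" using e(3) unfolding cells_def by blast
    obtain m' e' where e': "e' \<in> cw_cells K m'" "x \<in> opn m' e'" "e' \<subseteq> f" using below[OF f e(4)] by blast
    have "x \<in> topspace (cw_space K)" using top[OF e(3)] e(4) by blast
    then show ?thesis using un2[OF e(1) e'(1) e(2) e'(2)] e'(3) by blast
  qed
  have ne: "\<exists>x. x \<in> opn n e" for n e
  proof -
    have "(\<lambda>_. 0) \<in> open_unit_ball_set n"
      by (simp add: open_unit_ball_set_def topspace_Euclidean_space)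
    then show ?thesis unfolding opn_def by blast
  qed
  have dim: "m = n" if "e \<in> cw_cells K m" "e \<in> cw_cells K n" for e m n
  proof -
    \<comment> \<open>A point of the open n'-cell of \<open>e\<close> lies, by \<open>below\<close>
      for the m'-cell \<open>e\<close>, in an open cell of dimension at most \<open>m'\<close>;
      uniqueness identifies the two open cells and their dimensions.\<close>
    have "n' \<le> m'" if e: "e \<in> cw_cells K m'" "e \<in> cw_cells K n'" for m' n'
    proof -
      obtain x where x: "x \<in> opn n' e" using ne by blast
      then have "x \<in> e" using opn_subset[OF e(2)] by blast
      then obtain m e' where "m \<le> m'" "e' \<in> cw_cells K m" "x \<in> opn m e'" using below[OF e(1)] by blast
      moreover have "x \<in> topspace (cw_space K)" using \<open>x \<in> e\<close> top[OF cells_I[OF e(1)]] by blast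
      ultimately show ?thesis using un2[OF e(2) _ x] by blast
    qed
    then show ?thesis using that by (meson antisym)
  qed
  have crr: "\<exists>e\<in>cells K. x \<in> e \<and> (\<forall>f\<in>cells K. x \<in> f \<longrightarrow> e \<subseteq> f)" if x0: "x \<in> topspace (cw_space K)" for x
  proof -
    obtain n e where e: "e \<in> cw_cells K n" "x \<in> opn n e"
      using un[OF x0] unfolding opn_def by auto
    then have "x \<in> e" using opn_subset[OF e(1)] by blast
    then show ?thesis using carrier[OF e] cells_I[OF e(1)] by blast
  qed
  have gen: "\<exists>x\<in>e. \<forall>f\<in>cells K. x \<in> f \<longrightarrow> e \<subseteq> f" if e0: "e \<in> cells K" for e
  proof -
    obtain n where e: "e \<in> cw_cells K n" using e0 unfolding cells_def by blast
    obtain x where x: "x \<in> opn n e" using ne by blast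
    then have "x \<in> e" using opn_subset[OF e(1)] by blast
    then show ?thesis using carrier[OF e x] by blast
  qed
  have "\<forall>m n. cw_cells K m \<inter> cw_cells K n \<noteq> {} \<longrightarrow> m = n" using dim by blast
  then show ?thesis unfolding cell_structure_def using top crr gen by simp
qed

section \<open>Faces of labelled simplices and their identifications\<close>

definition faces :: "nat \<Rightarrow> nat set set" where
  "faces d = {A. A \<subseteq> {..d} \<and> A \<noteq> {}}"

lemma facesD: "A \<in> faces d \<Longrightarrow> A \<subseteq> {..d} \<and> A \<noteq> {} \<and> finite A \<and> card A > 0"
  unfolding faces_def by (auto simp: card_gt_0_iff intro: finite_subset)

lemma faces_subset: "A \<in> faces d \<Longrightarrow> B \<subseteq> A \<Longrightarrow> B \<noteq> {} \<Longrightarrow> B \<in> faces d"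
  unfolding faces_def by auto

lemma faces_image: "A \<in> faces d \<Longrightarrow> \<pi> permutes {..d} \<Longrightarrow> \<pi> ` A \<in> faces d"
  unfolding faces_def using permutes_in_image by fastforce

lemma card_permutes_image: "\<pi> permutes S \<Longrightarrow> card (\<pi> ` A) = card A"
  by (meson card_image inj_on_subset permutes_inj subset_UNIV)

text \<open>A gluing along the facet opposite \<open>a\<close> affects exactly the faces that avoid
  \<open>a\<close>. For a \<open>gluing_set\<close> the steps are symmetric, so their reflexive
  transitive closure is the generated equivalence of faces.\<close>

definition face_step :: "gluing set \<Rightarrow> ((nat list \<times> nat set) \<times> (nat list \<times> nat set)) set" where
  "face_step M = {((w, A), (v, \<pi> ` A)) |w a v b \<pi> A. ((w, a), (v, b), \<pi>) \<in> M \<and> a \<notin> A}"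

lemma face_stepI: "((w, a), (v, b), \<pi>) \<in> M \<Longrightarrow> a \<notin> A \<Longrightarrow> ((w, A), (v, \<pi> ` A)) \<in> face_step M"
  unfolding face_step_def by blast

lemma face_step_mono: "M \<subseteq> M' \<Longrightarrow> face_step M \<subseteq> face_step M'"
  unfolding face_step_def by blast

lemma face_stepE:
  assumes "(s, t) \<in> face_step M"
  obtains w a v b \<pi> A where "((w, a), (v, b), \<pi>) \<in> M" "a \<notin> A" "s = (w, A)" "t = (v, \<pi> ` A)"
  using assms unfolding face_step_def by blast

lemma face_steps_closed:
  assumes "((w, A), (v, B)) \<in> (face_step M)\<^sup>*" and gs: "gluing_set d W M" and "w \<in> W" "A \<in> faces d"
  shows "v \<in> W \<and> B \<in> faces d"
proof -
  have "fst t \<in> W \<and> snd t \<in> faces d" if "(s, t) \<in> (face_step M)\<^sup>*" "fst s \<in> W \<and> snd s \<in> faces d" for s t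
    using that
  proof (induction rule: rtrancl_induct)
    case (step s' t)
    obtain w a v b \<pi> A where m: "((w, a), (v, b), \<pi>) \<in> M" "a \<notin> A" "s' = (w, A)" "t = (v, \<pi> ` A)"
      using step(2) by (rule face_stepE)
    then show ?case using step gluing_setD(5,7)[OF gs m(1)] by (auto intro: faces_image)
  qed auto
  from this[OF assms(1)] assms show ?thesis by simp
qed

lemma rtrancl_only_refl: "(s, t) \<in> r\<^sup>* \<Longrightarrow> (\<And>t. (s, t) \<notin> r) \<Longrightarrow> s = t"
  by (metis converse_rtranclE surj_pair)

text \<open>The cells of \<open>K\<close> are the faces of the simplices in \<open>W\<close>, two of them being equal exactly if the
  gluings in \<open>M\<close> say so.\<close>

locale labelled =
  fixes d :: nat and K :: "'a cw_complex" and W :: "nat list set" and M :: "gluing set"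
    and \<phi> :: "nat list \<Rightarrow> nat set \<Rightarrow> 'a set"
  assumes label_cell: "\<And>w A. w \<in> W \<Longrightarrow> A \<in> faces d \<Longrightarrow> \<phi> w A \<in> cw_cells K (card A - 1)"
    and label_surj: "\<And>e n. e \<in> cw_cells K n \<Longrightarrow> \<exists>w\<in>W. \<exists>A\<in>faces d. e = \<phi> w A"
    and label_order: "\<And>w A B. w \<in> W \<Longrightarrow> A \<in> faces d \<Longrightarrow> B \<in> faces d \<Longrightarrow> \<phi> w A \<subseteq> \<phi> w B \<longleftrightarrow> A \<subseteq> B"
    and label_below: "\<And>w B e. w \<in> W \<Longrightarrow> B \<in> faces d \<Longrightarrow> e \<in> cells K \<Longrightarrow> e \<subseteq> \<phi> w B \<Longrightarrow>
      \<exists>A\<in>faces d. A \<subseteq> B \<and> e = \<phi> w A"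
    and label_kernel: "\<And>w v A B. w \<in> W \<Longrightarrow> v \<in> W \<Longrightarrow> A \<in> faces d \<Longrightarrow> B \<in> faces d \<Longrightarrow>
      \<phi> w A = \<phi> v B \<longleftrightarrow> ((w, A), (v, B)) \<in> (face_step M)\<^sup>*"
begin

lemma label_cells: "w \<in> W \<Longrightarrow> A \<in> faces d \<Longrightarrow> \<phi> w A \<in> cells K"
  using label_cell cells_I by blast

lemma label_inj: "w \<in> W \<Longrightarrow> A \<in> faces d \<Longrightarrow> B \<in> faces d \<Longrightarrow> \<phi> w A = \<phi> w B \<longleftrightarrow> A = B"
  using label_order[of w A B] label_order[of w B A] by auto

lemma label_dim:
  assumes "cell_structure K" "w \<in> W" "A \<in> faces d" "\<phi> w A \<in> cw_cells K n"
  shows "card A = n + 1"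
proof -
  have "card A - 1 = n" using cell_dim_unique[OF assms(1) label_cell[OF assms(2,3)] assms(4)] .
  then show ?thesis using facesD[OF assms(3)] by linarith
qed

end

lemma card_Suc_complement:
  assumes "A \<subseteq> S" "finite S" "card S = card A + 1"
  obtains a where "a \<in> S" "A = S - {a}"
proof -
  have "card (S - A) = 1" using assms by (simp add: card_Diff_subset finite_subset)
  then obtain a where "S - A = {a}" by (auto simp: card_1_singleton_iff)
  then show ?thesis using assms(1) that[of a] by blast
qed

text \<open>If the facet were glued to a facet of another simplex, it would lie in two d-cells: no
  step starts at the full face, which contains every vertex, so the two simplices stay distinct. If
  it were glued to a facet of its own simplex, the labels there would not be injective.\<close>

lemma boundary_label:
  assumes "labelled d K W M \<phi>" and gs: "gluing_set d W M" and cs: "cell_structure K" and d: "d \<ge> 1"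
    and e: "e \<in> boundary_cells d K (d - 1)"
  obtains w a where "w \<in> W" "a \<le> d" "e = \<phi> w ({..d} - {a})" "(w, a) \<notin> glued M"
proof -
  interpret labelled d K W M \<phi> by fact
  obtain r where e1: "e \<in> cw_cells K (d - 1)" and r: "r \<in> cw_cells K (d - 1)" "e \<subseteq> r"
    and c: "card {f \<in> cw_cells K d. r \<subseteq> f} = 1"
    using e unfolding boundary_cells_def by blast
  obtain w A where w: "w \<in> W" "A \<in> faces d" "e = \<phi> w A" using label_surj[OF e1] by blast
  obtain u C where u: "u \<in> W" "C \<in> faces d" "r = \<phi> u C" using label_surj[OF r(1)] by blast
  obtain C' where C': "C' \<in> faces d" "C' \<subseteq> C" "e = \<phi> u C'"
    using label_below[OF u(1,2) cells_I[OF e1]] r(2) u(3) by blast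
  have "card C = card C'" using label_dim[OF cs u(1,2)] label_dim[OF cs u(1) C'(1)] u C' r e1 by auto
  \<comment> \<open>A boundary cell is only known to lie in a facet \<open>r\<close> that belongs to
    a single d-cell; since \<open>e\<close> has the dimension of \<open>r\<close>, the two
    agree.\<close>
  then have re: "r = e" using C' u facesD[OF u(2)] by (metis card_subset_eq)
  have cA: "card A = d" using label_dim[OF cs w(1,2)] w(3) e1 d by auto
  obtain a where a: "a \<in> {..d}" "A = {..d} - {a}"
    by (rule card_Suc_complement[of A "{..d}"]) (use facesD[OF w(2)] cA in auto)
  have full: "{..d} \<in> faces d" unfolding faces_def by auto
  have "(w, a) \<notin> glued M"
  proof
    assume "(w, a) \<in> glued M"
    then obtain v b \<pi> where m: "((w, a), (v, b), \<pi>) \<in> M" unfolding glued_def by force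
    note D = gluing_setD[OF gs m]
    have B: "\<pi> ` A = {..d} - {b}" using D(7,8) a
      by (simp add: image_set_diff permutes_inj permutes_image)
    have B': "{..d} - {b} \<in> faces d" using faces_image[OF w(2) D(7)] B by simp
    have "((w, A), (v, {..d} - {b})) \<in> (face_step M)\<^sup>*"
      using face_stepI[OF m, of A] a B by auto
    then have eq: "\<phi> w A = \<phi> v ({..d} - {b})" using label_kernel[OF w(1) _ w(2) B'] D by auto
    show False
    proof (cases "w = v")
      case True
      then have "{..d} - {a} = {..d} - {b}" using eq label_inj[OF w(1) w(2) B'] a by simp
      then have "a = b" using a by (metis Diff_iff insertI1 singletonD atMost_iff D(6) snd_conv)
      then show False using D(2) True by simp
    next
      case False
      have vW: "v \<in> W" using D by simp
      have "\<phi> w {..d} \<in> {f \<in> cw_cells K d. r \<subseteq> f}" "\<phi> v {..d} \<in> {f \<in> cw_cells K d. r \<subseteq> f}"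
        using label_cell[OF w(1) full] label_cell[OF vW full] label_order[OF w(1,2) full]
          label_order[OF vW B' full] facesD[OF w(2)] re w(3) eq by auto
      moreover obtain g where "{f \<in> cw_cells K d. r \<subseteq> f} = {g}" using c by (auto simp: card_1_singleton_iff)
      ultimately have "\<phi> w {..d} = \<phi> v {..d}" by (metis singletonD)
      then have "((w, {..d}), (v, {..d})) \<in> (face_step M)\<^sup>*" using label_kernel[OF w(1) vW full full] by simp
      moreover have "((w, {..d}), t) \<notin> face_step M" for t
        using gluing_setD(4)[OF gs] by (auto elim!: face_stepE)
      ultimately have "(w, {..d}) = (v, {..d})" by (rule rtrancl_only_refl)
      then show False using False by simp
    qed
  qed
  then show ?thesis using that w a by auto
qed


text \<open>A chain of length \<open>d + 2\<close> forces the rank of the boolean interval to be at least \<open>d + 1\<close>, and a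
  surjection from \<open>2 ^ (d + 1)\<close> elements forces it to be at most that.\<close>

lemma boolean_interval_inj:
  assumes "boolean_interval P" and g: "g ` Pow {..d::nat} = P"
    and mono: "\<And>A B. A \<subset> B \<Longrightarrow> B \<subseteq> {..d} \<Longrightarrow> g A \<subset> g B"
  shows "inj_on g (Pow {..d})"
proof -
  obtain S :: "nat set" and f where S: "finite S" and f: "bij_betw f (Pow S) P"
    and ord: "\<And>a b. a \<subseteq> S \<Longrightarrow> b \<subseteq> S \<Longrightarrow> f a \<subseteq> f b \<longleftrightarrow> a \<subseteq> b"
    using assms(1) unfolding boolean_interval_def by auto
  have "i \<le> d + 1 \<Longrightarrow> \<exists>a\<subseteq>S. f a = g {..<i} \<and> i \<le> card a" for i
  proof (induction i)
    case 0
    have "g {..<0} \<in> P" using g by auto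
    then show ?case using f unfolding bij_betw_def by auto
  next
    case (Suc i)
    then obtain a where a: "a \<subseteq> S" "f a = g {..<i}" "i \<le> card a" by auto
    have "g {..<Suc i} \<in> P" using g Suc.prems by auto
    then obtain b where b: "b \<subseteq> S" "f b = g {..<Suc i}" using f unfolding bij_betw_def by auto
    have "g {..<i} \<subset> g {..<Suc i}" using Suc.prems by (intro mono) auto
    then have "a \<subset> b" using ord[OF a(1) b(1)] ord[OF b(1) a(1)] a(2) b(2) by auto
    then have "card a < card b" using b S by (meson finite_subset psubset_card_mono)
    then show ?case using a b by (intro exI[of _ b]) auto
  qed
  from this[of "d + 1"] have "d + 1 \<le> card S" using S by (auto dest: card_mono)
  then have "(2::nat) ^ (d + 1) \<le> 2 ^ card S" by (intro power_increasing) auto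
  also have "\<dots> = card P" using bij_betw_same_card[OF f] S by (simp add: card_Pow)
  finally have "card (Pow {..d}) \<le> card (g ` Pow {..d})" by (simp add: g card_Pow)
  then show ?thesis by (intro eq_card_imp_inj_on) (auto intro: antisym card_image_le)
qed

text \<open>Preservation of dimension sends vertices to vertices, which yields the permutation. The
  image of a larger face contains the images of its vertices and has equally many vertices, so it is
  determined as well.\<close>

lemma face_bijection_permutation:
  assumes "labelled d K W M \<phi>" and cs: "cell_structure K"
    and w: "w \<in> W" "a \<le> d" and v: "v \<in> W" "b \<le> d"
    and inj: "inj_on h (\<phi> w ({..d} - {a}))"
    and faces: "\<And>n. image h ` {e \<in> cw_cells K n. e \<subseteq> \<phi> w ({..d} - {a})} = {e \<in> cw_cells K n. e \<subseteq> \<phi> v ({..d} - {b})}"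
    and d: "d \<ge> 1"
  obtains \<pi> where "\<pi> permutes {..d}" "\<pi> a = b" "\<And>A. A \<in> faces d \<Longrightarrow> a \<notin> A \<Longrightarrow> h ` \<phi> w A = \<phi> v (\<pi> ` A)"
proof -
  interpret labelled d K W M \<phi> by fact
  let ?a = "{..d} - {a}" and ?b = "{..d} - {b}"
  have proper: "?a \<in> faces d" "?b \<in> faces d"
  proof -
    have "card ({..d} - {x}) > 0" if "x \<le> d" for x using that d by simp
    then have "{..d} - {x} \<noteq> {}" if "x \<le> d" for x using that by (metis card_gt_0_iff)
    then show "?a \<in> faces d" "?b \<in> faces d" using w(2) v(2) unfolding faces_def by auto
  qed
  have img: "\<exists>B\<in>faces d. B \<subseteq> ?b \<and> h ` \<phi> w A = \<phi> v B \<and> card B = card A" if A: "A \<in> faces d" "A \<subseteq> ?a" for A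
  proof -
    have "\<phi> w A \<in> {e \<in> cw_cells K (card A - 1). e \<subseteq> \<phi> w ?a}"
      using label_cell[OF w(1) A(1)] label_order[OF w(1) A(1) proper(1)] A by simp
    from imageI[OF this, of "image h"]
    have hA: "h ` \<phi> w A \<in> {e \<in> cw_cells K (card A - 1). e \<subseteq> \<phi> v ?b}" unfolding faces .
    then have "h ` \<phi> w A \<in> cells K" "h ` \<phi> w A \<subseteq> \<phi> v ?b" using cells_I by auto
    from label_below[OF v(1) proper(2) this]
    obtain B where B: "B \<in> faces d" "B \<subseteq> ?b" "h ` \<phi> w A = \<phi> v B" by blast
    then show ?thesis using label_dim[OF cs v(1) B(1), of "card A - 1"] hA facesD[OF A(1)] by auto
  qed
  have sing: "{i} \<in> faces d" if "i \<le> d" for i using that unfolding faces_def by auto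
  have "\<exists>j. j \<in> ?b \<and> h ` \<phi> w {i} = \<phi> v {j}" if i: "i \<in> ?a" for i
  proof -
    obtain B where B: "B \<in> faces d" "B \<subseteq> ?b" "h ` \<phi> w {i} = \<phi> v B" "card B = card {i}"
      using img[of "{i}"] sing i by auto
    then obtain j where "B = {j}" by (auto simp: card_1_singleton_iff)
    then show ?thesis using B by auto
  qed
  then obtain p where p: "\<And>i. i \<in> ?a \<Longrightarrow> p i \<in> ?b \<and> h ` \<phi> w {i} = \<phi> v {p i}" by metis
  have sub: "\<phi> w A \<subseteq> \<phi> w ?a" if "A \<in> faces d" "A \<subseteq> ?a" for A
    using label_order[OF w(1) that(1) proper(1)] that by simp
  have pinj: "inj_on p ?a"
  proof (rule inj_onI)
    fix i j assume ij: "i \<in> ?a" "j \<in> ?a" "p i = p j"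
    then have "h ` \<phi> w {i} = h ` \<phi> w {j}" using p by simp
    then have "\<phi> w {i} = \<phi> w {j}" using inj_on_image_eq_iff[OF inj] sub sing ij by simp
    then show "i = j" using label_inj[OF w(1) sing sing] ij by auto
  qed
  have "p ` ?a = ?b"
  proof (rule card_subset_eq)
    show "card (p ` ?a) = card ?b" using card_image[OF pinj] w v by simp
  qed (use p in auto)
  \<comment> \<open>The map of facet vertices is completed by \<open>a\<close> going to
    \<open>b\<close>, as the convention for gluings demands, and by the identity outside
    \<open>{..d}\<close>.\<close>
  define \<pi> where "\<pi> i = (if i = a then b else if i \<le> d then p i else i)" for i
  have "bij_betw \<pi> {..d} {..d}"
  proof (rule bij_betw_imageI)
    have "\<pi> ` {..d} = insert b (p ` ?a)" unfolding \<pi>_def using w by (auto simp: image_iff)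
    then show im: "\<pi> ` {..d} = {..d}" using \<open>p ` ?a = ?b\<close> v by auto
    then show "inj_on \<pi> {..d}" by (intro eq_card_imp_inj_on) auto
  qed
  then have \<pi>: "\<pi> permutes {..d}" by (rule bij_imp_permutes) (use w in \<open>auto simp: \<pi>_def\<close>)
  have "h ` \<phi> w A = \<phi> v (\<pi> ` A)" if A: "A \<in> faces d" "a \<notin> A" for A
  proof -
    have Aa: "A \<subseteq> ?a" using A facesD by auto
    obtain B where B: "B \<in> faces d" "B \<subseteq> ?b" "h ` \<phi> w A = \<phi> v B" "card B = card A" using img[OF A(1) Aa] by blast
    have "\<pi> ` A \<subseteq> B"
    proof
      fix j assume "j \<in> \<pi> ` A"
      then obtain i where i: "i \<in> A" "j = \<pi> i" by blast
      then have ia: "i \<in> ?a" and j: "j = p i" using Aa A facesD[OF A(1)] by (auto simp: \<pi>_def)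
      have "\<phi> w {i} \<subseteq> \<phi> w A" using label_order[OF w(1) _ A(1)] sing ia i by auto
      then have "\<phi> v {j} \<subseteq> \<phi> v B" using p[OF ia] B(3) j by blast
      then show "j \<in> B" using label_order[OF v(1) sing B(1)] p[OF ia] j by auto
    qed
    then have "\<pi> ` A = B" using card_permutes_image[OF \<pi>, of A] B(4) facesD[OF B(1)] by (metis card_subset_eq)
    then show ?thesis using B by simp
  qed
  then show ?thesis using that[OF \<pi>] by (auto simp: \<pi>_def)
qed


section \<open>The quotient by the identification of two facets\<close>

text \<open>This covers both phases of a local construction: when a simplex is attached,
  \<open>K\<close> is a disjoint union. The boolean intervals are those of the quotient
  \<open>K'\<close>, where they keep the faces of each simplex apart.\<close>

locale facet_identification = labelled +
  fixes K' :: "'b cw_complex" and h :: "'a \<Rightarrow> 'a" and q :: "'a \<Rightarrow> 'b"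
    and w v :: "nat list" and a b :: nat and \<pi> :: "nat \<Rightarrow> nat"
  assumes gs: "gluing_set d W M" and cs: "cell_structure K" and cs': "cell_structure K'"
    and boolean: "\<And>n e. e \<in> cw_cells K' n \<Longrightarrow> boolean_interval (lower_interval K' e)"
    and wa: "w \<in> W" "a \<le> d" and vb: "v \<in> W" "b \<le> d"
    and \<pi>: "\<pi> permutes {..d}" "\<pi> a = b"
    and h_bij: "inj_on h (\<phi> w ({..d} - {a}))" "h ` \<phi> w ({..d} - {a}) = \<phi> v ({..d} - {b})"
    and h_cells: "\<And>n. image h ` {e \<in> cw_cells K n. e \<subseteq> \<phi> w ({..d} - {a})} =
      {e \<in> cw_cells K n. e \<subseteq> \<phi> v ({..d} - {b})}"
    and h_label: "\<And>A. A \<in> faces d \<Longrightarrow> a \<notin> A \<Longrightarrow> h ` \<phi> w A = \<phi> v (\<pi> ` A)"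
    and q_cells: "\<And>n. cw_cells K' n = image q ` cw_cells K n"
    and q_eq: "\<And>x y. x \<in> topspace (cw_space K) \<Longrightarrow> y \<in> topspace (cw_space K) \<Longrightarrow>
      q x = q y \<longleftrightarrow> x = y \<or> (x \<in> \<phi> w ({..d} - {a}) \<and> y = h x) \<or> (y \<in> \<phi> w ({..d} - {a}) \<and> x = h y)"
    and d: "d \<ge> 1"
begin

abbreviation "\<sigma> \<equiv> \<phi> w ({..d} - {a})"
abbreviation "\<tau> \<equiv> \<phi> v ({..d} - {b})"
abbreviation "M' \<equiv> add_gluing ((w, a), (v, b), \<pi>) M"

lemma proper: "{..d} - {a} \<in> faces d" "{..d} - {b} \<in> faces d"
proof -
  have "{..d} - {x} \<noteq> {}" for x
  proof
    assume "{..d} - {x} = {}"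
    then have "0 = x" "1 = x" using d by (auto simp: subset_iff)
    then show False by linarith
  qed
  then show "{..d} - {a} \<in> faces d" "{..d} - {b} \<in> faces d" unfolding faces_def by auto
qed

lemma sigma_cell: "\<sigma> \<in> cells K" and tau_cell: "\<tau> \<in> cells K"
  using label_cells proper wa vb by auto

lemma q_cells': "cells K' = image q ` cells K"
  unfolding cells_def q_cells by blast

lemma h_cell:
  assumes "e \<in> cells K" "e \<subseteq> \<sigma>"
  shows "h ` e \<in> cells K" "h ` e \<subseteq> \<tau>"
proof -
  obtain n where "e \<in> {e \<in> cw_cells K n. e \<subseteq> \<sigma>}" using assms unfolding cells_def by blast
  from imageI[OF this, of "image h"] have "h ` e \<in> {e \<in> cw_cells K n. e \<subseteq> \<tau>}" unfolding h_cells .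
  then show "h ` e \<in> cells K" "h ` e \<subseteq> \<tau>" using cells_I by auto
qed

lemma h_cell_inverse:
  assumes "e \<in> cells K" "e \<subseteq> \<tau>"
  obtains e' where "e' \<in> cells K" "e' \<subseteq> \<sigma>" "e = h ` e'"
proof -
  obtain n where "e \<in> {e \<in> cw_cells K n. e \<subseteq> \<tau>}" using assms unfolding cells_def by blast
  then have "e \<in> image h ` {e \<in> cw_cells K n. e \<subseteq> \<sigma>}" unfolding h_cells .
  then show ?thesis using that cells_I by blast
qed

lemma q_h:
  assumes "e \<in> cells K" "e \<subseteq> \<sigma>"
  shows "q ` h ` e = q ` e"
proof -
  have "q (h x) = q x" if "x \<in> e" for x
  proof -
    have "x \<in> topspace (cw_space K)" using cell_subset_topspace[OF cs assms(1)] that by blast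
    moreover have "h x \<in> topspace (cw_space K)"
      using cell_subset_topspace[OF cs h_cell(1)[OF assms]] that by blast
    moreover have "x \<in> \<sigma>" using assms(2) that by blast
    ultimately show ?thesis using q_eq[of x "h x"] by simp
  qed
  then show ?thesis by (auto simp: image_image intro!: image_cong)
qed

text \<open>A generic point \<open>x\<close> of \<open>e\<close> has the same image as some
  \<open>y\<close> in \<open>f\<close>, so \<open>y\<close> is \<open>x\<close> or its partner under
  \<open>h\<close>. The smallest cell containing \<open>y\<close> lies in \<open>f\<close>, and it
  contains \<open>e\<close> or the cell corresponding to \<open>e\<close> under \<open>h\<close>;
  this cell is the lift \<open>e'\<close>.\<close>

lemma q_subset:
  assumes e: "e \<in> cells K" and f: "f \<in> cells K" and sub: "q ` e \<subseteq> q ` f"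
  shows "\<exists>e'\<in>cells K. e' \<subseteq> f \<and> q ` e' = q ` e \<and> (e' = e \<or> e \<subseteq> \<sigma> \<and> e' = h ` e \<or> e' \<subseteq> \<sigma> \<and> e = h ` e')"
proof -
  obtain x where x: "x \<in> e" "\<And>g. g \<in> cells K \<Longrightarrow> x \<in> g \<Longrightarrow> e \<subseteq> g" using generic_point[OF cs e] by blast
  have xt: "x \<in> topspace (cw_space K)" using x cell_subset_topspace[OF cs e] by blast
  obtain y where y: "y \<in> f" "q x = q y" using sub x(1) by blast
  have yt: "y \<in> topspace (cw_space K)" using y cell_subset_topspace[OF cs f] by blast
  obtain g where g: "g \<in> cells K" "y \<in> g" "\<And>f. f \<in> cells K \<Longrightarrow> y \<in> f \<Longrightarrow> g \<subseteq> f"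
    using carrier_cell[OF cs yt] by blast
  have gf: "g \<subseteq> f" using g(3)[OF f y(1)] .
  consider "x = y" | "x \<in> \<sigma>" "y = h x" | "y \<in> \<sigma>" "x = h y" using q_eq[OF xt yt] y(2) by blast
  then show ?thesis
  proof cases
    case 1
    then show ?thesis using x(2)[OF f] y(1) e by blast
  next
    case 2
    have e\<sigma>: "e \<subseteq> \<sigma>" using x(2)[OF sigma_cell] 2 by blast
    have "y \<in> \<tau>" using 2 h_bij(2) by blast
    then have "g \<subseteq> \<tau>" using g(3)[OF tau_cell] by blast
    then obtain g' where g': "g' \<in> cells K" "g' \<subseteq> \<sigma>" "g = h ` g'" using h_cell_inverse[OF g(1)] by blast
    then have "x \<in> g'" using g(2) 2 h_bij(1) by (metis inj_on_image_mem_iff)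
    then have "e \<subseteq> g'" using x(2)[OF g'(1)] by simp
    then have "h ` e \<subseteq> g" unfolding g'(3) by (rule image_mono)
    then have "h ` e \<subseteq> f" using gf by (rule subset_trans)
    then show ?thesis using e\<sigma> q_h[OF e e\<sigma>] h_cell(1)[OF e e\<sigma>] by (intro bexI[of _ "h ` e"]) simp_all
  next
    case 3
    have g\<sigma>: "g \<subseteq> \<sigma>" using g(3)[OF sigma_cell] 3 by blast
    have "x \<in> \<tau>" using 3 h_bij(2) by blast
    then have "e \<subseteq> \<tau>" using x(2)[OF tau_cell] by blast
    then obtain e' where e': "e' \<in> cells K" "e' \<subseteq> \<sigma>" "e = h ` e'" using h_cell_inverse[OF e] by blast
    have "x \<in> h ` g" using 3 g(2) by blast
    then have "h ` e' \<subseteq> h ` g" using x(2)[OF h_cell(1)[OF g(1) g\<sigma>]] e'(3) by simp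
    then have "e' \<subseteq> g" using inj_on_image_subset_iff[OF h_bij(1) e'(2) g\<sigma>] by simp
    then have "e' \<subseteq> f" using gf by blast
    moreover have "q ` e' = q ` e" using q_h[OF e'(1,2)] e'(3) by simp
    ultimately show ?thesis using e' by (intro bexI[of _ e']) simp_all
  qed
qed

lemma q_label_below:
  assumes "u \<in> W" "B \<in> faces d" "e \<in> cells K'" "e \<subseteq> q ` \<phi> u B"
  shows "\<exists>A\<in>faces d. A \<subseteq> B \<and> e = q ` \<phi> u A"
proof -
  obtain e0 where e0: "e0 \<in> cells K" "e = q ` e0" using assms(3) unfolding q_cells' by blast
  have "q ` e0 \<subseteq> q ` \<phi> u B" using assms(4) e0(2) by simp
  from q_subset[OF e0(1) label_cells[OF assms(1,2)] this]
  obtain e' where e': "e' \<in> cells K" "e' \<subseteq> \<phi> u B" "q ` e' = q ` e0" by blast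
  then show ?thesis using label_below[OF assms(1,2) e'(1,2)] e0(2) by blast
qed

lemma q_label_cell: "u \<in> W \<Longrightarrow> A \<in> faces d \<Longrightarrow> q ` \<phi> u A \<in> cw_cells K' (card A - 1)"
  unfolding q_cells using label_cell by blast

text \<open>If two faces of the simplex \<open>u\<close> merged, fewer than 2^(d+1) elements would
  lie below its top cell. The faces of increasing dimension form a chain that already forces the
  boolean interval to have that many elements.\<close>

lemma q_label_order:
  assumes u: "u \<in> W" and A: "A \<in> faces d" "B \<in> faces d"
  shows "q ` \<phi> u A \<subseteq> q ` \<phi> u B \<longleftrightarrow> A \<subseteq> B"
proof -
  \<comment> \<open>The empty face is sent to the empty set, the bottom element of
    \<open>lower_interval\<close>, so that \<open>g\<close> is defined on a full power set.\<close>
  define g where "g A = (if A = {} then {} else q ` \<phi> u A)" for A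
  have full: "{..d} \<in> faces d" unfolding faces_def by auto
  have g_mono: "g A \<subseteq> g B" if "A \<subseteq> B" "B \<subseteq> {..d}" for A B
  proof (cases "A = {}")
    case False
    then have "A \<in> faces d" "B \<in> faces d" using that unfolding faces_def by auto
    then have "\<phi> u A \<subseteq> \<phi> u B" using label_order[OF u] that by simp
    then show ?thesis using False that unfolding g_def by auto
  qed (simp add: g_def)
  have inj: "inj_on g (Pow {..d})"
  proof (rule boolean_interval_inj)
    show "boolean_interval (lower_interval K' (q ` \<phi> u {..d}))"
      using boolean[OF q_label_cell[OF u full]] .
    show "g ` Pow {..d} = lower_interval K' (q ` \<phi> u {..d})"
    proof (intro equalityI subsetI)
      fix e assume "e \<in> g ` Pow {..d}"
      then obtain A where A: "A \<subseteq> {..d}" "e = g A" by blast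
      show "e \<in> lower_interval K' (q ` \<phi> u {..d})"
      proof (cases "A = {}")
        case False
        then have f: "A \<in> faces d" using A unfolding faces_def by auto
        have "e \<subseteq> q ` \<phi> u {..d}" using g_mono[OF A(1) order_refl] A(2) by (simp add: g_def split: if_splits)
        moreover have "e \<in> cw_cells K' (card A - 1)" using q_label_cell[OF u f] A False by (simp add: g_def)
        ultimately show ?thesis unfolding lower_interval_def by blast
      qed (simp add: A g_def lower_interval_def)
    next
      fix e assume "e \<in> lower_interval K' (q ` \<phi> u {..d})"
      then consider "e = {}" | "e \<in> cells K'" "e \<subseteq> q ` \<phi> u {..d}"
        unfolding lower_interval_def using cells_I by blast
      then show "e \<in> g ` Pow {..d}"
      proof cases
        case 1
        then show ?thesis by (intro image_eqI[of _ _ "{}"]) (auto simp: g_def)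
      next
        case 2
        then obtain A where "A \<in> faces d" "e = q ` \<phi> u A" using q_label_below[OF u full] by blast
        then show ?thesis by (intro image_eqI[of _ _ A]) (auto simp: g_def faces_def)
      qed
    qed
  next
    fix A B :: "nat set" assume AB: "A \<subset> B" "B \<subseteq> {..d}"
    then have fB: "B \<in> faces d" unfolding faces_def by auto
    have cellB: "q ` \<phi> u B \<in> cells K'" using q_label_cell[OF u fB] by (rule cells_I)
    have "g A \<noteq> g B"
    proof (cases "A = {}")
      case True
      then show ?thesis using generic_point[OF cs' cellB] fB unfolding g_def faces_def by auto
    next
      case False
      then have fA: "A \<in> faces d" using AB unfolding faces_def by auto
      have "card A < card B" using AB facesD[OF fB] by (simp add: psubset_card_mono)
      then have "q ` \<phi> u A \<noteq> q ` \<phi> u B"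
        using cell_dim_unique[OF cs' q_label_cell[OF u fA]] q_label_cell[OF u fB] facesD[OF fA] by fastforce
      then show ?thesis using False fB by (simp add: g_def faces_def)
    qed
    then show "g A \<subset> g B" using g_mono AB by blast
  qed
  show ?thesis
  proof
    assume "A \<subseteq> B"
    then have "\<phi> u A \<subseteq> \<phi> u B" using label_order[OF u A] by simp
    then show "q ` \<phi> u A \<subseteq> q ` \<phi> u B" by blast
  next
    assume "q ` \<phi> u A \<subseteq> q ` \<phi> u B"
    then obtain C where C: "C \<in> faces d" "C \<subseteq> B" "q ` \<phi> u A = q ` \<phi> u C"
      using q_label_below[OF u A(2) cells_I[OF q_label_cell[OF u A(1)]]] by blast
    then have "g A = g C" using A facesD[OF A(1)] facesD[OF C(1)] by (simp add: g_def)
    then have "A = C" using inj_onD[OF inj] facesD[OF A(1)] facesD[OF C(1)] by blast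
    then show "A \<subseteq> B" using C by simp
  qed
qed

lemma face_step_new: "A \<subseteq> {..d} - {a} \<Longrightarrow> ((w, A), (v, \<pi> ` A)) \<in> face_step M'"
  by (rule face_stepI) (auto simp: add_gluing_def)

lemma face_step_new': "A \<subseteq> {..d} - {a} \<Longrightarrow> ((v, \<pi> ` A), (w, A)) \<in> face_step M'"
proof -
  assume A: "A \<subseteq> {..d} - {a}"
  have "b \<notin> \<pi> ` A" using \<pi> A by (metis Diff_iff image_iff injD insertI1 permutes_inj subsetD)
  then have "((v, \<pi> ` A), (w, inv \<pi> ` \<pi> ` A)) \<in> face_step M'"
    by (intro face_stepI) (auto simp: add_gluing_def rev_gluing_def)
  then show ?thesis using \<pi>(1) by (simp add: image_image permutes_inverses)
qed

lemma q_label_step: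
  assumes "((u, A), (t, B)) \<in> face_step M'" and u: "u \<in> W" "A \<in> faces d"
  shows "t \<in> W \<and> B \<in> faces d \<and> q ` \<phi> u A = q ` \<phi> t B"
proof -
  obtain x y \<rho> where m: "((u, x), (t, y), \<rho>) \<in> M'" "x \<notin> A" "B = \<rho> ` A"
    using assms(1) by (elim face_stepE) auto
  have new: "q ` \<phi> w C = q ` \<phi> v (\<pi> ` C)" if "C \<in> faces d" "a \<notin> C" for C
  proof -
    have "C \<subseteq> {..d} - {a}" using that facesD by auto
    then have "\<phi> w C \<subseteq> \<sigma>" using label_order[OF wa(1) that(1) proper(1)] by simp
    then show ?thesis using q_h[OF label_cells[OF wa(1) that(1)]] h_label[OF that] by simp
  qed
  consider "((u, x), (t, y), \<rho>) \<in> M" | "u = w" "x = a" "t = v" "\<rho> = \<pi>" | "u = v" "x = b" "t = w" "\<rho> = inv \<pi>"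
    using m(1) unfolding add_gluing_def rev_gluing_def by auto
  then show ?thesis
  proof cases
    case 1
    note D = gluing_setD[OF gs 1]
    have "t \<in> W" "B \<in> faces d" using D m(3) faces_image[OF u(2)] by auto
    moreover have "((u, A), (t, B)) \<in> (face_step M)\<^sup>*" using face_stepI[OF 1 m(2)] m(3) by auto
    ultimately show ?thesis using label_kernel[OF u(1) _ u(2)] by auto
  next
    case 2
    then show ?thesis using new[OF u(2)] m vb faces_image[OF u(2) \<pi>(1)] by simp
  next
    case 3
    have i: "inv \<pi> permutes {..d}" using \<pi>(1) by (rule permutes_inv)
    have B: "B \<in> faces d" "\<pi> ` B = A" using faces_image[OF u(2) i] m 3 \<pi>(1)
      by (auto simp: image_image permutes_inverses)
    moreover have "a \<notin> B" using B(2) m(2) 3 \<pi>(2) by blast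
    ultimately show ?thesis using new[OF B(1)] 3 wa by simp
  qed
qed

text \<open>For the direction from equal images, \<open>q_subset\<close> lifts the common image to a
  cell inside \<open>\<phi> t B\<close>, and equality of dimensions makes it all of
  \<open>\<phi> t B\<close>. This cell is \<open>\<phi> u A\<close> or its partner under
  \<open>h\<close>, so the new gluing is crossed at most once, between chains of old steps.\<close>

lemma q_label_kernel:
  assumes u: "u \<in> W" "A \<in> faces d" and t: "t \<in> W" "B \<in> faces d"
  shows "q ` \<phi> u A = q ` \<phi> t B \<longleftrightarrow> ((u, A), (t, B)) \<in> (face_step M')\<^sup>*"
proof
  assume "((u, A), (t, B)) \<in> (face_step M')\<^sup>*"
  moreover have "(s, s') \<in> (face_step M')\<^sup>* \<Longrightarrow> fst s \<in> W \<and> snd s \<in> faces d \<Longrightarrow>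
      fst s' \<in> W \<and> snd s' \<in> faces d \<and> q ` \<phi> (fst s) (snd s) = q ` \<phi> (fst s') (snd s')" for s s'
  proof (induction rule: rtrancl_induct)
    case (step s' s'')
    then show ?case using q_label_step[of "fst s'" "snd s'" "fst s''" "snd s''"] by simp
  qed simp
  ultimately show "q ` \<phi> u A = q ` \<phi> t B" using u t by fastforce
next
  assume eq: "q ` \<phi> u A = q ` \<phi> t B"
  have MM: "(face_step M)\<^sup>* \<subseteq> (face_step M')\<^sup>*"
    by (intro rtrancl_mono face_step_mono) (auto simp: add_gluing_def)
  have ker: "((u1, A1), (u2, A2)) \<in> (face_step M')\<^sup>*"
    if "u1 \<in> W" "u2 \<in> W" "A1 \<in> faces d" "A2 \<in> faces d" "\<phi> u1 A1 = \<phi> u2 A2" for u1 u2 A1 A2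
    using label_kernel[OF that(1-4)] that(5) MM by blast
  have \<sigma>E: "\<exists>C\<in>faces d. C \<subseteq> {..d} - {a} \<and> e = \<phi> w C \<and> h ` e = \<phi> v (\<pi> ` C) \<and> \<pi> ` C \<in> faces d"
    if "e \<in> cells K" "e \<subseteq> \<sigma>" for e
    using label_below[OF wa(1) proper(1) that] h_label faces_image[OF _ \<pi>(1)] by blast
  obtain e' where e': "e' \<in> cells K" "e' \<subseteq> \<phi> t B" "q ` e' = q ` \<phi> u A"
    and c: "e' = \<phi> u A \<or> \<phi> u A \<subseteq> \<sigma> \<and> e' = h ` \<phi> u A \<or> e' \<subseteq> \<sigma> \<and> \<phi> u A = h ` e'"
    using q_subset[OF label_cells[OF u] label_cells[OF t] eq[THEN equalityD1]] by blast
  obtain C where C: "C \<in> faces d" "C \<subseteq> B" "e' = \<phi> t C" using label_below[OF t e'(1,2)] by blast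
  have "card C - 1 = card B - 1"
    using cell_dim_unique[OF cs' q_label_cell[OF t(1) C(1)]] q_label_cell[OF t] e'(3) eq C(3) by simp
  then have "card C = card B" using facesD[OF C(1)] facesD[OF t(2)] by linarith
  then have "C = B" using C(2) facesD[OF t(2)] by (simp add: card_subset_eq)
  then have e'B: "e' = \<phi> t B" using C by simp
  from c consider "\<phi> t B = \<phi> u A" | "\<phi> u A \<subseteq> \<sigma>" "\<phi> t B = h ` \<phi> u A" | "\<phi> t B \<subseteq> \<sigma>" "\<phi> u A = h ` \<phi> t B"
    unfolding e'B by blast
  then show "((u, A), (t, B)) \<in> (face_step M')\<^sup>*"
  proof cases
    case 1
    then show ?thesis using ker[of u t A B] u t by simp
  next
    case 2
    obtain C where C: "C \<in> faces d" "C \<subseteq> {..d} - {a}" "\<phi> u A = \<phi> w C" "h ` \<phi> u A = \<phi> v (\<pi> ` C)" "\<pi> ` C \<in> faces d"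
      using \<sigma>E[OF label_cells[OF u] 2(1)] by blast
    have "((u, A), (w, C)) \<in> (face_step M')\<^sup>*" using ker[of u w A C] u wa C by simp
    also have "((w, C), (v, \<pi> ` C)) \<in> (face_step M')\<^sup>*" using face_step_new[OF C(2)] by blast
    also have "((v, \<pi> ` C), (t, B)) \<in> (face_step M')\<^sup>*" using ker[of v t "\<pi> ` C" B] t vb C 2 by simp
    finally show ?thesis .
  next
    case 3
    obtain C where C: "C \<in> faces d" "C \<subseteq> {..d} - {a}" "\<phi> t B = \<phi> w C" "h ` \<phi> t B = \<phi> v (\<pi> ` C)" "\<pi> ` C \<in> faces d"
      using \<sigma>E[OF label_cells[OF t] 3(1)] by blast
    have "((u, A), (v, \<pi> ` C)) \<in> (face_step M')\<^sup>*" using ker[of u v A "\<pi> ` C"] u vb C 3 by simp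
    also have "((v, \<pi> ` C), (w, C)) \<in> (face_step M')\<^sup>*" using face_step_new'[OF C(2)] by blast
    also have "((w, C), (t, B)) \<in> (face_step M')\<^sup>*" using ker[of w t C B] t wa C by simp
    finally show ?thesis .
  qed
qed

lemma labelled_quotient: "labelled d K' W M' (\<lambda>u A. q ` \<phi> u A)"
proof
  show "\<exists>u\<in>W. \<exists>A\<in>faces d. e = q ` \<phi> u A" if e: "e \<in> cw_cells K' n" for e n
  proof -
    obtain e0 where e0: "e0 \<in> cw_cells K n" "e = q ` e0" using e unfolding q_cells by blast
    show ?thesis using label_surj[OF e0(1)] e0(2) by blast
  qed
qed (simp_all add: q_label_cell q_label_order q_label_below q_label_kernel del: One_nat_def)

end

section \<open>From a common ridge to a pair of partners\<close>

text \<open>Faces of the ridge avoid the vertex opposite every facet that is crossed, and the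
  transposition in each step moves only the two vertices outside the ridge. So \<open>\<rho>\<close>
  acts on these faces exactly as the gluings do.\<close>

lemma walk_faces:
  assumes gs: "gluing_set d W M" and w: "w \<in> W" "a \<le> d" "c \<le> d"
    and walk: "(\<mu>, \<rho>) \<in> walk M (w, a) c" and A: "A \<subseteq> {..d} - {a, c}"
  shows "((w, A), (fst \<mu>, \<rho> ` A)) \<in> (face_step M)\<^sup>*"
  using walk
proof (induction rule: walk_induct)
  case base
  have "Transposition.transpose a c ` A = A" using A by (auto simp: Transposition.transpose_def image_iff)
  then show ?case by simp
next
  case (extend \<mu> \<rho> v b \<pi>)
  have \<rho>: "\<rho> permutes {..d}" "\<rho> a = snd \<mu>"
    using walk_invariant[OF gs extend.hyps(1)] w by auto
  have \<pi>: "\<pi> permutes {..d}" "\<pi> (snd \<mu>) = b" using gluing_setD[OF gs extend.hyps(2)] by auto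
  have "snd \<mu> \<notin> \<rho> ` A"
    using \<rho> A by (metis Diff_iff image_iff injD insertI1 permutes_inj subsetD)
  then have "((fst \<mu>, \<rho> ` A), (v, \<pi> ` \<rho> ` A)) \<in> face_step M"
    using extend.hyps(2) by (intro face_stepI) auto
  moreover have "Transposition.transpose b (\<pi> (\<rho> c)) (\<pi> (\<rho> x)) = \<pi> (\<rho> x)" if "x \<in> A" for x
  proof (rule transpose_apply_other)
    have "x \<noteq> a" "x \<noteq> c" using that A by auto
    then show "\<pi> (\<rho> x) \<noteq> b" "\<pi> (\<rho> x) \<noteq> \<pi> (\<rho> c)"
      using \<rho> \<pi> by (metis injD permutes_inj)+
  qed
  then have "(Transposition.transpose b (\<pi> (\<rho> c)) \<circ> \<pi> \<circ> \<rho>) ` A = \<pi> ` \<rho> ` A"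
    unfolding image_comp by (intro image_cong) auto
  ultimately show ?case using extend.IH by (simp add: comp_def)
qed

lemma walk_cases:
  assumes "(\<mu>, \<rho>) \<in> walk M (w, a) c"
  obtains "\<mu> = (w, c)" "\<rho> = Transposition.transpose a c"
  | \<mu>0 \<rho>0 v b \<pi> where "(\<mu>0, \<rho>0) \<in> walk M (w, a) c" "(\<mu>0, (v, b), \<pi>) \<in> M"
    "\<mu> = (v, \<pi> (\<rho>0 c))" "\<rho> = Transposition.transpose b (\<pi> (\<rho>0 c)) \<circ> \<pi> \<circ> \<rho>0"
proof -
  have "(\<mu> = (w, c) \<and> \<rho> = Transposition.transpose a c) \<or> (\<exists>\<mu>0 \<rho>0 v b \<pi>. (\<mu>0, \<rho>0) \<in> walk M (w, a) c \<and> (\<mu>0, (v, b), \<pi>) \<in> M \<and>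
    \<mu> = (v, \<pi> (\<rho>0 c)) \<and> \<rho> = Transposition.transpose b (\<pi> (\<rho>0 c)) \<circ> \<pi> \<circ> \<rho>0)"
    using assms
  proof (induction rule: walk_induct)
    case (extend \<mu> \<rho> v b \<pi>)
    show ?case by (rule disjI2, intro exI conjI) (rule extend.hyps refl)+
  qed simp
  then show ?thesis
    by (elim disjE exE conjE) (rule that(1) that(2), assumption+)+
qed

text \<open>The ridge can be left only through two facets: the one the walk uses next and the one it came from.\<close>

lemma walk_visits:
  assumes gs: "gluing_set d W M" and w: "w \<in> W" "a \<le> d" "c \<le> d" and un: "(w, a) \<notin> glued M"
    and S: "((w, {..d} - {a, c}), (u, S)) \<in> (face_step M)\<^sup>*"
  shows "\<exists>x \<rho>. ((u, x), \<rho>) \<in> walk M (w, a) c \<and> S = {..d} - {x, \<rho> c}"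
proof -
  have "\<exists>x \<rho>. ((fst t, x), \<rho>) \<in> walk M (w, a) c \<and> snd t = {..d} - {x, \<rho> c}"
    if "((w, {..d} - {a, c}), t) \<in> (face_step M)\<^sup>*" for t
    using that
  proof (induction rule: rtrancl_induct)
    case base
    show ?case using walk_base[of w c a M] by (intro exI[of _ c] exI[of _ "Transposition.transpose a c"]) auto
  next
    case (step s t)
    obtain x \<rho> where wk: "((fst s, x), \<rho>) \<in> walk M (w, a) c" and S: "snd s = {..d} - {x, \<rho> c}"
      using step.IH by blast
    obtain u z u' z' \<pi> A where m: "((u, z), (u', z'), \<pi>) \<in> M" "z \<notin> A" "s = (u, A)" "t = (u', \<pi> ` A)"
      using step.hyps(2) by (rule face_stepE)
    note D = gluing_setD[OF gs m(1)]
    have A: "A = {..d} - {x, \<rho> c}" using S m(3) by simp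
    have "\<pi> ` A = \<pi> ` {..d} - \<pi> ` {x, \<rho> c}" unfolding A using D(7) by (intro image_set_diff permutes_inj)
    then have \<pi>A: "\<pi> ` A = {..d} - {\<pi> x, \<pi> (\<rho> c)}" using D(7) by (simp add: permutes_image)
    have "z = x \<or> z = \<rho> c" using m(2) D(4) A by auto
    then show ?case
    proof
      assume z: "z = x"
      then have m': "((fst s, x), (u', z'), \<pi>) \<in> M" using m(1,3) by simp
      have "\<pi> x = z'" using D(8) z by simp
      then show ?thesis using walk_extend[OF wk m'] \<pi>A m(4)
        by (intro exI[of _ "\<pi> (\<rho> c)"] exI[of _ "Transposition.transpose z' (\<pi> (\<rho> c)) \<circ> \<pi> \<circ> \<rho>"])
          (auto simp: comp_def)
    next
      \<comment> \<open>This step goes back through the facet of entry. At the beginning of the walk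
        that facet is \<open>(w, a)\<close>, which is free; later, \<open>\<pi>\<close> undoes the
        last crossing and the previous state is the witness.\<close>
      assume z: "z = \<rho> c"
      from wk show ?thesis
      proof (cases rule: walk_cases)
        case 1
        then have "(u, z) = (w, a)" using z m(3) by simp
        then have "(w, a) \<in> glued M" using D by simp
        then show ?thesis using un by simp
      next
        case (2 \<mu>0 \<rho>0 v0 b0 \<pi>0)
        have "\<rho> c = b0" using 2(4) by simp
        then have "((u, z), \<mu>0, inv \<pi>0) \<in> M" using gluing_setD(1)[OF gs 2(2)] 2(3) z m(3) by simp
        then have eq: "(u', z') = \<mu>0" "\<pi> = inv \<pi>0" using glued_unique[OF gs m(1)] by auto
        have p: "\<pi>0 permutes {..d}" "\<pi>0 z' = b0" using gluing_setD(7,8)[OF gs 2(2)] eq by auto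
        have "\<pi> x = \<rho>0 c" "\<pi> (\<rho> c) = z'"
          using 2(3) \<open>\<rho> c = b0\<close> eq p by (auto simp: permutes_inverses permutes_inv_eq)
        then show ?thesis using 2(1) eq(1) \<pi>A m(4) by (intro exI[of _ z'] exI[of _ \<rho>0]) auto
      qed
    qed
  qed
  from this[OF S] show ?thesis by simp
qed

text \<open>Equal labels of the ridge give a chain of face steps, hence a state of the walk in the
  simplex \<open>v\<close>. The walk cannot have entered through \<open>(v, b)\<close>, which is
  neither glued nor the starting facet, so it is about to leave through it. Its transport agrees
  with \<open>\<pi>\<close> on each vertex of the ridge, since both lead to the same cell and labels
  within \<open>v\<close> are injective.\<close>

lemma items_of_common_ridge:
  assumes "labelled d K W M \<phi>" and gs: "gluing_set d W M" and d: "d \<ge> 2"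
    and w: "w \<in> W" "a \<le> d" "(w, a) \<notin> glued M" and v: "v \<in> W" "b \<le> d" "(v, b) \<notin> glued M"
    and ne: "(w, a) \<noteq> (v, b)" and c: "c \<le> d" "c \<noteq> a"
    and \<pi>: "\<pi> permutes {..d}" "\<pi> a = b"
    and fixed: "\<And>A. A \<in> faces d \<Longrightarrow> A \<subseteq> {..d} - {a, c} \<Longrightarrow> \<phi> w A = \<phi> v (\<pi> ` A)"
  shows "((w, a), c, (v, b), \<pi>) \<in> items d W M"
proof -
  interpret labelled d K W M \<phi> by fact
  let ?R = "{..d} - {a, c}"
  have "card ?R = d - 1" using w c by (simp add: card_Diff_subset)
  then have "card ?R > 0" using d by simp
  then have R: "?R \<in> faces d" unfolding faces_def card_gt_0_iff by blast
  have "\<phi> w ?R = \<phi> v (\<pi> ` ?R)" using fixed R by blast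
  then have "((w, ?R), (v, \<pi> ` ?R)) \<in> (face_step M)\<^sup>*"
    using label_kernel[OF w(1) v(1) R faces_image[OF R \<pi>(1)]] by simp
  from walk_visits[OF gs w(1,2) c(1) w(3) this]
  obtain x \<rho> where wk: "((v, x), \<rho>) \<in> walk M (w, a) c" and S: "\<pi> ` ?R = {..d} - {x, \<rho> c}"
    by (elim exE conjE) (rule that)
  note I = walk_invariant[OF gs wk w(2) c(1) w(1)]
  have \<rho>: "\<rho> permutes {..d}" "\<rho> a = x" "x \<le> d" using I by auto
  have \<rho>c: "\<rho> c \<le> d" using \<rho>(1) c permutes_in_image by fastforce
  have "\<pi> ` ?R = \<pi> ` {..d} - \<pi> ` {a, c}" using \<pi> by (intro image_set_diff permutes_inj)
  then have "{..d} - {x, \<rho> c} = {..d} - {b, \<pi> c}" using S \<pi> by (simp add: permutes_image)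
  moreover have "\<pi> c \<le> d" using \<pi>(1) c permutes_in_image by fastforce
  moreover have "{p, r} = {..d} - ({..d} - {p, r})" if "p \<le> d" "r \<le> d" for p r using that by auto
  ultimately have xy: "{x, \<rho> c} = {b, \<pi> c}" using \<rho>(3) \<rho>c v(2) by metis
  have "\<rho> c \<noteq> b"
  proof
    assume b: "\<rho> c = b"
    from wk show False
    proof (cases rule: walk_cases)
      case 1
      then show ?thesis using b ne by simp
    next
      case (2 \<mu>0 \<rho>0 v0 b0 \<pi>0)
      then have "(v, b) \<in> glued M" using gluing_setD(10)[OF gs 2(2)] b by simp
      then show ?thesis using v by simp
    qed
  qed
  then have x: "x = b" "\<rho> c = \<pi> c" using xy by (auto simp: doubleton_eq_iff)
  have "\<rho> i = \<pi> i" for i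
  proof (cases "i \<in> ?R")
    case True
    then have i: "{i} \<in> faces d" "{i} \<subseteq> ?R" unfolding faces_def by auto
    have "((w, {i}), (v, \<rho> ` {i})) \<in> (face_step M)\<^sup>*"
      using walk_faces[OF gs w(1,2) c(1) wk i(2)] by simp
    then have "\<phi> w {i} = \<phi> v (\<rho> ` {i})" using label_kernel[OF w(1) v(1) i(1) faces_image[OF i(1) \<rho>(1)]] by simp
    then have "\<phi> v (\<rho> ` {i}) = \<phi> v (\<pi> ` {i})" using fixed[OF i] by simp
    then have "\<rho> ` {i} = \<pi> ` {i}"
      using label_inj[OF v(1) faces_image[OF i(1) \<rho>(1)] faces_image[OF i(1) \<pi>(1)]] by simp
    then show ?thesis by simp
  next
    case False
    then consider "i = a" | "i = c" | "i \<notin> {..d}" by blast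
    then show ?thesis using x \<rho> \<pi> by cases (auto simp: permutes_not_in)
  qed
  then have "\<rho> = \<pi>" by blast
  then show ?thesis using wk x w v c ne unfolding items_def by auto
qed

section \<open>Simplicial complexes as labelled cell complexes\<close>

definition simplex_cell :: "'v set set \<Rightarrow> 'v set \<Rightarrow> ('v \<Rightarrow> real) set" where
  "simplex_cell C s = {x \<in> realization C. {v. x v \<noteq> 0} \<subseteq> s}"

lemma cw_cells_cw_of_complex:
  "cw_cells (cw_of_complex C) n = simplex_cell C ` {s \<in> C. card s = n + 1}"
  unfolding cw_of_complex_def simplex_cell_def by simp

context
  fixes C :: "'v set set"
  assumes C: "abstract_complex C"
begin

lemma complexD: "s \<in> C \<Longrightarrow> finite s \<and> s \<noteq> {} \<and> card s > 0"
  using C unfolding abstract_complex_def by (simp add: card_gt_0_iff)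

text \<open>A point with full support serves as the generic point of its simplex.\<close>

lemma barycenter:
  assumes "s \<in> C"
  obtains x where "x \<in> realization C" "{v. x v \<noteq> 0} = s"
proof -
  let ?x = "\<lambda>v. if v \<in> s then 1 / real (card s) else 0"
  have supp: "{v. ?x v \<noteq> 0} = s" using complexD[OF assms] by auto
  have "(\<Sum>v\<in>s. ?x v) = 1" using complexD[OF assms] by simp
  then have "?x \<in> realization C" unfolding realization_def using supp assms by simp
  then show ?thesis using supp that by blast
qed

lemma simplex_cell_subset_iff:
  assumes "s \<in> C"
  shows "simplex_cell C s \<subseteq> simplex_cell C t \<longleftrightarrow> s \<subseteq> t"
proof
  assume a: "simplex_cell C s \<subseteq> simplex_cell C t"
  obtain x where "x \<in> realization C" "{v. x v \<noteq> 0} = s" using barycenter[OF assms] .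
  then show "s \<subseteq> t" using a unfolding simplex_cell_def by blast
qed (auto simp: simplex_cell_def)

lemma simplex_cell_eq_iff:
  "s \<in> C \<Longrightarrow> t \<in> C \<Longrightarrow> simplex_cell C s = simplex_cell C t \<longleftrightarrow> s = t"
  using simplex_cell_subset_iff[of s t] simplex_cell_subset_iff[of t s] by auto

lemma cells_cw_of_complex: "cells (cw_of_complex C) = simplex_cell C ` C"
proof -
  have "\<exists>n. card s = n + 1" if "s \<in> C" for s using complexD[OF that] by (intro exI[of _ "card s - 1"]) simp
  then show ?thesis unfolding cells_def cw_cells_cw_of_complex by blast
qed

lemma cell_structure_cw_of_complex: "cell_structure (cw_of_complex C)"
  unfolding cell_structure_def cells_cw_of_complex
proof (intro conjI ballI allI impI)
  have top: "topspace (cw_space (cw_of_complex C)) = realization C" by (simp add: cw_of_complex_def)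
  show "e \<subseteq> topspace (cw_space (cw_of_complex C))" if "e \<in> simplex_cell C ` C" for e
    using that unfolding top simplex_cell_def by blast
  have carrier: "simplex_cell C {v. x v \<noteq> 0} \<subseteq> f" if "x \<in> f" "f \<in> simplex_cell C ` C" for x f
    using that unfolding simplex_cell_def by blast
  show "\<exists>e\<in>simplex_cell C ` C. x \<in> e \<and> (\<forall>f\<in>simplex_cell C ` C. x \<in> f \<longrightarrow> e \<subseteq> f)"
    if "x \<in> topspace (cw_space (cw_of_complex C))" for x
  proof (rule bexI[of _ "simplex_cell C {v. x v \<noteq> 0}"])
    show "x \<in> simplex_cell C {v. x v \<noteq> 0} \<and>
        (\<forall>f\<in>simplex_cell C ` C. x \<in> f \<longrightarrow> simplex_cell C {v. x v \<noteq> 0} \<subseteq> f)"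
      using that carrier unfolding top by (simp add: simplex_cell_def)
    show "simplex_cell C {v. x v \<noteq> 0} \<in> simplex_cell C ` C"
      using that unfolding top realization_def by blast
  qed
  show "\<exists>x\<in>e. \<forall>f\<in>simplex_cell C ` C. x \<in> f \<longrightarrow> e \<subseteq> f" if e: "e \<in> simplex_cell C ` C" for e
  proof -
    obtain s where s: "s \<in> C" "e = simplex_cell C s" using e by blast
    obtain x where x: "x \<in> realization C" "{v. x v \<noteq> 0} = s" using barycenter[OF s(1)] .
    then have "x \<in> e" unfolding s simplex_cell_def by blast
    then show ?thesis using carrier[of x] x s by (intro bexI[of _ x]) auto
  qed
  show "m = n" if ne: "cw_cells (cw_of_complex C) m \<inter> cw_cells (cw_of_complex C) n \<noteq> {}" for m n
  proof -
    obtain s t where "s \<in> C" "card s = m + 1" "t \<in> C" "card t = n + 1" "simplex_cell C s = simplex_cell C t"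
      using ne unfolding cw_cells_cw_of_complex by blast
    then show ?thesis using simplex_cell_eq_iff by auto
  qed
qed

end

lemma abstract_complex_faces: "abstract_complex (faces d)"
proof -
  have "faces d \<subseteq> Pow {..d}" unfolding faces_def by auto
  then have "finite (faces d)" using finite_subset by blast
  then show ?thesis unfolding abstract_complex_def using facesD faces_subset by blast
qed

lemma simplex_cw_eq: "simplex_cw d = cw_of_complex (faces d)"
  unfolding simplex_cw_def faces_def ..

lemma labelled_simplex: "labelled d (simplex_cw d) {w} {} (\<lambda>_. simplex_cell (faces d))"
  unfolding simplex_cw_eq
proof
  note C = abstract_complex_faces[of d]
  fix u v :: "nat list" and A B :: "nat set" and n e
  show "simplex_cell (faces d) A \<in> cw_cells (cw_of_complex (faces d)) (card A - 1)" if "A \<in> faces d"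
    using that facesD[OF that] by (auto simp: cw_cells_cw_of_complex)
  show "\<exists>w\<in>{w}. \<exists>A\<in>faces d. e = simplex_cell (faces d) A" if "e \<in> cw_cells (cw_of_complex (faces d)) n"
    using that by (auto simp: cw_cells_cw_of_complex)
  show "simplex_cell (faces d) A \<subseteq> simplex_cell (faces d) B \<longleftrightarrow> A \<subseteq> B" if "A \<in> faces d"
    by (rule simplex_cell_subset_iff[OF C that])
  show "\<exists>A\<in>faces d. A \<subseteq> B \<and> e = simplex_cell (faces d) A"
    if e: "e \<in> cells (cw_of_complex (faces d))" "e \<subseteq> simplex_cell (faces d) B"
  proof -
    obtain A where "A \<in> faces d" "e = simplex_cell (faces d) A" using e(1) cells_cw_of_complex[OF C] by auto
    then show ?thesis using e simplex_cell_subset_iff[OF C] by auto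
  qed
  show "simplex_cell (faces d) A = simplex_cell (faces d) B \<longleftrightarrow> ((u, A), v, B) \<in> (face_step {})\<^sup>*"
    if "u \<in> {w}" "v \<in> {w}" "A \<in> faces d" "B \<in> faces d"
  proof -
    have "face_step {} = {}" by (simp add: face_step_def)
    then show ?thesis using simplex_cell_eq_iff[OF C that(3,4)] that by simp
  qed
qed

text \<open>The vertices of a simplex that is not yet attached may be renamed freely; this is what
  makes the gluing maps of the tree identities.\<close>

lemma labelled_permute:
  assumes "labelled d K {w} {} \<psi>" and \<pi>: "\<pi> permutes {..d}"
  shows "labelled d K {w} {} (\<lambda>u A. \<psi> u (\<pi> ` A))"
proof -
  interpret labelled d K "{w}" "{}" \<psi> by fact
  have f: "A \<in> faces d \<Longrightarrow> \<pi> ` A \<in> faces d" "A \<in> faces d \<Longrightarrow> inv \<pi> ` A \<in> faces d" for A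
    using faces_image \<pi> permutes_inv by blast+
  have ii: "\<pi> ` inv \<pi> ` A = A" "inv \<pi> ` \<pi> ` A = A" for A
    using \<pi> by (simp_all add: image_image permutes_inverses)
  have sub: "\<pi> ` A \<subseteq> \<pi> ` B \<longleftrightarrow> A \<subseteq> B" for A B using permutes_inj[OF \<pi>] by (rule inj_image_subset_iff)
  have fe: "face_step {} = {}" by (simp add: face_step_def)
  show ?thesis
  proof
    fix u v A B e n
    show "\<psi> u (\<pi> ` A) \<in> cw_cells K (card A - 1)" if "u \<in> {w}" "A \<in> faces d"
      using label_cell[of u "\<pi> ` A"] that f card_permutes_image[OF \<pi>, of A] by simp
    show "\<exists>u\<in>{w}. \<exists>A\<in>faces d. e = \<psi> u (\<pi> ` A)" if "e \<in> cw_cells K n"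
      using label_surj[OF that] ii f by metis
    show "\<psi> u (\<pi> ` A) \<subseteq> \<psi> u (\<pi> ` B) \<longleftrightarrow> A \<subseteq> B" if "u \<in> {w}" "A \<in> faces d" "B \<in> faces d"
      using label_order[of u "\<pi> ` A" "\<pi> ` B"] that f sub by simp
    show "\<exists>A\<in>faces d. A \<subseteq> B \<and> e = \<psi> u (\<pi> ` A)"
      if h: "u \<in> {w}" "B \<in> faces d" "e \<in> cells K" "e \<subseteq> \<psi> u (\<pi> ` B)"
    proof -
      obtain A where "A \<in> faces d" "A \<subseteq> \<pi> ` B" "e = \<psi> u A" using label_below[OF h(1) f(1)[OF h(2)] h(3,4)] by blast
      then show ?thesis using sub[of "inv \<pi> ` A" B] ii f by (intro bexI[of _ "inv \<pi> ` A"]) auto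
    qed
    show "\<psi> u (\<pi> ` A) = \<psi> v (\<pi> ` B) \<longleftrightarrow> ((u, A), v, B) \<in> (face_step {})\<^sup>*"
      if "u \<in> {w}" "v \<in> {w}" "A \<in> faces d" "B \<in> faces d"
      using label_inj[of u "\<pi> ` A" "\<pi> ` B"] that f fe inj_image_eq_iff[OF permutes_inj[OF \<pi>]] by auto
  qed
qed

section \<open>Disjoint unions\<close>

lemma cw_cells_disjoint_union:
  "cw_cells (cw_disjoint_union K L) n = (\<times>) {False} ` cw_cells K n \<union> (\<times>) {True} ` cw_cells L n"
  by (simp add: cw_disjoint_union_def)

lemma cells_disjoint_union:
  "cells (cw_disjoint_union K L) = (\<times>) {False} ` cells K \<union> (\<times>) {True} ` cells L"
  unfolding cells_def cw_cells_disjoint_union by blast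

lemma topspace_disjoint_union:
  "topspace (cw_space (cw_disjoint_union K L)) =
     {False} \<times> topspace (cw_space K) \<union> {True} \<times> topspace (cw_space L)"
  by (auto simp: cw_disjoint_union_def split: if_splits)

lemma singleton_times_subset_iff: "{b} \<times> X \<subseteq> {b} \<times> Y \<longleftrightarrow> X \<subseteq> Y"
  by auto

lemma singleton_times_eq_iff: "{b} \<times> X = {b} \<times> Y \<longleftrightarrow> X = Y"
  by auto

lemma cell_nonempty: "cell_structure K \<Longrightarrow> e \<in> cells K \<Longrightarrow> e \<noteq> {}"
  using generic_point by blast

lemma cell_structure_disjoint_union:
  assumes K: "cell_structure K" and L: "cell_structure L"
  shows "cell_structure (cw_disjoint_union K L)"
  unfolding cell_structure_def cells_disjoint_union topspace_disjoint_union
proof (intro conjI ballI allI impI)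
  show "e \<subseteq> {False} \<times> topspace (cw_space K) \<union> {True} \<times> topspace (cw_space L)"
    if "e \<in> (\<times>) {False} ` cells K \<union> (\<times>) {True} ` cells L" for e
    using that by (auto dest: cell_subset_topspace[OF K, THEN subsetD] cell_subset_topspace[OF L, THEN subsetD])
  show "\<exists>e\<in>(\<times>) {False} ` cells K \<union> (\<times>) {True} ` cells L. z \<in> e \<and>
      (\<forall>f\<in>(\<times>) {False} ` cells K \<union> (\<times>) {True} ` cells L. z \<in> f \<longrightarrow> e \<subseteq> f)"
    if z: "z \<in> {False} \<times> topspace (cw_space K) \<union> {True} \<times> topspace (cw_space L)" for z
  proof -
    obtain b x where zb: "z = (b, x)" by force
    show ?thesis
    proof (cases b)
      case True
      then obtain e where "e \<in> cells L" "x \<in> e" "\<forall>f\<in>cells L. x \<in> f \<longrightarrow> e \<subseteq> f"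
        using carrier_cell[OF L, of x] z zb by auto
      then show ?thesis using zb True by (intro bexI[of _ "{True} \<times> e"]) auto
    next
      case False
      then obtain e where "e \<in> cells K" "x \<in> e" "\<forall>f\<in>cells K. x \<in> f \<longrightarrow> e \<subseteq> f"
        using carrier_cell[OF K, of x] z zb by auto
      then show ?thesis using zb False by (intro bexI[of _ "{False} \<times> e"]) auto
    qed
  qed
  show "\<exists>z\<in>e. \<forall>f\<in>(\<times>) {False} ` cells K \<union> (\<times>) {True} ` cells L. z \<in> f \<longrightarrow> e \<subseteq> f"
    if e: "e \<in> (\<times>) {False} ` cells K \<union> (\<times>) {True} ` cells L" for e
    using e
  proof
    assume "e \<in> (\<times>) {False} ` cells K"
    then obtain e0 where e0: "e0 \<in> cells K" "e = {False} \<times> e0" by blast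
    obtain x where "x \<in> e0" "\<forall>f\<in>cells K. x \<in> f \<longrightarrow> e0 \<subseteq> f" using generic_point[OF K e0(1)] by blast
    then show ?thesis using e0 by (intro bexI[of _ "(False, x)"]) auto
  next
    assume "e \<in> (\<times>) {True} ` cells L"
    then obtain e0 where e0: "e0 \<in> cells L" "e = {True} \<times> e0" by blast
    obtain x where "x \<in> e0" "\<forall>f\<in>cells L. x \<in> f \<longrightarrow> e0 \<subseteq> f" using generic_point[OF L e0(1)] by blast
    then show ?thesis using e0 by (intro bexI[of _ "(True, x)"]) auto
  qed
  show "m = n" if mn: "cw_cells (cw_disjoint_union K L) m \<inter> cw_cells (cw_disjoint_union K L) n \<noteq> {}" for m n
  proof -
    have split: "(\<exists>e\<in>cw_cells K k. z = {False} \<times> e) \<or> (\<exists>e\<in>cw_cells L k. z = {True} \<times> e)"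
      if "z \<in> cw_cells (cw_disjoint_union K L) k" for z k
      using that unfolding cw_cells_disjoint_union by auto
    obtain z where z: "z \<in> cw_cells (cw_disjoint_union K L) m" "z \<in> cw_cells (cw_disjoint_union K L) n"
      using mn by blast
    have ne: "{False} \<times> e \<noteq> {True} \<times> f" if "e \<in> cw_cells K k" for e f k
      using cell_nonempty[OF K cells_I[OF that]] by auto
    from split[OF z(1)] show ?thesis
    proof (elim disjE bexE)
      fix e assume e: "e \<in> cw_cells K m" "z = {False} \<times> e"
      from split[OF z(2)] have "e \<in> cw_cells K n"
        using ne[OF e(1)] unfolding e(2) by (auto simp: singleton_times_eq_iff)
      then show "m = n" using cell_dim_unique[OF K e(1)] by simp
    next
      fix e assume e: "e \<in> cw_cells L m" "z = {True} \<times> e"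
      from split[OF z(2)] have "e \<in> cw_cells L n"
      proof (elim disjE bexE)
        fix f assume "f \<in> cw_cells K n" "z = {False} \<times> f"
        then show ?thesis using ne[of f n e] e(2) by simp
      next
        fix f assume "f \<in> cw_cells L n" "z = {True} \<times> f"
        then show ?thesis using e(2) singleton_times_eq_iff[of True e f] by simp
      qed
      then show "m = n" using cell_dim_unique[OF L e(1)] by simp
    qed
  qed
qed

text \<open>All gluings in \<open>M\<close> involve only simplices of \<open>W\<close>, so no face
  step starts at the new simplex \<open>w\<close>. The tags keep old and new cells apart because
  cells are nonempty.\<close>

lemma labelled_disjoint_union:
  assumes "labelled d K W M \<phi>" and L: "labelled d L {w} {} \<psi>" and w: "w \<notin> W"
    and gs: "gluing_set d W M" and K: "cell_structure K" and csL: "cell_structure L"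
  shows "labelled d (cw_disjoint_union K L) (insert w W) M
    (\<lambda>u A. if u = w then {True} \<times> \<psi> u A else {False} \<times> \<phi> u A)"
proof -
  interpret labelled d K W M \<phi> by fact
  interpret L: labelled d L "{w}" "{}" \<psi> by fact
  have ne: "{False} \<times> \<phi> u A \<noteq> {True} \<times> X" if "u \<in> W" "A \<in> faces d" for u A X
    using cell_nonempty[OF K label_cells[OF that]] by blast
  have iso: "(w, A) = t" if "((w, A), t) \<in> (face_step M)\<^sup>*" for A t
  proof (rule rtrancl_only_refl[OF that])
    show "((w, A), t) \<notin> face_step M" for t
      using gluing_setD(3)[OF gs] w by (auto elim!: face_stepE)
  qed
  show ?thesis
  proof
    fix u v A B e n
    show "(if u = w then {True} \<times> \<psi> u A else {False} \<times> \<phi> u A) \<in> cw_cells (cw_disjoint_union K L) (card A - 1)"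
      if "u \<in> insert w W" "A \<in> faces d"
      using that label_cell[of u A] L.label_cell[of u A] unfolding cw_cells_disjoint_union by auto
    show "\<exists>u\<in>insert w W. \<exists>A\<in>faces d. e = (if u = w then {True} \<times> \<psi> u A else {False} \<times> \<phi> u A)"
      if e: "e \<in> cw_cells (cw_disjoint_union K L) n"
    proof -
      consider f where "f \<in> cw_cells K n" "e = {False} \<times> f" | f where "f \<in> cw_cells L n" "e = {True} \<times> f"
        using e unfolding cw_cells_disjoint_union by blast
      then show ?thesis
      proof cases
        case 1
        then obtain u A where "u \<in> W" "A \<in> faces d" "f = \<phi> u A" using label_surj by blast
        then show ?thesis using 1 w by (intro bexI[of _ u] bexI[of _ A]) auto
      next
        case 2
        then obtain A where "A \<in> faces d" "f = \<psi> w A" using L.label_surj by blast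
        then show ?thesis using 2 by (intro bexI[of _ w] bexI[of _ A]) auto
      qed
    qed
    show "(if u = w then {True} \<times> \<psi> u A else {False} \<times> \<phi> u A) \<subseteq>
        (if u = w then {True} \<times> \<psi> u B else {False} \<times> \<phi> u B) \<longleftrightarrow> A \<subseteq> B"
      if "u \<in> insert w W" "A \<in> faces d" "B \<in> faces d"
      using that label_order[of u A B] L.label_order[of u A B] by (auto simp: singleton_times_subset_iff)
    show "\<exists>A\<in>faces d. A \<subseteq> B \<and> e = (if u = w then {True} \<times> \<psi> u A else {False} \<times> \<phi> u A)"
      if h: "u \<in> insert w W" "B \<in> faces d" "e \<in> cells (cw_disjoint_union K L)"
        "e \<subseteq> (if u = w then {True} \<times> \<psi> u B else {False} \<times> \<phi> u B)"
    proof -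
      have e0: "e \<noteq> {}" by (rule cell_nonempty[OF cell_structure_disjoint_union[OF K csL] h(3)])
      consider f where "f \<in> cells K" "e = {False} \<times> f" | f where "f \<in> cells L" "e = {True} \<times> f"
        using h(3) unfolding cells_disjoint_union by blast
      then show ?thesis
      proof cases
        case 1
        then obtain x where "(False, x) \<in> e" using e0 by blast
        then have "u \<noteq> w" using h(4) by (auto split: if_splits)
        then show ?thesis using 1 h label_below[of u B f] by (auto simp: singleton_times_subset_iff)
      next
        case 2
        then obtain x where "(True, x) \<in> e" using e0 by blast
        then have "u = w" using h(4) by (auto split: if_splits)
        then show ?thesis using 2 h L.label_below[of u B f] by (auto simp: singleton_times_subset_iff)
      qed
    qed
    show "(if u = w then {True} \<times> \<psi> u A else {False} \<times> \<phi> u A) =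
        (if v = w then {True} \<times> \<psi> v B else {False} \<times> \<phi> v B) \<longleftrightarrow> ((u, A), v, B) \<in> (face_step M)\<^sup>*"
      if h: "u \<in> insert w W" "v \<in> insert w W" "A \<in> faces d" "B \<in> faces d"
    proof (cases "u = w"; cases "v = w")
      assume "u = w" "v = w"
      then show ?thesis using iso[of A "(w, B)"] L.label_inj[of w A B] h by (auto simp: singleton_times_eq_iff)
    next
      assume c: "u = w" "v \<noteq> w"
      then show ?thesis using iso[of A "(v, B)"] ne[of v B "\<psi> u A"] h by auto
    next
      assume c: "u \<noteq> w" "v = w"
      then show ?thesis using face_steps_closed[OF _ gs, of u A v B] ne[of u A "\<psi> v B"] h w by auto
    next
      assume "u \<noteq> w" "v \<noteq> w"
      then show ?thesis using label_kernel[of u v A B] h by (auto simp: singleton_times_eq_iff)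
    qed
  qed
qed

section \<open>The two kinds of steps of a local construction\<close>

lemma cell_identificationE:
  assumes "cell_identification K \<sigma> \<tau> K'" and sub: "\<sigma> \<subseteq> topspace (cw_space K)" "\<tau> \<subseteq> topspace (cw_space K)"
  obtains h q where "inj_on h \<sigma>" "h ` \<sigma> = \<tau>"
    "\<forall>n. image h ` {e \<in> cw_cells K n. e \<subseteq> \<sigma>} = {e \<in> cw_cells K n. e \<subseteq> \<tau>}"
    "\<forall>x\<in>\<sigma> \<inter> \<tau>. h x = x"
    "\<forall>x\<in>topspace (cw_space K). \<forall>y\<in>topspace (cw_space K).
      q x = q y \<longleftrightarrow> x = y \<or> (x \<in> \<sigma> \<and> y = h x) \<or> (y \<in> \<sigma> \<and> x = h y)"
    "\<forall>n. cw_cells K' n = image q ` cw_cells K n"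
proof -
  from assms(1)[unfolded cell_identification_def] obtain h q where
    hom: "homeomorphic_map (subtopology (cw_space K) \<sigma>) (subtopology (cw_space K) \<tau>) h"
    and r: "\<forall>n. image h ` {e \<in> cw_cells K n. e \<subseteq> \<sigma>} = {e \<in> cw_cells K n. e \<subseteq> \<tau>}"
    "\<forall>x\<in>\<sigma> \<inter> \<tau>. h x = x"
    "\<forall>x\<in>topspace (cw_space K). \<forall>y\<in>topspace (cw_space K).
      q x = q y \<longleftrightarrow> x = y \<or> (x \<in> \<sigma> \<and> y = h x) \<or> (y \<in> \<sigma> \<and> x = h y)"
    "\<forall>n. cw_cells K' n = image q ` cw_cells K n"
    by (elim exE conjE) (rule that)
  have "inj_on h \<sigma>" using homeomorphic_imp_injective_map[OF hom] sub by (simp add: Int_absorb1)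
  moreover have "h ` \<sigma> = \<tau>" using homeomorphic_imp_surjective_map[OF hom] sub by (simp add: Int_absorb1)
  ultimately show ?thesis using r by (rule that)
qed

lemma tree_gluing_insert:
  "w \<in> W \<Longrightarrow> tree_gluing (insert (a # w) W) = add_gluing ((w, a), (a # w, a), id) (tree_gluing W)"
  unfolding tree_gluing_def add_gluing_def rev_gluing_def by auto

lemma gluing_set_mono:
  assumes gs: "gluing_set d W M" and W: "W \<subseteq> W'"
  shows "gluing_set d W' M"
proof -
  have "(\<tau>, \<sigma>, inv \<pi>) \<in> M \<and> \<sigma> \<noteq> \<tau> \<and> fst \<sigma> \<in> W' \<and> snd \<sigma> \<le> d \<and> \<pi> permutes {..d} \<and> \<pi> (snd \<sigma>) = snd \<tau>"
    if "(\<sigma>, \<tau>, \<pi>) \<in> M" for \<sigma> \<tau> \<pi>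
    using gluing_setD[OF gs that] W by auto
  then show ?thesis using gs unfolding gluing_set_def by simp
qed

text \<open>The facet to which the new simplex is attached dictates its word \<open>a # w\<close>. A
  first labelling \<open>\<phi>1\<close> serves to read off the permutation of the gluing; the
  labelling \<open>\<phi>2\<close> renames the new vertices by it, after which the gluing is the
  identity.\<close>

lemma glue_step_labelled:
  assumes d: "d \<ge> 1" and st: "simplex_tree d W" and lab: "labelled d K W (tree_gluing W) \<phi>"
    and cs: "cell_structure K" and step: "glue_simplex_step d K K'" and K': "simplicial_cw K'"
  shows "\<exists>w\<in>W. \<exists>a \<phi>'. a # w \<notin> W \<and> simplex_tree d (insert (a # w) W) \<and>
    labelled d K' (insert (a # w) W) (tree_gluing (insert (a # w) W)) \<phi>'"
proof -
  let ?M = "tree_gluing W" and ?L = "simplex_cw d" and ?D = "cw_disjoint_union K (simplex_cw d)"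
  have gs: "gluing_set d W ?M" by (rule gluing_set_tree_gluing[OF st])
  have csL: "cell_structure ?L"
    unfolding simplex_cw_eq by (rule cell_structure_cw_of_complex[OF abstract_complex_faces])
  have csD: "cell_structure ?D" by (rule cell_structure_disjoint_union[OF cs csL])
  obtain \<sigma> \<rho> where \<sigma>: "\<sigma> \<in> boundary_cells d K (d - 1)" and \<rho>: "\<rho> \<in> cw_cells ?L (d - 1)"
    and id: "cell_identification ?D ({False} \<times> \<sigma>) ({True} \<times> \<rho>) K'"
    using step unfolding glue_simplex_step_def by blast
  obtain w a where w: "w \<in> W" "a \<le> d" "\<sigma> = \<phi> w ({..d} - {a})" "(w, a) \<notin> glued ?M"
    using boundary_label[OF lab gs cs d \<sigma>] .
  \<comment> \<open>A child \<open>a # w\<close>, or the parent if \<open>a = hd w\<close>, would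
    already occupy the facet \<open>(w, a)\<close>, which is free as a boundary facet.\<close>
  have new: "a # w \<notin> W"
  proof
    assume "a # w \<in> W"
    then have "((w, a), (a # w, a), id) \<in> ?M" unfolding tree_gluing_def by blast
    then show False using w(4) unfolding glued_def by force
  qed
  have hd: "w \<noteq> [] \<longrightarrow> a \<noteq> hd w"
  proof (intro impI notI)
    assume "w \<noteq> []" "a = hd w"
    then obtain w' where "w = a # w'" by (cases w) auto
    then have "((w, a), (w', a), id) \<in> ?M" using w(1) unfolding tree_gluing_def by blast
    then show False using w(4) unfolding glued_def by force
  qed
  let ?W = "insert (a # w) W"
  define \<psi> :: "nat list \<Rightarrow> nat set \<Rightarrow> (nat \<Rightarrow> real) set" where "\<psi> = (\<lambda>_. simplex_cell (faces d))"
  have L: "labelled d ?L {a # w} {} \<psi>" unfolding \<psi>_def by (rule labelled_simplex)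
  interpret L: labelled d ?L "{a # w}" "{}" \<psi> by (rule L)
  obtain B where B: "B \<in> faces d" "\<rho> = \<psi> (a # w) B" using L.label_surj[OF \<rho>] by blast
  have "card B = d" using L.label_dim[OF csL _ B(1), of "a # w" "d - 1"] \<rho> B(2) d by simp
  then obtain b where b: "b \<le> d" "B = {..d} - {b}"
    by (rule_tac card_Suc_complement[of B "{..d}"]) (use facesD[OF B(1)] in auto)
  define \<phi>1 where "\<phi>1 u A = (if u = a # w then {True} \<times> \<psi> u A else {False} \<times> \<phi> u A)" for u A
  have lab1: "labelled d ?D ?W ?M \<phi>1"
    unfolding \<phi>1_def by (rule labelled_disjoint_union[OF lab L new gs cs csL])
  have \<sigma>1: "{False} \<times> \<sigma> = \<phi>1 w ({..d} - {a})" using w new by (auto simp: \<phi>1_def)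
  have \<tau>1: "{True} \<times> \<rho> = \<phi>1 (a # w) ({..d} - {b})" using B b by (simp add: \<phi>1_def)
  have top: "{False} \<times> \<sigma> \<subseteq> topspace (cw_space ?D)" "{True} \<times> \<rho> \<subseteq> topspace (cw_space ?D)"
  proof -
    have "\<sigma> \<in> cells K" using \<sigma> unfolding boundary_cells_def by (blast intro: cells_I)
    then show "{False} \<times> \<sigma> \<subseteq> topspace (cw_space ?D)"
      using cell_subset_topspace[OF cs] unfolding topspace_disjoint_union by blast
    show "{True} \<times> \<rho> \<subseteq> topspace (cw_space ?D)"
      using cell_subset_topspace[OF csL cells_I[OF \<rho>]] unfolding topspace_disjoint_union by blast
  qed
  obtain h q where h: "inj_on h ({False} \<times> \<sigma>)" "h ` ({False} \<times> \<sigma>) = {True} \<times> \<rho>"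
    "\<forall>n. image h ` {e \<in> cw_cells ?D n. e \<subseteq> {False} \<times> \<sigma>} = {e \<in> cw_cells ?D n. e \<subseteq> {True} \<times> \<rho>}"
    and "\<forall>x\<in>({False} \<times> \<sigma>) \<inter> ({True} \<times> \<rho>). h x = x"
    and q: "\<forall>x\<in>topspace (cw_space ?D). \<forall>y\<in>topspace (cw_space ?D).
      q x = q y \<longleftrightarrow> x = y \<or> (x \<in> {False} \<times> \<sigma> \<and> y = h x) \<or> (y \<in> {False} \<times> \<sigma> \<and> x = h y)"
    "\<forall>n. cw_cells K' n = image q ` cw_cells ?D n"
    by (rule cell_identificationE[OF id top])
  obtain \<pi> where \<pi>: "\<pi> permutes {..d}" "\<pi> a = b"
    "\<And>A. A \<in> faces d \<Longrightarrow> a \<notin> A \<Longrightarrow> h ` \<phi>1 w A = \<phi>1 (a # w) (\<pi> ` A)"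
  proof (rule face_bijection_permutation[OF lab1 csD, of w a "a # w" b h])
    show "inj_on h (\<phi>1 w ({..d} - {a}))" using h(1) unfolding \<sigma>1 .
    show "image h ` {e \<in> cw_cells ?D n. e \<subseteq> \<phi>1 w ({..d} - {a})} =
        {e \<in> cw_cells ?D n. e \<subseteq> \<phi>1 (a # w) ({..d} - {b})}" for n
      using h(3) unfolding \<sigma>1 \<tau>1 by (rule spec)
  qed (use w b d in simp_all)
  define \<phi>2 where "\<phi>2 u A = (if u = a # w then {True} \<times> \<psi> u (\<pi> ` A) else {False} \<times> \<phi> u A)" for u A
  have lab2: "labelled d ?D ?W ?M \<phi>2"
    unfolding \<phi>2_def by (rule labelled_disjoint_union[OF lab labelled_permute[OF L \<pi>(1)] new gs cs csL])
  have \<sigma>2: "\<phi>2 w ({..d} - {a}) = {False} \<times> \<sigma>" using w new by (auto simp: \<phi>2_def)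
  have "\<pi> ` ({..d} - {a}) = \<pi> ` {..d} - \<pi> ` {a}" using \<pi>(1) by (intro image_set_diff permutes_inj)
  then have "\<pi> ` ({..d} - {a}) = {..d} - {b}" using \<pi> by (simp add: permutes_image)
  then have \<tau>2: "\<phi>2 (a # w) ({..d} - {a}) = {True} \<times> \<rho>" using B b by (simp add: \<phi>2_def)
  have cs': "cell_structure K'" using K' finite_regular_cw_cell_structure unfolding simplicial_cw_def by blast
  have "facet_identification d ?D ?W ?M \<phi>2 K' h q w (a # w) a a id"
  proof (intro facet_identification.intro facet_identification_axioms.intro lab2)
    show "gluing_set d ?W ?M" using gluing_set_mono[OF gs] by blast
    show "boolean_interval (lower_interval K' e)" if "e \<in> cw_cells K' n" for n e
      using K' that unfolding simplicial_cw_def by blast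
    show "h ` \<phi>2 w A = \<phi>2 (a # w) (id ` A)" if "A \<in> faces d" "a \<notin> A" for A
      using \<pi>(3)[OF that] w new unfolding \<phi>1_def \<phi>2_def by auto
    show "q x = q y \<longleftrightarrow> x = y \<or> (x \<in> \<phi>2 w ({..d} - {a}) \<and> y = h x) \<or> (y \<in> \<phi>2 w ({..d} - {a}) \<and> x = h y)"
      if "x \<in> topspace (cw_space ?D)" "y \<in> topspace (cw_space ?D)" for x y
      using q(1) that unfolding \<sigma>2 by blast
    show "image h ` {e \<in> cw_cells ?D n. e \<subseteq> \<phi>2 w ({..d} - {a})} =
        {e \<in> cw_cells ?D n. e \<subseteq> \<phi>2 (a # w) ({..d} - {a})}" for n
      using h(3) unfolding \<sigma>2 \<tau>2 by (rule spec)
    show "cw_cells K' n = image q ` cw_cells ?D n" for n using q(2) by (rule spec)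
  qed (use csD cs' w(1,2) d h(1,2) in \<open>simp_all add: \<sigma>2 \<tau>2 permutes_id\<close>)
  from facet_identification.labelled_quotient[OF this]
  have "labelled d K' ?W (tree_gluing ?W) (\<lambda>u A. q ` \<phi>2 u A)"
    unfolding tree_gluing_insert[OF w(1)] .
  then show ?thesis using w(1) new simplex_tree_insert[OF st w(1,2) hd] by blast
qed

text \<open>The identifying map fixes the intersection of the two facets pointwise, hence every face
  of the common ridge \<open>F\<close>. Thus the two facets are partners in the present set of
  gluings, with precisely the transport of the walk as their identification.\<close>

lemma identify_step_labelled:
  assumes d: "d \<ge> 2" and gs: "gluing_set d W M" and lab: "labelled d K W M \<phi>"
    and cs: "cell_structure K" and step: "identify_step d K K'" and K': "simplicial_cw K'"
  shows "\<exists>u\<in>items d W M. \<exists>\<phi>'. labelled d K' W (add_gluing (item_gluing u) M) \<phi>'"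
proof -
  interpret labelled d K W M \<phi> by (rule lab)
  have d1: "d \<ge> 1" using d by simp
  obtain \<sigma> \<tau> F where \<sigma>: "\<sigma> \<in> boundary_cells d K (d - 1)" and \<tau>: "\<tau> \<in> boundary_cells d K (d - 1)"
    and ne: "\<sigma> \<noteq> \<tau>" and F: "F \<in> cw_cells K (d - 2)" "F \<subseteq> \<sigma> \<inter> \<tau>" and id: "cell_identification K \<sigma> \<tau> K'"
    using step unfolding identify_step_def by blast
  obtain w a where w: "w \<in> W" "a \<le> d" "\<sigma> = \<phi> w ({..d} - {a})" "(w, a) \<notin> glued M"
    using boundary_label[OF lab gs cs d1 \<sigma>] .
  obtain v b where v: "v \<in> W" "b \<le> d" "\<tau> = \<phi> v ({..d} - {b})" "(v, b) \<notin> glued M"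
    using boundary_label[OF lab gs cs d1 \<tau>] .
  have nwv: "(w, a) \<noteq> (v, b)" using ne w v by auto
  have cells: "\<sigma> \<in> cells K" "\<tau> \<in> cells K" using \<sigma> \<tau> unfolding boundary_cells_def by (blast intro: cells_I)+
  obtain h q where h: "inj_on h \<sigma>" "h ` \<sigma> = \<tau>"
    "\<forall>n. image h ` {e \<in> cw_cells K n. e \<subseteq> \<sigma>} = {e \<in> cw_cells K n. e \<subseteq> \<tau>}"
    and fixed: "\<forall>x\<in>\<sigma> \<inter> \<tau>. h x = x"
    and q: "\<forall>x\<in>topspace (cw_space K). \<forall>y\<in>topspace (cw_space K).
      q x = q y \<longleftrightarrow> x = y \<or> (x \<in> \<sigma> \<and> y = h x) \<or> (y \<in> \<sigma> \<and> x = h y)"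
    "\<forall>n. cw_cells K' n = image q ` cw_cells K n"
    by (rule cell_identificationE[OF id cell_subset_topspace[OF cs cells(1)] cell_subset_topspace[OF cs cells(2)]])
  obtain \<pi> where \<pi>: "\<pi> permutes {..d}" "\<pi> a = b"
    "\<And>A. A \<in> faces d \<Longrightarrow> a \<notin> A \<Longrightarrow> h ` \<phi> w A = \<phi> v (\<pi> ` A)"
  proof (rule face_bijection_permutation[OF lab cs w(1,2) v(1,2), of h])
    show "inj_on h (\<phi> w ({..d} - {a}))" using h(1) unfolding w(3) .
    show "image h ` {e \<in> cw_cells K n. e \<subseteq> \<phi> w ({..d} - {a})} = {e \<in> cw_cells K n. e \<subseteq> \<phi> v ({..d} - {b})}" for n
      using h(3) unfolding w(3) v(3) by (rule spec)
  qed (use d1 in simp_all)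
  have "d - 1 > 0" using d by simp
  then have "card ({..d} - {a}) > 0" using w by simp
  then have proper: "{..d} - {a} \<in> faces d" unfolding faces_def card_gt_0_iff by blast
  obtain S where S: "S \<in> faces d" "S \<subseteq> {..d} - {a}" "F = \<phi> w S"
    using label_below[OF w(1) proper cells_I[OF F(1)]] F(2) w(3) by blast
  have "card S = d - 1" using label_dim[OF cs w(1) S(1), of "d - 2"] F(1) S(3) d by simp
  then obtain c where c: "c \<in> {..d} - {a}" "S = {..d} - {a} - {c}"
    using S(2) w(2) d by (rule_tac card_Suc_complement[of S "{..d} - {a}"]) auto
  have Sac: "S = {..d} - {a, c}" using c by auto
  have "((w, a), c, (v, b), \<pi>) \<in> items d W M"
  proof (rule items_of_common_ridge[OF lab gs d w(1,2,4) v(1,2,4) nwv _ _ \<pi>(1,2)])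
    fix A assume A: "A \<in> faces d" "A \<subseteq> {..d} - {a, c}"
    then have "\<phi> w A \<subseteq> F" using label_order[OF w(1) A(1) S(1)] S Sac by simp
    then have "\<phi> w A \<subseteq> \<sigma> \<inter> \<tau>" using F by blast
    then have "h ` \<phi> w A = id ` \<phi> w A" using fixed by (intro image_cong) auto
    then have "h ` \<phi> w A = \<phi> w A" by simp
    then show "\<phi> w A = \<phi> v (\<pi> ` A)" using \<pi>(3)[OF A(1)] A(2) by auto
  qed (use c in auto)
  moreover have cs': "cell_structure K'"
    using K' finite_regular_cw_cell_structure unfolding simplicial_cw_def by blast
  have "facet_identification d K W M \<phi> K' h q w v a b \<pi>"
  proof (intro facet_identification.intro facet_identification_axioms.intro lab)
    show "boolean_interval (lower_interval K' e)" if "e \<in> cw_cells K' n" for n e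
      using K' that unfolding simplicial_cw_def by blast
    show "h ` \<phi> w A = \<phi> v (\<pi> ` A)" if "A \<in> faces d" "a \<notin> A" for A
      using \<pi>(3)[OF that] .
    show "q x = q y \<longleftrightarrow> x = y \<or> (x \<in> \<phi> w ({..d} - {a}) \<and> y = h x) \<or> (y \<in> \<phi> w ({..d} - {a}) \<and> x = h y)"
      if "x \<in> topspace (cw_space K)" "y \<in> topspace (cw_space K)" for x y
      using q(1) that unfolding w(3) by blast
    show "image h ` {e \<in> cw_cells K n. e \<subseteq> \<phi> w ({..d} - {a})} = {e \<in> cw_cells K n. e \<subseteq> \<phi> v ({..d} - {b})}" for n
      using h(3) unfolding w(3) v(3) by (rule spec)
    show "cw_cells K' n = image q ` cw_cells K n" for n using q(2) by (rule spec)
  qed (use gs cs cs' w v d1 h(1,2) \<pi>(1,2) in simp_all)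
  from facet_identification.labelled_quotient[OF this]
  have "labelled d K' W (add_gluing (item_gluing ((w, a), c, (v, b), \<pi>)) M) (\<lambda>u A. q ` \<phi> u A)"
    by (simp add: item_gluing_def)
  ultimately show ?thesis by blast
qed


section \<open>Codes of locally constructible complexes\<close>

lemma cw_isomorphic_sym:
  assumes iso: "cw_isomorphic K L" and K: "\<And>e. e \<in> cells K \<Longrightarrow> e \<subseteq> topspace (cw_space K)"
  shows "cw_isomorphic L K"
proof -
  obtain f where f: "homeomorphic_map (cw_space K) (cw_space L) f" "\<forall>n. cw_cells L n = image f ` cw_cells K n"
    using iso unfolding cw_isomorphic_def by (elim exE conjE) (rule that)
  obtain g where g: "homeomorphic_maps (cw_space K) (cw_space L) f g"
    using f(1) unfolding homeomorphic_map_maps by (elim exE) (rule that)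
  have "g ` f ` e = e" if "e \<in> cw_cells K n" for e n
  proof -
    have "g (f x) = x" if "x \<in> e" for x
      using g that K[OF cells_I[OF \<open>e \<in> cw_cells K n\<close>]] unfolding homeomorphic_maps_def by blast
    then show ?thesis by (auto simp: image_image)
  qed
  then have "cw_cells K n = image g ` cw_cells L n" for n
    unfolding f(2)[rule_format] image_image[of "image g"] by simp
  moreover have "homeomorphic_map (cw_space L) (cw_space K) g"
    using g homeomorphic_maps_sym homeomorphic_maps_map by blast
  ultimately show ?thesis unfolding cw_isomorphic_def by (intro exI[of _ g] conjI allI)
qed

lemma labelled_isomorphic:
  assumes "labelled d K W M \<phi>" and K: "\<And>e. e \<in> cells K \<Longrightarrow> e \<subseteq> topspace (cw_space K)"
    and iso: "cw_isomorphic K L"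
  shows "\<exists>\<phi>'. labelled d L W M \<phi>'"
proof -
  interpret labelled d K W M \<phi> by fact
  obtain f where f: "homeomorphic_map (cw_space K) (cw_space L) f" "\<forall>n. cw_cells L n = image f ` cw_cells K n"
    using iso unfolding cw_isomorphic_def by (elim exE conjE) (rule that)
  have inj: "inj_on f (topspace (cw_space K))" by (rule homeomorphic_imp_injective_map[OF f(1)])
  have cL: "cw_cells L n = image f ` cw_cells K n" for n using f(2) by (rule spec)
  have sub: "f ` e \<subseteq> f ` e' \<longleftrightarrow> e \<subseteq> e'" if "e \<in> cells K" "e' \<in> cells K" for e e'
    by (rule inj_on_image_subset_iff[OF inj K[OF that(1)] K[OF that(2)]])
  have "labelled d L W M (\<lambda>w A. f ` \<phi> w A)"
  proof
    fix w v A B e n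
    show "f ` \<phi> w A \<in> cw_cells L (card A - 1)" if "w \<in> W" "A \<in> faces d"
      unfolding cL using label_cell[OF that] by (rule imageI)
    show "\<exists>w\<in>W. \<exists>A\<in>faces d. e = f ` \<phi> w A" if e: "e \<in> cw_cells L n"
    proof -
      obtain e0 where e0: "e0 \<in> cw_cells K n" "e = f ` e0" using e unfolding cL by blast
      then show ?thesis using label_surj[OF e0(1)] by blast
    qed
    show "f ` \<phi> w A \<subseteq> f ` \<phi> w B \<longleftrightarrow> A \<subseteq> B" if "w \<in> W" "A \<in> faces d" "B \<in> faces d"
      using sub label_cells label_order that by simp
    show "\<exists>A\<in>faces d. A \<subseteq> B \<and> e = f ` \<phi> w A"
      if h: "w \<in> W" "B \<in> faces d" "e \<in> cells L" "e \<subseteq> f ` \<phi> w B"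
    proof -
      obtain n where "e \<in> cw_cells L n" using h(3) unfolding cells_def by blast
      then obtain e0 where "e0 \<in> cw_cells K n" "e = f ` e0" unfolding cL by blast
      then have e0: "e0 \<in> cells K" "e = f ` e0" by (auto intro: cells_I)
      then have "e0 \<subseteq> \<phi> w B" using sub[OF e0(1) label_cells[OF h(1,2)]] h(4) by simp
      then show ?thesis using label_below[OF h(1,2) e0(1)] e0(2) by blast
    qed
    show "f ` \<phi> w A = f ` \<phi> v B \<longleftrightarrow> ((w, A), v, B) \<in> (face_step M)\<^sup>*"
      if h: "w \<in> W" "v \<in> W" "A \<in> faces d" "B \<in> faces d"
      using inj_on_image_eq_iff[OF inj K K] label_cells h label_kernel[OF h] by simp
  qed
  then show ?thesis by blast
qed

text \<open>One complex may have many codes. For an upper bound it is enough that a code determines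
  its complex up to isomorphism.\<close>

definition codes :: "nat \<Rightarrow> nat \<Rightarrow> (nat list set \<times> gluing set) set" where
  "codes d N = (SIGMA W:{W. simplex_tree d W \<and> card W = N}. {M. lc_gluing d W (tree_gluing W) M})"

lemma local_construction_code:
  assumes d: "d \<ge> 2" and C: "abstract_complex C" and lc: "local_construction d C N k T"
  shows "\<exists>c\<in>codes d N. \<exists>\<phi>. labelled d (cw_of_complex C) (fst c) (snd c) \<phi>"
proof -
  have N: "1 \<le> N" "N \<le> k" and ps: "\<And>i. i \<in> {1..k} \<Longrightarrow> pseudomanifold d (T i)"
    and T1: "cw_isomorphic (T 1) (simplex_cw d)"
    and glue: "\<And>i. i \<in> {1..<N} \<Longrightarrow> glue_simplex_step d (T i) (T (i + 1))"
    and ident: "\<And>i. i \<in> {N..<k} \<Longrightarrow> identify_step d (T i) (T (i + 1))"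
    and Tk: "cw_isomorphic (T k) (cw_of_complex C)"
    using lc unfolding local_construction_def by simp_all
  have sim: "simplicial_cw (T i)" and cs: "cell_structure (T i)" if "i \<in> {1..k}" for i
  proof -
    show s: "simplicial_cw (T i)" using ps[OF that] unfolding pseudomanifold_def by simp
    show "cell_structure (T i)"
      using s finite_regular_cw_cell_structure unfolding simplicial_cw_def by blast
  qed
  have "1 + j \<le> N \<Longrightarrow> \<exists>W \<phi>. simplex_tree d W \<and> card W = 1 + j \<and> labelled d (T (1 + j)) W (tree_gluing W) \<phi>" for j
  proof (induction j)
    case 0
    have iso: "cw_isomorphic (simplex_cw d) (T 1)"
      by (rule cw_isomorphic_sym[OF T1]) (use cell_subset_topspace[OF cs] N in auto)
    have "cell_structure (simplex_cw d)"
      unfolding simplex_cw_eq by (rule cell_structure_cw_of_complex[OF abstract_complex_faces])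
    from labelled_isomorphic[OF labelled_simplex[of d "[]"] cell_subset_topspace[OF this] iso]
    obtain \<phi> where "labelled d (T 1) {[]} {} \<phi>" by blast
    moreover have "tree_gluing {[]} = {}" unfolding tree_gluing_def by auto
    ultimately show ?case by (intro exI[of _ "{[]}"] exI[of _ \<phi>]) (auto simp: simplex_tree_def)
  next
    case (Suc j)
    then obtain W \<phi> where W: "simplex_tree d W" "card W = 1 + j" "labelled d (T (1 + j)) W (tree_gluing W) \<phi>"
      by auto
    have "glue_simplex_step d (T (1 + j)) (T (1 + j + 1))" using glue[of "1 + j"] Suc.prems by simp
    from glue_step_labelled[OF _ W(1,3) cs this sim] d N Suc.prems
    obtain w a \<phi>' where w: "a # w \<notin> W" "simplex_tree d (insert (a # w) W)"
      "labelled d (T (1 + j + 1)) (insert (a # w) W) (tree_gluing (insert (a # w) W)) \<phi>'" by auto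
    moreover have "card (insert (a # w) W) = 1 + Suc j"
      using w(1) W(1,2) unfolding simplex_tree_def by simp
    ultimately show ?case by (intro exI[of _ "insert (a # w) W"] exI[of _ \<phi>']) simp
  qed
  from this[of "N - 1"] N obtain W \<phi> where
    W: "simplex_tree d W" "card W = N" "labelled d (T N) W (tree_gluing W) \<phi>" by auto
  have "N + j \<le> k \<Longrightarrow> \<exists>M \<phi>. lc_gluing d W (tree_gluing W) M \<and> labelled d (T (N + j)) W M \<phi>" for j
  proof (induction j)
    case 0
    then show ?case using W lc_gluing.base by auto
  next
    case (Suc j)
    then obtain M \<phi> where M: "lc_gluing d W (tree_gluing W) M" "labelled d (T (N + j)) W M \<phi>" by auto
    have gs: "gluing_set d W M" by (rule lc_gluing_gluing_set[OF M(1) gluing_set_tree_gluing[OF W(1)]])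
    have "identify_step d (T (N + j)) (T (N + j + 1))" using ident[of "N + j"] Suc.prems by simp
    from identify_step_labelled[OF d gs M(2) cs this sim] N Suc.prems
    obtain u \<phi>' where "u \<in> items d W M" "labelled d (T (N + j + 1)) W (add_gluing (item_gluing u) M) \<phi>'" by auto
    then show ?case using lc_gluing.add[OF M(1)] by (intro exI[of _ "add_gluing (item_gluing u) M"] exI[of _ \<phi>']) simp
  qed
  from this[of "k - N"] N obtain M \<phi> where
    M: "lc_gluing d W (tree_gluing W) M" "labelled d (T k) W M \<phi>" by auto
  have "\<exists>\<phi>'. labelled d (cw_of_complex C) W M \<phi>'"
    by (rule labelled_isomorphic[OF M(2) cell_subset_topspace[OF cs] Tk]) (use N in auto)
  then show ?thesis using M(1) W(1,2) unfolding codes_def by (intro bexI[of _ "(W, M)"]) auto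
qed

text \<open>The cells labelled by singletons give the vertex names \<open>p w i\<close>. A face
  contains the vertices of its label and has as many of them as the label, so it is spanned by
  them.\<close>

lemma labelled_complex_vertices:
  assumes C: "abstract_complex C" and "labelled d (cw_of_complex C) W M \<phi>"
  obtains p where "C = {p w ` A |w A. w \<in> W \<and> A \<in> faces d}"
    "\<forall>w\<in>W. \<forall>v\<in>W. \<forall>i\<le>d. \<forall>j\<le>d. p w i = p v j \<longleftrightarrow> ((w, {i}), (v, {j})) \<in> (face_step M)\<^sup>*"
proof -
  interpret labelled d "cw_of_complex C" W M \<phi> by fact
  have "\<exists>s. w \<in> W \<longrightarrow> A \<in> faces d \<longrightarrow> s \<in> C \<and> \<phi> w A = simplex_cell C s \<and> card s = card A" for w A
  proof (cases "w \<in> W \<and> A \<in> faces d")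
    case True
    then have "\<phi> w A \<in> simplex_cell C ` {s \<in> C. card s = card A - 1 + 1}"
      using label_cell[of w A] unfolding cw_cells_cw_of_complex by blast
    moreover have "card A - 1 + 1 = card A" using True facesD[of A d] by simp
    ultimately show ?thesis by auto
  qed blast
  then obtain S where S0: "\<And>w A. w \<in> W \<longrightarrow> A \<in> faces d \<longrightarrow>
      S w A \<in> C \<and> \<phi> w A = simplex_cell C (S w A) \<and> card (S w A) = card A" by metis
  have S: "S w A \<in> C" "\<phi> w A = simplex_cell C (S w A)" "card (S w A) = card A"
    if "w \<in> W" "A \<in> faces d" for w A using S0[of w A] that by simp_all
  have order: "S w A \<subseteq> S w B \<longleftrightarrow> A \<subseteq> B" if "w \<in> W" "A \<in> faces d" "B \<in> faces d" for w A B
    using label_order[OF that] simplex_cell_subset_iff[OF C S(1)[OF that(1,2)]] S(2) that by simp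
  have kernel: "S w A = S v B \<longleftrightarrow> ((w, A), (v, B)) \<in> (face_step M)\<^sup>*"
    if "w \<in> W" "v \<in> W" "A \<in> faces d" "B \<in> faces d" for w v A B
    using label_kernel[OF that] simplex_cell_eq_iff[OF C S(1)[of w A] S(1)[of v B]] S(2) that by simp
  have sing: "{i} \<in> faces d" if "i \<le> d" for i using that unfolding faces_def by auto
  have "\<exists>x. w \<in> W \<longrightarrow> i \<le> d \<longrightarrow> S w {i} = {x}" for w i
  proof (cases "w \<in> W \<and> i \<le> d")
    case True
    then have "card (S w {i}) = 1" using S(3)[of w "{i}"] sing by simp
    then show ?thesis by (auto simp: card_1_singleton_iff)
  qed blast
  then obtain p where p0: "\<And>w i. w \<in> W \<longrightarrow> i \<le> d \<longrightarrow> S w {i} = {p w i}" by metis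
  have p: "S w {i} = {p w i}" if "w \<in> W" "i \<le> d" for w i using p0[of w i] that by simp
  have ker: "p w i = p v j \<longleftrightarrow> ((w, {i}), (v, {j})) \<in> (face_step M)\<^sup>*"
    if "w \<in> W" "v \<in> W" "i \<le> d" "j \<le> d" for w v i j
    using kernel[OF that(1,2) sing[OF that(3)] sing[OF that(4)]] p that by simp
  have inj: "inj_on (p w) {..d}" if w: "w \<in> W" for w
  proof (rule inj_onI)
    fix i j assume ij: "i \<in> {..d}" "j \<in> {..d}" "p w i = p w j"
    then have "S w {i} \<subseteq> S w {j}" using p w by simp
    then show "i = j" using order[OF w sing sing] ij by simp
  qed
  have pS: "p w ` A = S w A" if w: "w \<in> W" and A: "A \<in> faces d" for w A
  proof (rule card_subset_eq)
    show "finite (S w A)" using complexD[OF C S(1)[OF w A]] by simp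
    show "card (p w ` A) = card (S w A)"
      using card_image[OF inj_on_subset[OF inj[OF w]], of A] facesD[OF A] S(3)[OF w A] by simp
    show "p w ` A \<subseteq> S w A"
    proof
      fix x assume "x \<in> p w ` A"
      then obtain i where i: "i \<in> A" "x = p w i" by blast
      then have "i \<le> d" using facesD[OF A] by auto
      then show "x \<in> S w A" using order[OF w sing A, of i] p[OF w] i by simp
    qed
  qed
  have "C = {p w ` A |w A. w \<in> W \<and> A \<in> faces d}"
  proof (intro equalityI subsetI)
    fix s assume s: "s \<in> C"
    then have "simplex_cell C s \<in> cw_cells (cw_of_complex C) (card s - 1)"
      using complexD[OF C s] unfolding cw_cells_cw_of_complex by (intro imageI) simp
    then obtain w A where wA: "w \<in> W" "A \<in> faces d" "simplex_cell C s = \<phi> w A" using label_surj by blast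
    then have "s = S w A" using simplex_cell_eq_iff[OF C s S(1)[OF wA(1,2)]] S(2)[OF wA(1,2)] by simp
    then show "s \<in> {p w ` A |w A. w \<in> W \<and> A \<in> faces d}" using pS wA by blast
  next
    fix s assume "s \<in> {p w ` A |w A. w \<in> W \<and> A \<in> faces d}"
    then obtain w A where "w \<in> W" "A \<in> faces d" "s = p w ` A" by blast
    then show "s \<in> C" using pS S(1) by simp
  qed
  moreover have "\<forall>w\<in>W. \<forall>v\<in>W. \<forall>i\<le>d. \<forall>j\<le>d. p w i = p v j \<longleftrightarrow> ((w, {i}), (v, {j})) \<in> (face_step M)\<^sup>*"
    using ker by simp
  ultimately show ?thesis by (rule that)
qed

text \<open>The vertex names \<open>p\<close> and \<open>r\<close> identify the same pairs
  \<open>(w, i)\<close>, since both kernels are read off from \<open>M\<close>. So \<open>r\<close>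
  after a section \<open>pos\<close> of \<open>p\<close> does not depend on the section and is
  injective.\<close>

lemma labelled_complexes_isomorphic:
  assumes C: "abstract_complex C" "labelled d (cw_of_complex C) W M \<phi>"
    and D: "abstract_complex D" "labelled d (cw_of_complex D) W M \<psi>"
  shows "simplicially_isomorphic C D"
proof -
  obtain p where p1: "C = {p w ` A |w A. w \<in> W \<and> A \<in> faces d}"
    and p2: "\<forall>w\<in>W. \<forall>v\<in>W. \<forall>i\<le>d. \<forall>j\<le>d. p w i = p v j \<longleftrightarrow> ((w, {i}), (v, {j})) \<in> (face_step M)\<^sup>*"
    by (rule labelled_complex_vertices[OF C])
  obtain r where r1: "D = {r w ` A |w A. w \<in> W \<and> A \<in> faces d}"
    and r2: "\<forall>w\<in>W. \<forall>v\<in>W. \<forall>i\<le>d. \<forall>j\<le>d. r w i = r v j \<longleftrightarrow> ((w, {i}), (v, {j})) \<in> (face_step M)\<^sup>*"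
    by (rule labelled_complex_vertices[OF D])
  define pos where "pos x = (SOME z. fst z \<in> W \<and> snd z \<le> d \<and> p (fst z) (snd z) = x)" for x
  define f where "f x = r (fst (pos x)) (snd (pos x))" for x
  have f: "f (p w i) = r w i" if "w \<in> W" "i \<le> d" for w i
  proof -
    have "\<exists>z. fst z \<in> W \<and> snd z \<le> d \<and> p (fst z) (snd z) = p w i" using that by (intro exI[of _ "(w, i)"]) simp
    then have "fst (pos (p w i)) \<in> W \<and> snd (pos (p w i)) \<le> d \<and> p (fst (pos (p w i))) (snd (pos (p w i))) = p w i"
      unfolding pos_def by (rule someI_ex)
    then show ?thesis using p2 r2 that unfolding f_def by auto
  qed
  have vert: "\<exists>w\<in>W. \<exists>i\<le>d. x = p w i" if x: "x \<in> \<Union>C" for x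
  proof -
    obtain w A where "w \<in> W" "A \<in> faces d" "x \<in> p w ` A" using x unfolding p1 by blast
    then show ?thesis using facesD[of A d] by blast
  qed
  have "inj_on f (\<Union>C)"
  proof (rule inj_onI)
    fix x y assume x: "x \<in> \<Union>C" and y: "y \<in> \<Union>C" and eq: "f x = f y"
    obtain w i v j where "w \<in> W" "i \<le> d" "x = p w i" "v \<in> W" "j \<le> d" "y = p v j"
      using vert[OF x] vert[OF y] by blast
    then show "x = y" using eq f p2 r2 by auto
  qed
  moreover have img: "f ` p w ` A = r w ` A" if "w \<in> W" "A \<in> faces d" for w A
  proof -
    have "f (p w i) = r w i" if "i \<in> A" for i using f[OF \<open>w \<in> W\<close>] facesD[OF \<open>A \<in> faces d\<close>] that by auto
    then show ?thesis by (simp add: image_image)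
  qed
  have "D = image f ` C"
  proof (intro equalityI subsetI)
    fix s assume "s \<in> D"
    then obtain w A where wA: "w \<in> W" "A \<in> faces d" "s = r w ` A" unfolding r1 by blast
    then have "p w ` A \<in> C" unfolding p1 by blast
    then show "s \<in> image f ` C" using img[OF wA(1,2)] wA(3) by (intro image_eqI[of _ _ "p w ` A"]) simp_all
  next
    fix s assume "s \<in> image f ` C"
    then obtain t where t: "t \<in> C" "s = f ` t" by blast
    then obtain w A where "w \<in> W" "A \<in> faces d" "t = p w ` A" unfolding p1 by blast
    then show "s \<in> D" unfolding r1 using img t(2) by blast
  qed
  ultimately show ?thesis unfolding simplicially_isomorphic_def by blast
qed

text \<open>One code is chosen for each complex; complexes with the same chosen code are isomorphic,
  so every isomorphism class is the class attached to some code.\<close>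

lemma isomorphism_types_le_codes:
  assumes d: "d \<ge> 2" and fin: "finite (codes d N)"
    and S: "\<And>C. C \<in> S \<Longrightarrow> locally_constructible d C \<and> card (facets d C) = N"
  shows "finite (isomorphism_types S) \<and> card (isomorphism_types S) \<le> card (codes d N)"
proof -
  let ?R = "{(C, D). C \<in> S \<and> D \<in> S \<and> simplicially_isomorphic C D}"
  have "\<exists>c. C \<in> S \<longrightarrow> c \<in> codes d N \<and> abstract_complex C \<and> (\<exists>\<phi>. labelled d (cw_of_complex C) (fst c) (snd c) \<phi>)" for C
  proof (cases "C \<in> S")
    case True
    then obtain k T where C: "pure_complex d C" "local_construction d C N k T"
      using S[OF True] unfolding locally_constructible_def by blast
    have a: "abstract_complex C" using C(1) unfolding pure_complex_def by simp
    then show ?thesis using local_construction_code[OF d a C(2)] by blast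
  qed blast
  then obtain code where code: "\<And>C. C \<in> S \<longrightarrow> code C \<in> codes d N \<and> abstract_complex C \<and>
      (\<exists>\<phi>. labelled d (cw_of_complex C) (fst (code C)) (snd (code C)) \<phi>)" by metis
  have iso: "(C, D) \<in> ?R" if CD: "C \<in> S" "D \<in> S" "code C = code D" for C D
  proof -
    obtain \<phi> \<psi> where "labelled d (cw_of_complex C) (fst (code C)) (snd (code C)) \<phi>"
      "labelled d (cw_of_complex D) (fst (code C)) (snd (code C)) \<psi>" "abstract_complex C" "abstract_complex D"
      using code[of C] code[of D] CD by auto
    then show ?thesis using labelled_complexes_isomorphic CD by blast
  qed
  define cls where "cls c = ?R `` {SOME C. C \<in> S \<and> code C = c}" for c
  have "isomorphism_types S \<subseteq> cls ` codes d N"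
  proof
    fix X assume "X \<in> isomorphism_types S"
    then obtain C where C: "C \<in> S" "X = ?R `` {C}" unfolding isomorphism_types_def by (elim quotientE)
    let ?D = "SOME D. D \<in> S \<and> code D = code C"
    have "?D \<in> S \<and> code ?D = code C" by (rule someI[of _ C]) (simp add: C)
    then have "(C, ?D) \<in> ?R" using iso C(1) by simp
    then have "X = cls (code C)"
      unfolding C(2) cls_def by (rule equiv_class_eq[OF equiv_simplicially_isomorphic])
    then show "X \<in> cls ` codes d N" using code[of C] C(1) by blast
  qed
  then show ?thesis using fin by (meson card_image_le card_mono finite_imageI finite_subset le_trans)
qed

section \<open>The numerical bound\<close>

lemma card_Sigma_le:
  fixes a b :: real
  assumes "finite A" "\<And>x. x \<in> A \<Longrightarrow> finite (B x)" "real (card A) \<le> a" "\<And>x. x \<in> A \<Longrightarrow> real (card (B x)) \<le> b" "b \<ge> 0"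
  shows "real (card (SIGMA x:A. B x)) \<le> a * b"
proof -
  have "real (card (SIGMA x:A. B x)) = (\<Sum>x\<in>A. real (card (B x)))"
    using assms(1,2) by (subst card_SigmaI) auto
  also have "\<dots> \<le> real (card A) * b" using assms(4) by (intro sum_bounded_above) auto
  also have "\<dots> \<le> a * b" using assms by (intro mult_right_mono) auto
  finally show ?thesis .
qed

text \<open>The fifth powers are 243/32 and 8.\<close>

lemma three_halves_le: "(3 / 2 :: real) \<le> 2 powr (3 / 5)"
proof (rule power_le_imp_le_base)
  have "((2::real) powr (3 / 5)) ^ 5 = 2 powr (3 / 5 * real 5)" by (simp add: powr_power)
  also have "\<dots> = 2 powr (real 3)" by simp
  also have "\<dots> = 8" by (subst powr_realpow) auto
  finally show "(3 / 2 :: real) ^ Suc 4 \<le> (2 powr (3 / 5)) ^ Suc 4" by (simp add: power_divide)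
qed simp

lemma three_halves_power_le: "(3 / 2 :: real) ^ n \<le> 2 powr (3 / 5 * real n)"
proof -
  have "(3 / 2 :: real) ^ n \<le> (2 powr (3 / 5)) ^ n" by (intro power_mono three_halves_le) auto
  also have "\<dots> = 2 powr (3 / 5 * real n)" by (simp add: powr_power mult.commute)
  finally show ?thesis .
qed

text \<open>With about (d-1)N free facets the exponent per simplex is (d-1)(3d/5 + 1/5). It is
  smaller than (2d^2-d)/3 by d(d+1)/15 + 1/5; the 1/5 is kept to absorb constant factors
  later.\<close>

lemma gluing_bound:
  fixes d N n :: nat
  assumes d: "d \<ge> 2" and N: "N \<ge> 1" and n: "n + 2 * (N - 1) \<le> N * (d + 1)"
  defines "x \<equiv> (1 / 2) / (3 / 2 :: real) ^ (d - 1)"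
  shows "(3 / 2) ^ (d * n div 2) / x ^ ((n + 1) div 2)
    \<le> 2 powr (real N * ((2 * (real d)\<^sup>2 - real d) / 3) - real N / 5 + 3 * real d / 2 + 3 / 5)"
proof -
  define k where "k = (n + 1) div 2"
  define m where "m = d * n div 2"
  have "1 / x = 2 * (3 / 2) ^ (d - 1)" by (simp add: x_def)
  then have "(3 / 2) ^ m / x ^ k = (3 / 2) ^ m * (2 * (3 / 2) ^ (d - 1)) ^ k"
    by (metis divide_inverse inverse_eq_divide power_one_over)
  also have "\<dots> = (3 / 2) ^ (m + (d - 1) * k) * 2 ^ k"
    by (simp add: power_mult_distrib power_add power_mult)
  also have "\<dots> \<le> 2 powr (3 / 5 * real (m + (d - 1) * k)) * 2 powr real k"
    by (intro mult_mono three_halves_power_le) (auto simp: powr_realpow)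
  also have "\<dots> = 2 powr (3 / 5 * (real m + (real d - 1) * real k) + real k)"
    using d by (simp add: powr_add of_nat_diff)
  also have "\<dots> \<le> 2 powr (real N * ((2 * (real d)\<^sup>2 - real d) / 3) - real N / 5 + 3 * real d / 2 + 3 / 5)"
  proof (rule powr_mono)
    \<comment> \<open>\<open>R\<close> is the real form of the bound on the free facets. Its summand
      2, together with the rounding in \<open>k\<close>, produces
      \<open>3 * real d / 2 + 3 / 5\<close>.\<close>
    define R where "R = real N * (real d - 1) + 2"
    have "n \<le> N * (d - 1) + 2"
    proof -
      obtain e where e: "d = Suc e" using d by (cases d) auto
      show ?thesis using n N unfolding e by (simp add: algebra_simps)
    qed
    then have "real n \<le> real (N * (d - 1) + 2)" by (rule of_nat_mono)
    then have nR: "real n \<le> R" using d by (simp add: R_def of_nat_diff)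
    have k: "real k \<le> (R + 1) / 2"
    proof -
      have "2 * k \<le> n + 1" unfolding k_def by simp
      then have "2 * real k \<le> real n + 1" by linarith
      then show ?thesis using nR by simp
    qed
    have m: "real m \<le> real d * R / 2"
    proof -
      have "2 * m \<le> d * n" unfolding m_def by simp
      then have "2 * real m \<le> real d * real n" by (metis of_nat_le_iff of_nat_mult of_nat_numeral)
      also have "\<dots> \<le> real d * R" using nR by (intro mult_left_mono) auto
      finally show ?thesis by simp
    qed
    have "(real d - 1) * real k \<le> (real d - 1) * ((R + 1) / 2)" using k d by (intro mult_left_mono) auto
    then have "3 / 5 * (real m + (real d - 1) * real k) + real k
        \<le> 3 / 5 * (real d * R / 2 + (real d - 1) * ((R + 1) / 2)) + (R + 1) / 2"
      using k m d by (intro add_mono mult_left_mono) auto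
    also have "\<dots> = real N * ((real d - 1) * (3 * real d / 5 + 1 / 5)) + 3 * real d / 2 + 3 / 5"
      unfolding R_def by (simp add: field_simps)
    also have "\<dots> \<le> real N * ((2 * (real d)\<^sup>2 - real d) / 3 - 1 / 5) + 3 * real d / 2 + 3 / 5"
    proof -
      have "(real d - 1) * (3 * real d / 5 + 1 / 5) \<le> (2 * (real d)\<^sup>2 - real d) / 3 - 1 / 5"
        by (simp add: field_simps power2_eq_square)
      then show ?thesis by (simp add: mult_left_mono)
    qed
    also have "\<dots> = real N * ((2 * (real d)\<^sup>2 - real d) / 3) - real N / 5 + 3 * real d / 2 + 3 / 5"
      by (simp add: algebra_simps)
    finally show "3 / 5 * (real m + (real d - 1) * real k) + real k \<le>
      real N * ((2 * (real d)\<^sup>2 - real d) / 3) - real N / 5 + 3 * real d / 2 + 3 / 5" .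
  qed simp
  finally show ?thesis unfolding k_def m_def .
qed

text \<open>The saving N/5 must pay for d + 1, which comes from \<open>y ^ (d + 1)\<close> with
  \<open>y \<le> 2\<close>, and for 3d/2 + 3/5 from the gluings. This needs N at least 25d/2 + 8,
  rounded up to \<open>13 * d + 8\<close>.\<close>

lemma card_codes_le:
  assumes d: "d \<ge> 2" and N: "N \<ge> 13 * d + 8"
  shows "finite (codes d N) \<and> real (card (codes d N)) \<le>
    (real d * (real d / (real d - 1)) ^ (d - 1) * 2 powr ((2 * (real d)\<^sup>2 - real d) / 3)) ^ N"
proof -
  define q where "q = real d * (real d / (real d - 1)) ^ (d - 1)"
  \<comment> \<open>This \<open>y\<close> minimizes y^d / (y - 1), the reciprocal of the best weight
    \<open>x\<close> when a positive decision opens d others; the minimum is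
    \<open>q\<close>.\<close>
  define y where "y = real d / (real d - 1)"
  define x2 where "x2 = (1 / 2) / (3 / 2 :: real) ^ (d - 1)"
  define b where "b = (2 * (real d)\<^sup>2 - real d) / 3"
  define B where "B = (2::real) powr (real N * b - real N / 5 + 3 * real d / 2 + 3 / 5)"
  have y: "y \<ge> 1" "y \<le> 2" using d by (auto simp: y_def field_simps)
  have "q \<ge> real d * 1" unfolding q_def using y(1) by (intro mult_left_mono one_le_power) (auto simp: y_def)
  then have q: "q \<ge> 1" using d by linarith
  have "1 + (1 / q) * y ^ d = y"
  proof -
    have "y ^ d = y * y ^ (d - 1)" using d by (simp add: power_eq_if)
    then have "(1 / q) * y ^ d = y / real d" using y d by (simp add: q_def flip: y_def)
    also have "\<dots> = y - 1" using d by (simp add: y_def field_simps)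
    finally show ?thesis by simp
  qed
  then have trees: "finite {W. simplex_tree d W \<and> card W = N}"
    "real (card {W. simplex_tree d W \<and> card W = N}) \<le> y ^ (d + 1) / (1 / q) ^ N"
    using simplex_trees_count[of "1 / q" y d N] q y by auto
  have x2: "x2 > 0" "x2 \<le> 1" "1 + x2 * (3 / 2) ^ (d - 1) \<le> 3 / 2"
  proof -
    have "(1::real) \<le> (3 / 2) ^ (d - 1)" by (rule one_le_power) simp
    then have "1 / (3 / 2 :: real) ^ (d - 1) \<le> 1" by simp
    moreover have "x2 = 1 / 2 * (1 / (3 / 2) ^ (d - 1))" by (simp add: x2_def)
    ultimately show "x2 \<le> 1" by linarith
  qed (simp_all add: x2_def)
  have gluings: "finite {M. lc_gluing d W (tree_gluing W) M} \<and>
      real (card {M. lc_gluing d W (tree_gluing W) M}) \<le> B"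
    if W: "W \<in> {W. simplex_tree d W \<and> card W = N}" for W
  proof -
    define n where "n = card (W \<times> {..d} - glued (tree_gluing W))"
    have st: "simplex_tree d W" "card W = N" using W by auto
    have fW: "finite W" using st unfolding simplex_tree_def by simp
    have "finite {M. lc_gluing d W (tree_gluing W) M} \<and>
      real (card {M. lc_gluing d W (tree_gluing W) M}) \<le> (3 / 2) ^ (d * n div 2) / x2 ^ ((n + 1) div 2)"
      by (rule lc_gluings_count[OF x2(1,2) _ x2(3) gluing_set_tree_gluing[OF st(1)] fW n_def]) simp
    moreover have "(3 / 2) ^ (d * n div 2) / x2 ^ ((n + 1) div 2) \<le> B"
      unfolding B_def b_def x2_def
      by (rule gluing_bound[OF d]) (use N card_glued_tree_gluing[OF st(1)] st(2) in \<open>simp_all add: n_def\<close>)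
    ultimately show ?thesis by auto
  qed
  have fin: "finite (codes d N)" unfolding codes_def using trees(1) gluings by (intro finite_SigmaI) auto
  have "real (card (codes d N)) \<le> y ^ (d + 1) / (1 / q) ^ N * B"
    unfolding codes_def by (rule card_Sigma_le[OF trees(1) _ trees(2)]) (use gluings in \<open>auto simp: B_def\<close>)
  also have "\<dots> = q ^ N * (y ^ (d + 1) * B)" by (simp add: power_one_over)
  also have "\<dots> \<le> q ^ N * (2 powr b) ^ N"
  proof (intro mult_left_mono)
    have "y ^ (d + 1) \<le> 2 ^ (d + 1)" using y by (intro power_mono) auto
    also have "\<dots> = 2 powr (real d + 1)" by (metis of_nat_Suc Suc_eq_plus1 add.commute powr_realpow zero_less_numeral)
    finally have "y ^ (d + 1) * B \<le> 2 powr (real d + 1) * B" by (intro mult_right_mono) (simp_all add: B_def)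
    also have "\<dots> = 2 powr (real d + 1 + (real N * b - real N / 5 + 3 * real d / 2 + 3 / 5))"
      unfolding B_def by (rule powr_add[symmetric])
    also have "\<dots> \<le> 2 powr (real N * b)"
    proof (rule powr_mono)
      have "real (13 * d + 8) \<le> real N" using N by (rule of_nat_mono)
      then show "real d + 1 + (real N * b - real N / 5 + 3 * real d / 2 + 3 / 5) \<le> real N * b" by simp
    qed simp
    also have "\<dots> = (2 powr b) ^ N" by (simp add: powr_power mult.commute)
    finally show "y ^ (d + 1) * B \<le> (2 powr b) ^ N" .
  qed (use q in simp)
  also have "\<dots> = (q * 2 powr b) ^ N" by (simp add: power_mult_distrib)
  finally show ?thesis using fin unfolding q_def b_def by simp
qed

theorem theorem4p4:
  fixes d :: nat
  assumes "d \<ge> 2"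
  shows
    "(\<forall>\<^sub>F N in sequentially.
        finite (isomorphism_types (LC_spheres d N)) \<and>
        real (card (isomorphism_types (LC_spheres d N)))
          \<le> (real d * (real d / (real d - 1)) ^ (d - 1) * 2 powr ((2 * (real d)\<^sup>2 - real d) / 3)) ^ N) \<and>
     (\<forall>\<^sub>F N in sequentially.
        finite (isomorphism_types (LC_balls d N)) \<and>
        real (card (isomorphism_types (LC_balls d N)))
          \<le> (real d * (real d / (real d - 1)) ^ (d - 1) * 2 powr ((2 * (real d)\<^sup>2 - real d) / 3)) ^ N)"
proof -
  have bound: "\<forall>\<^sub>F N in sequentially.
      finite (isomorphism_types (S N)) \<and> real (card (isomorphism_types (S N))) \<le>
        (real d * (real d / (real d - 1)) ^ (d - 1) * 2 powr ((2 * (real d)\<^sup>2 - real d) / 3)) ^ N"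
    if S: "\<And>N C. C \<in> S N \<Longrightarrow> locally_constructible d C \<and> card (facets d C) = N" for S
  proof (rule eventually_sequentiallyI[of "13 * d + 8"])
    fix N :: nat assume N: "13 * d + 8 \<le> N"
    note codes = card_codes_le[OF assms N]
    have types: "finite (isomorphism_types (S N)) \<and> card (isomorphism_types (S N)) \<le> card (codes d N)"
      by (rule isomorphism_types_le_codes[OF assms]) (use codes S in auto)
    then have "real (card (isomorphism_types (S N))) \<le> real (card (codes d N))" by simp
    with types codes show "finite (isomorphism_types (S N)) \<and> real (card (isomorphism_types (S N))) \<le>
        (real d * (real d / (real d - 1)) ^ (d - 1) * 2 powr ((2 * (real d)\<^sup>2 - real d) / 3)) ^ N"
      by linarith
  qed
  show ?thesis
  proof
    show "\<forall>\<^sub>F N in sequentially.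
        finite (isomorphism_types (LC_spheres d N)) \<and>
        real (card (isomorphism_types (LC_spheres d N)))
          \<le> (real d * (real d / (real d - 1)) ^ (d - 1) * 2 powr ((2 * (real d)\<^sup>2 - real d) / 3)) ^ N"
      by (rule bound) (simp add: LC_spheres_def)
    show "\<forall>\<^sub>F N in sequentially.
        finite (isomorphism_types (LC_balls d N)) \<and>
        real (card (isomorphism_types (LC_balls d N)))
          \<le> (real d * (real d / (real d - 1)) ^ (d - 1) * 2 powr ((2 * (real d)\<^sup>2 - real d) / 3)) ^ N"
      by (rule bound) (simp add: LC_balls_def)
  qed
qed

end
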